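(* Let $(\Gamma,\mu)$ be a weighted graph satisfying condition $(p_0)$. Then the following five conditions are equivalent (each condition means that there exist constants $C,\delta>0$, respectively $C>0$, respectively $c,C>0$ and $\beta>1$, depending only on $(\Gamma,\mu)$, such that the stated inequality holds for all $x,y\in\Gamma$, all $R>0$, all integers $n\ge 1$, and all nonempty sets $D\subset A\subset B$, where $B=B(x,3R)$): (E) $\displaystyle \overline{E}(A)\le C\,E(x,R)\left(\frac{\mu(A)}{\mu(B)}\right)^{\delta}$; (FK) $\displaystyle \lambda(A)^{-1}\le C\,E(x,R)\left(\frac{\mu(A)}{\mu(B)}\right)^{\delta}$; ($\rho$) $\displaystyle \rho(D,A)\,\mu(D)\le C\,E(x,R)\left(\frac{\mu(A)}{\mu(B)}\right)^{\delta}$; (DUE) $(\Gamma,\mu)$ satisfies (VD) and (TC), and $\displaystyle p_n(x,x)\le \frac{C}{V(x,e(x,n))}$; (UE) $(\Gamma,\mu)$ satisfies (VD) and (TC), and $\displaystyle p_n(x,y)\le \frac{C}{V(x,e(x,n))}\exp\left(-c\left(\frac{E(x,d(x,y))}{n}\right)^{\frac{1}{\beta-1}}\right)$.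
   Context: $\Gamma$ is a countable infinite connected graph with symmetric weights $\mu_{x,y}=\mu_{y,x}>0$ on edges $x\sim y$ (and $\mu_{x,y}=0$ otherwise); $\mu(x)=\sum_{y\sim x}\mu_{x,y}$ and $\mu(A)=\sum_{y\in A}\mu(y)$. $d$ is the graph distance, $B(x,R)=\{y\in\Gamma: d(x,y)<R\}$, $V(x,R)=\mu(B(x,R))$. The pair $(\Gamma,\mu)$ is called a weighted graph. Random walk: $X_n$ is the Markov chain on $\Gamma$ with transition probabilities $P(x,y)=\mu_{x,y}/\mu(x)$; $P_n(x,y)=\mathbb P(X_n=y\mid X_0=x)$; the heat kernel is $p_n(x,y)=P_n(x,y)/\mu(y)$. Condition $(p_0)$: there is $p_0>0$ with $\mu_{x,y}/\mu(x)\ge p_0$ for all $x\sim y$. Exit times: $T_A=\min\{k\ge 0: X_k\in\Gamma\setminus A\}$, $E_x(A)=\mathbb E(T_A\mid X_0=x)$, $E(x,R)=E_x(B(x,R))$ (so $E(x,0)=0$), $\overline E(A)=\max_{x\in A}E_x(A)$. $e(x,n)=\min\{r\in\mathbb N: E(x,r)\ge n\}$ is the inverse of $E(x,\cdot)$. Dirichlet form: $\mathcal E(f,f)=\frac12\sum_{x,y\in\Gamma}\mu_{x,y}(f(x)-f(y))^2$, $(f,f)=\sum_x f(x)^2\mu(x)$. For finite nonempty $A$, $\lambda(A)=\inf\{\mathcal E(f,f)/(f,f): f\neq 0,\ f=0 \text{ outside } A\}$ (the smallest eigenvalue of minus the Laplacian $\Delta=P-I$ with Dirichlet boundary condition on $A$).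 Resistance: for disjoint sets $A_1,A_2$, $\rho(A_1,A_2)=\left(\inf\{\mathcal E(f,f): f|_{A_1}=1,\ f|_{A_2}=0\}\right)^{-1}$. For $D\subset A$, the notation $\rho(D,A)$ means $\rho(D,\Gamma\setminus A)$. (VD): there is $D_V>0$ with $V(x,2R)\le D_V V(x,R)$ for all $x\in\Gamma$, $R>0$. (TC): there is $C>1$ with $E(y,2R)\le C\,E(x,R)$ for all $x\in\Gamma$, $R>0$, $y\in B(x,R)$. *)

theory Defs
  imports "HOL-Probability.Probability"
begin

text \<open>
  The vertex set is the whole type \<^typ>\<open>'a\<close>, and the weight function \<open>w\<close> determines the edges:
  \<open>x \<sim> y\<close> iff \<open>w x y > 0\<close>.  Loops are not excluded.  Summability of the weights at a vertex is what
  makes \<open>\<mu>(x)\<close> a real number; local finiteness is not assumed, but it follows from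
  condition \<open>(p\<^sub>0)\<close> below.
\<close>

locale weighted_graph =
  fixes w :: "'a \<Rightarrow> 'a \<Rightarrow> real"
  assumes countable_vertices: "countable (UNIV :: 'a set)"
    and infinite_vertices: "infinite (UNIV :: 'a set)"
    and weight_sym: "w x y = w y x"
    and weight_nonneg: "0 \<le> w x y"
    and connected: "(x, y) \<in> {(u, v). 0 < w u v}\<^sup>*"
    and weight_summable: "(\<lambda>y. w x y) summable_on {y. 0 < w x y}"
begin

subsection \<open>Measure, distance and balls\<close>

definition adj :: "('a \<times> 'a) set" where
  "adj = {(x, y). 0 < w x y}"

definition \<mu> :: "'a \<Rightarrow> real" where
  "\<mu> x = (\<Sum>\<^sub>\<infinity>y\<in>{y. (x, y) \<in> adj}. w x y)"

text \<open>Only used for subsets of balls, which are finite under \<open>(p\<^sub>0)\<close>.\<close>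

definition vol :: "'a set \<Rightarrow> real" where
  "vol A = (\<Sum>\<^sub>\<infinity>y\<in>A. \<mu> y)"

definition d :: "'a \<Rightarrow> 'a \<Rightarrow> nat" where
  "d x y = (LEAST n. (x, y) \<in> adj ^^ n)"

definition B :: "'a \<Rightarrow> real \<Rightarrow> 'a set" where
  "B x R = {y. real (d x y) < R}"

definition V :: "'a \<Rightarrow> real \<Rightarrow> real" where
  "V x R = vol (B x R)"

definition P :: "'a \<Rightarrow> 'a \<Rightarrow> real" where
  "P x y = w x y / \<mu> x"

definition cond_p0 :: bool where
  "cond_p0 \<longleftrightarrow> (\<exists>p\<^sub>0>0. \<forall>x y. (x, y) \<in> adj \<longrightarrow> P x y \<ge> p\<^sub>0)"

subsection \<open>The random walk\<close>

lemma \<mu>_pos: "0 < \<mu> x"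
proof -
  obtain y where "y \<noteq> x"
    using infinite_vertices by (metis ex_new_if_finite finite.emptyI finite_insert insertCI)
  with connected[of x y] obtain z where z: "0 < w x z"
    by (auto elim: converse_rtranclE)
  have "w x z = (\<Sum>\<^sub>\<infinity>y\<in>{z}. w x y)"
    by simp
  also have "\<dots> \<le> \<mu> x"
    unfolding \<mu>_def using z weight_summable[of x]
    by (intro infsum_mono2) (auto simp: adj_def)
  finally show ?thesis
    using z by simp
qed

lemma P_nonneg: "0 \<le> P x y"
  using \<mu>_pos[of x] weight_nonneg[of x y] by (simp add: P_def)

lemma nn_integral_P: "(\<integral>\<^sup>+y. ennreal (P x y) \<partial>count_space UNIV) = 1"
proof -
  have "((\<lambda>y. w x y) has_sum \<mu> x) {y. (x, y) \<in> adj}"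
    using weight_summable[of x] by (simp add: \<mu>_def adj_def)
  then have "((\<lambda>y. w x y) has_sum \<mu> x) UNIV"
    by (rule has_sum_cong_neutral[THEN iffD1, rotated 3])
       (use weight_nonneg in \<open>auto simp: adj_def order.order_iff_strict\<close>)
  then have "((\<lambda>y. w x y * (1 / \<mu> x)) has_sum (\<mu> x * (1 / \<mu> x))) UNIV"
    by (rule has_sum_cmult_left)
  then have *: "(P x has_sum 1) UNIV"
    using \<mu>_pos[of x] by (simp add: P_def[abs_def])
  have "(\<lambda>y. norm (P x y)) summable_on UNIV"
    using * P_nonneg by (simp add: has_sum_imp_summable)
  then have summable: "Infinite_Set_Sum.abs_summable_on (P x) UNIV"
    by (simp only: abs_summable_equivalent)
  then have "(\<integral>\<^sup>+y. ennreal (P x y) \<partial>count_space UNIV) = ennreal (infsetsum (P x) UNIV)"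
    by (intro nn_integral_conv_infsetsum) (auto simp: P_nonneg)
  then show ?thesis
    using infsetsum_infsum[OF summable] infsumI[OF *] by simp
qed

definition step :: "'a \<Rightarrow> 'a pmf" where
  "step x = embed_pmf (P x)"

lemma pmf_step: "pmf (step x) y = P x y"
  unfolding step_def by (rule pmf_embed_pmf[OF P_nonneg nn_integral_P])

text \<open>
  Law of \<open>X\<^sub>n\<close> given \<open>X\<^sub>0, \<dots>, X\<^sub>n\<^sub>-\<^sub>1\<close>, for the walk started at \<open>x\<close>; the Ionescu-Tulcea
  theorem turns these kernels into the law of the whole trajectory.
\<close>

definition walk_kernel :: "'a \<Rightarrow> nat \<Rightarrow> (nat \<Rightarrow> 'a) \<Rightarrow> 'a measure" where
  "walk_kernel x n \<omega> =
     measure_pmf (case n of 0 \<Rightarrow> return_pmf x | Suc m \<Rightarrow> step (\<omega> m))"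

sublocale RW: Ionescu_Tulcea "walk_kernel x" "\<lambda>_. count_space UNIV" for x
proof (rule Ionescu_Tulcea.intro)
  fix n
  show "walk_kernel x n \<in>
      measurable (PiM {0..<n} (\<lambda>_. count_space UNIV)) (subprob_algebra (count_space UNIV))"
  proof (cases n)
    case 0
    then show ?thesis
      by (auto simp: walk_kernel_def[abs_def] measure_pmf_in_subprob_algebra)
  next
    case (Suc m)
    have "(\<lambda>\<omega>. measure_pmf (step (\<omega> m))) \<in>
        measurable (PiM {0..<n} (\<lambda>_. count_space UNIV)) (subprob_algebra (count_space UNIV))"
      by (rule measurable_compose[OF measurable_component_singleton])
         (auto simp: Suc intro: measure_pmf_in_subprob_algebra)
    then show ?thesis
      by (simp add: walk_kernel_def[abs_def] Suc)
  qed
next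
  show "prob_space (walk_kernel x n \<omega>)" for n \<omega>
    by (simp add: walk_kernel_def measure_pmf.prob_space_axioms)
qed

definition walk :: "'a \<Rightarrow> (nat \<Rightarrow> 'a) measure" where
  "walk x = RW.PF.lim x"

lemma space_walk: "space (walk x) = UNIV"
  by (auto simp: walk_def space_PiM)

lemma sets_walk: "sets (walk x) = sets (PiM UNIV (\<lambda>_. count_space UNIV))"
  by (simp add: walk_def)

lemma emeasure_walk:
  "emeasure (walk x) {\<omega>. \<forall>k<n. \<omega> k = \<xi> k} =
     (\<Prod>k<n. ennreal (pmf (case k of 0 \<Rightarrow> return_pmf x | Suc m \<Rightarrow> step (\<xi> m)) (\<xi> k)))"
    (is "_ = (\<Prod>k<n. ?q k)")
proof -
  let ?M = "\<lambda>_::nat. count_space (UNIV :: 'a set)"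
  let ?S = "\<lambda>n. PiE {0..<n} (\<lambda>k. {\<xi> k})"
  let ?u = "\<lambda>_::nat. undefined :: 'a"
  have S: "?S n \<in> sets (PiM {0..<n} ?M)" for n
    by (rule sets_PiM_I_finite) auto
  have C: "emeasure (RW.C x 0 n ?u) (?S n) = (\<Prod>k<n. ?q k)" for n
  proof (induction n)
    case 0
    show ?case
      by (simp add: space_PiM PiM_empty)
  next
    case (Suc n)
    have eP: "emeasure (RW.eP x n \<omega>) (?S (Suc n)) = indicator (?S n) \<omega> * ?q n"
      if \<omega>: "\<omega> \<in> space (PiM {0..<n} ?M)" for \<omega>
    proof -
      have "(\<lambda>y. fun_upd \<omega> n y) -` ?S (Suc n) \<inter> space (count_space UNIV) =
          (if \<omega> \<in> ?S n then {\<xi> n} else {})"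
        using \<omega> by (auto simp: space_PiM PiE_iff extensional_def less_Suc_eq split: if_splits)
      moreover have "emeasure (walk_kernel x n \<omega>) {\<xi> n} = ?q n" if "\<omega> \<in> ?S n"
        using that by (cases n) (auto simp: walk_kernel_def emeasure_pmf_single PiE_iff)
      ultimately show ?thesis
        by (auto simp: RW.emeasure_eP[OF \<omega> S])
    qed
    have "emeasure (RW.C x 0 (Suc n) ?u) (?S (Suc n)) =
        (\<integral>\<^sup>+\<omega>. emeasure (RW.eP x n \<omega>) (?S (Suc n)) \<partial>RW.C x 0 n ?u)"
      by (simp, rule emeasure_bind[OF _ _ S])
         (auto simp: RW.space_C space_PiM_empty_iff intro!: measurable_cong_sets[OF RW.sets_C refl, THEN equalityD2, THEN subsetD] RW.measurable_eP)
    also have "\<dots> = (\<integral>\<^sup>+\<omega>. ?q n * indicator (?S n) \<omega> \<partial>RW.C x 0 n ?u)"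
      by (intro nn_integral_cong) (simp add: RW.space_C eP mult.commute)
    also have "\<dots> = ?q n * emeasure (RW.C x 0 n ?u) (?S n)"
      using S by (subst nn_integral_cmult_indicator) (auto simp: RW.sets_C)
    finally show ?case
      by (simp add: Suc mult.commute)
  qed
  have "{\<omega>. \<forall>k<n. \<omega> k = \<xi> k} = prod_emb UNIV ?M {0..<n} (?S n)"
    by (auto simp: prod_emb_def PiE_iff)
  then have "emeasure (walk x) {\<omega>. \<forall>k<n. \<omega> k = \<xi> k} = emeasure (RW.CI x {0..<n}) (?S n)"
    by (simp only: walk_def) (rule RW.lim[OF _ S], simp)
  also have "\<dots> = emeasure (RW.C x 0 n ?u) (?S n)"
    by (subst RW.emeasure_CI[OF order_refl S]) (simp add: prod_emb_id)
  finally show ?thesis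
    by (simp add: C)
qed

lemma prob_space_walk: "prob_space (walk x)"
  using emeasure_walk[of x 0] by (intro prob_spaceI) (simp add: space_walk)

text \<open>The coordinates \<open>X\<^sub>n(\<omega>) = \<omega> n\<close> form the Markov chain with transition function \<open>P\<close>.\<close>

lemma measure_walk:
  "measure (walk x) {\<omega>. \<forall>k\<le>n. \<omega> k = \<xi> k} =
     (if \<xi> 0 = x then \<Prod>k<n. P (\<xi> k) (\<xi> (Suc k)) else 0)"
  using emeasure_walk[of x "Suc n" \<xi>]
  by (simp add: less_Suc_eq_le prod.lessThan_Suc_shift pmf_step prod_ennreal P_nonneg prod_nonneg
      measure_def del: prod.lessThan_Suc)

definition p :: "nat \<Rightarrow> 'a \<Rightarrow> 'a \<Rightarrow> real" where
  "p n x y = measure (walk x) {\<omega> \<in> space (walk x). \<omega> n = y} / \<mu> y"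

text \<open>
  Mean exit times, energies and resistances take values in \<^typ>\<open>ennreal\<close>, so that an infinite
  expectation or a divergent energy is \<open>\<infinity>\<close>.
\<close>

definition exit_time :: "'a set \<Rightarrow> (nat \<Rightarrow> 'a) \<Rightarrow> enat" where
  "exit_time A \<omega> = (INF k\<in>{k. \<omega> k \<notin> A}. enat k)"

definition mean_exit :: "'a \<Rightarrow> 'a set \<Rightarrow> ennreal" where
  "mean_exit x A = (\<integral>\<^sup>+\<omega>. ennreal_of_enat (exit_time A \<omega>) \<partial>walk x)"

definition E :: "'a \<Rightarrow> real \<Rightarrow> ennreal" where
  "E x R = mean_exit x (B x R)"

text \<open>The supremum is a maximum, since it is only taken over finite nonempty sets.\<close>

definition max_exit :: "'a set \<Rightarrow> ennreal" where
  "max_exit A = (SUP x\<in>A. mean_exit x A)"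

definition e :: "'a \<Rightarrow> nat \<Rightarrow> nat" where
  "e x n = (LEAST r. E x (real r) \<ge> of_nat n)"

subsection \<open>Dirichlet form, eigenvalue and resistance\<close>

definition dirichlet_form :: "('a \<Rightarrow> real) \<Rightarrow> ennreal" where
  "dirichlet_form f = (\<Sum>\<^sub>\<infinity>(x, y)\<in>UNIV. ennreal (w x y * (f x - f y)\<^sup>2)) / 2"

definition norm2 :: "('a \<Rightarrow> real) \<Rightarrow> ennreal" where
  "norm2 f = (\<Sum>\<^sub>\<infinity>x\<in>UNIV. ennreal ((f x)\<^sup>2 * \<mu> x))"

definition eigenvalue :: "'a set \<Rightarrow> ennreal" where
  "eigenvalue A = (INF f\<in>{f. f \<noteq> (\<lambda>_. 0) \<and> (\<forall>x. x \<notin> A \<longrightarrow> f x = 0)}.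
     dirichlet_form f / norm2 f)"

definition resistance :: "'a set \<Rightarrow> 'a set \<Rightarrow> ennreal" where
  "resistance A\<^sub>1 A\<^sub>2 = inverse (INF f\<in>{f. (\<forall>x\<in>A\<^sub>1. f x = 1) \<and> (\<forall>x\<in>A\<^sub>2. f x = 0)}.
     dirichlet_form f)"

subsection \<open>The conditions\<close>

text \<open>Radii \<open>R\<close> range over the positive reals, and inclusions of sets need not be strict.\<close>

definition cond_VD :: bool where
  "cond_VD \<longleftrightarrow> (\<exists>D>0. \<forall>x R. R > 0 \<longrightarrow> V x (2 * R) \<le> D * V x R)"

definition cond_TC :: bool where
  "cond_TC \<longleftrightarrow> (\<exists>C>1. \<forall>x R. R > 0 \<longrightarrow> (\<forall>y\<in>B x R. E y (2 * R) \<le> ennreal C * E x R))"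

definition cond_E :: bool where
  "cond_E \<longleftrightarrow> (\<exists>C>0. \<exists>\<delta>>0. \<forall>x R A. R > 0 \<longrightarrow> A \<noteq> {} \<longrightarrow> A \<subseteq> B x (3 * R) \<longrightarrow>
     max_exit A \<le> ennreal C * E x R * ennreal ((vol A / V x (3 * R)) powr \<delta>))"

definition cond_FK :: bool where
  "cond_FK \<longleftrightarrow> (\<exists>C>0. \<exists>\<delta>>0. \<forall>x R A. R > 0 \<longrightarrow> A \<noteq> {} \<longrightarrow> A \<subseteq> B x (3 * R) \<longrightarrow>
     inverse (eigenvalue A) \<le> ennreal C * E x R * ennreal ((vol A / V x (3 * R)) powr \<delta>))"

definition cond_rho :: bool where
  "cond_rho \<longleftrightarrow> (\<exists>C>0. \<exists>\<delta>>0. \<forall>x R A D.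
     R > 0 \<longrightarrow> D \<noteq> {} \<longrightarrow> D \<subseteq> A \<longrightarrow> A \<subseteq> B x (3 * R) \<longrightarrow>
     resistance D (UNIV - A) * ennreal (vol D)
       \<le> ennreal C * E x R * ennreal ((vol A / V x (3 * R)) powr \<delta>))"

definition cond_DUE :: bool where
  "cond_DUE \<longleftrightarrow> cond_VD \<and> cond_TC \<and>
     (\<exists>C>0. \<forall>x n. n \<ge> 1 \<longrightarrow> p n x x \<le> C / V x (real (e x n)))"

text \<open>\<^term>\<open>enn2real\<close> is harmless here: mean exit times from balls are finite under \<open>(p\<^sub>0)\<close>.\<close>

definition cond_UE :: bool where
  "cond_UE \<longleftrightarrow> cond_VD \<and> cond_TC \<and>
     (\<exists>c>0. \<exists>C>0. \<exists>\<beta>>1. \<forall>x y n. n \<ge> 1 \<longrightarrow>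
        p n x y \<le> C / V x (real (e x n)) *
          exp (- c * (enn2real (E x (real (d x y))) / real n) powr (1 / (\<beta> - 1))))"

end

end

theory Submission
  imports Defs
begin

text \<open>
  All conditions are read on finite sets, where the walk killed outside \<open>A\<close> is a finite symmetric
  matrix.  The mean exit time \<open>u\<close> solves \<open>u - Pu = 1\<close>, so it is a positive supersolution and bounds
  \<open>1/\<lambda>(A)\<close> from above, whence (E) gives (FK); testing \<open>\<lambda>(A)\<close> with functions equal to \<open>1\<close> on \<open>D\<close>
  gives (\<open>\<rho>\<close>), and (\<open>\<rho>\<close>) gives (FK) back by Maz'ya's truncation.  Nash's argument turns (FK) into a
  bound for the heat kernel killed outside a ball; comparing its total mass with \<open>\<mu>(A)\<close> shows that
  half of the walks have left \<open>A\<close> by the time predicted by (E).  Taking balls for \<open>A\<close> in (E) yields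
  (VD) and (TC), and (TC) alone yields a stretched exponential bound for the probability of leaving
  a ball early, by chaining through smaller balls.  This bound removes the killing from the heat
  kernel estimate, which is (DUE), and it provides the exponential factor in (UE) when a path from
  \<open>x\<close> to \<open>y\<close> is cut at its midpoint.
\<close>

text \<open>The scale \<open>E(x,R)\<close> depends on the centre and follows no power law, so radii
  and volumes at different points are not directly comparable. (TC) lets the centre move and forces
  \<open>E(x,R) / E(x,r)\<close> to be at least of order a positive power of \<open>R / r\<close>.
  Together with (VD) this makes \<open>V(x,e(x,n))\<close> change by at most a power of
  \<open>1 + E(x,R)/n\<close> when the centre moves by \<open>R\<close>, a loss that a stretched
  exponential outweighs. The walk may be periodic, so return densities are monotone along even times
  only, and energies are estimated for sums of two consecutive kernels. (FK) controls kernels killed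
  outside a ball. Undoing the killing requires a bound for the walks that leave and come back, which
  is the very estimate being proved. The circle is broken by taking the ball so large that leaving
  it in time is unlikely enough for this term to enter with factor 1/2. The way back from (DUE) to
  (E) compares mass with \<mu>(A) exactly as the one from (FK) does.\<close>

locale weighted_graph_p0 = weighted_graph w for w :: "'a \<Rightarrow> 'a \<Rightarrow> real" +
  assumes p0: cond_p0
begin

section \<open>Neighbourhoods and local finiteness\<close>

definition nb :: "'a \<Rightarrow> 'a set" where
  "nb x = {y. 0 < w x y}"

lemma nb_iff: "y \<in> nb x \<longleftrightarrow> (x, y) \<in> adj"
  by (simp add: nb_def adj_def)

lemma nb_sym: "y \<in> nb x \<longleftrightarrow> x \<in> nb y"
  by (simp add: nb_def weight_sym)

lemma w_nb: "y \<notin> nb x \<Longrightarrow> w x y = 0"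
  using weight_nonneg[of x y] by (simp add: nb_def)

lemma P_nb: "y \<notin> nb x \<Longrightarrow> P x y = 0"
  by (simp add: P_def w_nb)

lemma P_pos: "y \<in> nb x \<Longrightarrow> 0 < P x y"
  using \<mu>_pos[of x] by (simp add: P_def nb_def)

lemma p0E:
  obtains p0 where "0 < p0" "p0 \<le> 1" "\<And>x y. y \<in> nb x \<Longrightarrow> p0 \<le> P x y"
proof -
  obtain q where q: "0 < q" "\<forall>x y. (x, y) \<in> adj \<longrightarrow> P x y \<ge> q"
    using p0 by (auto simp: cond_p0_def)
  show ?thesis
    by (rule that[of "min q 1"]) (use q in \<open>auto simp: nb_iff min_le_iff_disj\<close>)
qed

lemma sum_P_le: "finite F \<Longrightarrow> (\<Sum>y\<in>F. P x y) \<le> 1"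
  using measure_measure_pmf_finite[of F "step x"] measure_pmf.prob_le_1[of "step x" F]
  by (simp add: pmf_step)

text \<open>Transition probabilities along edges are bounded below and sum to at most 1, which caps
  the number of neighbours.\<close>

lemma finite_nb: "finite (nb x)"
proof (rule ccontr)
  assume inf: "infinite (nb x)"
  obtain q where q: "0 < q" "q \<le> 1" "\<And>x y. y \<in> nb x \<Longrightarrow> q \<le> P x y"
    by (rule p0E) blast
  obtain n :: nat where n: "1 < real n * q"
    using q(1) reals_Archimedean3 by blast
  obtain F where F: "finite F" "card F = n" "F \<subseteq> nb x"
    using infinite_arbitrarily_large[OF inf] by blast
  have "real n * q \<le> (\<Sum>y\<in>F. P x y)"
    using sum_bounded_below[of F q "P x"] F q(3) by auto
  also have "\<dots> \<le> 1"
    by (rule sum_P_le[OF F(1)])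
  finally show False
    using n by simp
qed

lemma sum_nb_P: "(\<Sum>y\<in>nb x. P x y) = 1"
proof -
  have "set_pmf (step x) \<subseteq> nb x"
    by (metis P_nb pmf_step set_pmf_iff subsetI)
  then show ?thesis
    using sum_pmf_eq_1[OF finite_nb, of "step x" x] by (simp add: pmf_step)
qed

lemma \<mu>_nonneg: "0 \<le> \<mu> x"
  using \<mu>_pos[of x] by simp

lemma \<mu>_neq0 [simp]: "\<mu> x \<noteq> 0"
  using \<mu>_pos[of x] by simp

lemma \<mu>_P: "\<mu> x * P x y = w x y"
  by (simp add: P_def)

lemma sum_w_le: "finite F \<Longrightarrow> (\<Sum>y\<in>F. w x y) \<le> \<mu> x"
  using mult_left_mono[OF sum_P_le[of F x] \<mu>_nonneg[of x]]
  by (simp add: sum_distrib_left \<mu>_P)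

lemma sum_nb_w: "(\<Sum>y\<in>nb x. w x y) = \<mu> x"
proof -
  have "\<mu> x * (\<Sum>y\<in>nb x. P x y) = (\<Sum>y\<in>nb x. w x y)"
    by (simp only: sum_distrib_left \<mu>_P)
  then show ?thesis
    by (simp add: sum_nb_P)
qed

lemma vol_eq: "finite A \<Longrightarrow> vol A = (\<Sum>x\<in>A. \<mu> x)"
  by (simp add: vol_def)

lemma vol_mono: "finite B' \<Longrightarrow> A \<subseteq> B' \<Longrightarrow> vol A \<le> vol B'"
  by (simp add: vol_eq finite_subset sum_mono2 \<mu>_nonneg)

lemma vol_pos: "finite A \<Longrightarrow> A \<noteq> {} \<Longrightarrow> 0 < vol A"
  by (simp add: vol_eq sum_pos \<mu>_pos)

lemma vol_nonneg: "finite A \<Longrightarrow> 0 \<le> vol A"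
  by (simp add: vol_eq sum_nonneg \<mu>_nonneg)

subsection \<open>Distance\<close>

lemma adj_sym: "(x, y) \<in> adj \<longleftrightarrow> (y, x) \<in> adj"
  by (simp add: adj_def weight_sym)

lemma d_path: "(x, y) \<in> adj ^^ d x y"
proof -
  have "(x, y) \<in> adj\<^sup>*"
    using connected[of x y] by (simp add: adj_def)
  then obtain n where "(x, y) \<in> adj ^^ n"
    using rtrancl_imp_relpow by blast
  then show ?thesis
    unfolding d_def by (rule LeastI)
qed

lemma d_le: "(x, y) \<in> adj ^^ n \<Longrightarrow> d x y \<le> n"
  unfolding d_def by (rule Least_le)

lemma d_self [simp]: "d x x = 0"
  using d_le[of x x 0] by simp

lemma d_eq0_iff [simp]: "d x y = 0 \<longleftrightarrow> x = y"
  using d_path[of x y] by (metis d_self relpow_0_E)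

lemma d_triangle: "d x z \<le> d x y + d y z"
proof -
  have "(x, z) \<in> adj ^^ (d x y + d y z)"
    unfolding relpow_add using d_path[of x y] d_path[of y z] by blast
  then show ?thesis
    by (rule d_le)
qed

lemma adj_pow_sym: "(x, y) \<in> adj ^^ n \<Longrightarrow> (y, x) \<in> adj ^^ n"
proof (induction n arbitrary: y)
  case (Suc n)
  then obtain z where z: "(x, z) \<in> adj ^^ n" "(z, y) \<in> adj"
    by auto
  then have "(y, z) \<in> adj"
    using adj_sym by blast
  with Suc.IH[OF z(1)] show ?case
    by (rule relpow_Suc_I2[rotated])
qed simp

lemma d_sym: "d x y = d y x"
  by (rule antisym) (rule d_le, rule adj_pow_sym, rule d_path)+

lemma d_nb: "y \<in> nb x \<Longrightarrow> d x y \<le> 1"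
  using d_le[of x y 1] by (simp add: nb_iff)

lemma d_nb_le: "y \<in> nb z \<Longrightarrow> d x y \<le> d x z + 1"
  using d_triangle[of x y z] d_nb[of y z] by linarith

lemma finite_adj_pow: "finite {y. (x, y) \<in> adj ^^ n}"
proof (induction n)
  case (Suc n)
  have "{y. (x, y) \<in> adj ^^ Suc n} \<subseteq> (\<Union>z\<in>{z. (x, z) \<in> adj ^^ n}. nb z)"
    by (auto simp: nb_iff)
  moreover have "finite (\<Union>z\<in>{z. (x, z) \<in> adj ^^ n}. nb z)"
    using Suc by (intro finite_UN_I finite_nb)
  ultimately show ?case
    by (rule finite_subset)
qed simp

lemma finite_B [simp]: "finite (B x R)"
proof -
  have "B x R \<subseteq> (\<Union>n\<in>{..nat \<lceil>R\<rceil>}. {y. (x, y) \<in> adj ^^ n})"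
  proof
    fix y assume "y \<in> B x R"
    then have "real (d x y) < R"
      by (simp add: B_def)
    then have "d x y \<le> nat \<lceil>R\<rceil>"
      by linarith
    then show "y \<in> (\<Union>n\<in>{..nat \<lceil>R\<rceil>}. {y. (x, y) \<in> adj ^^ n})"
      using d_path[of x y] by auto
  qed
  then show ?thesis
    by (rule finite_subset) (auto intro: finite_adj_pow)
qed

lemma B_iff: "y \<in> B x R \<longleftrightarrow> real (d x y) < R"
  by (simp add: B_def)

lemma center_B: "0 < R \<Longrightarrow> x \<in> B x R"
  by (simp add: B_iff)

lemma B_mono: "r \<le> R \<Longrightarrow> B x r \<subseteq> B x R"
  by (auto simp: B_iff)

lemma B_subset: "real (d x y) + r \<le> R \<Longrightarrow> B y r \<subseteq> B x R"
proof
  fix z assume "real (d x y) + r \<le> R" "z \<in> B y r"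
  then show "z \<in> B x R"
    using d_triangle[of x z y] unfolding B_iff by linarith
qed

lemma B_le1: "0 < R \<Longrightarrow> R \<le> 1 \<Longrightarrow> B x R = {x}"
proof -
  assume R: "0 < R" "R \<le> 1"
  have "real (d x y) < R \<longleftrightarrow> y = x" for y
  proof (cases "y = x")
    case False
    then have "1 \<le> d x y"
      using d_eq0_iff[of x y] by (auto simp: Suc_le_eq simp del: d_eq0_iff)
    then show ?thesis
      using R False by simp
  qed (use R in simp)
  then show "B x R = {x}"
    unfolding B_def by blast
qed

lemma V_pos: "0 < R \<Longrightarrow> 0 < V x R"
  unfolding V_def by (rule vol_pos) (use center_B in auto)

lemma V_mono: "r \<le> R \<Longrightarrow> V x r \<le> V x R"
  unfolding V_def by (rule vol_mono) (auto simp: B_mono)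

lemma V_subset: "real (d x y) + r \<le> R \<Longrightarrow> V y r \<le> V x R"
  unfolding V_def by (rule vol_mono) (auto simp: B_subset)

lemma V_1: "0 < R \<Longrightarrow> R \<le> 1 \<Longrightarrow> V x R = \<mu> x"
  by (simp add: V_def B_le1 vol_eq)

subsection \<open>Walks killed outside a set\<close>

text \<open>Only the rows outside \<open>A\<close> are deleted; \<open>f\<close> is still summed
  over all neighbours. This is the restriction of \<open>P\<close> to \<open>A\<close> when
  \<open>f\<close> vanishes off \<open>A\<close>, which is why \<open>Q\<close> starts from
  \<open>res\<close>. \<open>T UNIV\<close> is \<open>P\<close> itself.\<close>

definition T :: "'a set \<Rightarrow> ('a \<Rightarrow> real) \<Rightarrow> 'a \<Rightarrow> real" where
  "T A f x = (if x \<in> A then \<Sum>y\<in>nb x. P x y * f y else 0)"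

definition res :: "'a set \<Rightarrow> ('a \<Rightarrow> real) \<Rightarrow> 'a \<Rightarrow> real" where
  "res A f x = (if x \<in> A then f x else 0)"

text \<open>The expectation of \<open>f(X\<^sub>n)\<close> over the walks that stay in \<open>A\<close> up to time \<open>n\<close>, as a function
  of the starting point.\<close>

definition Q :: "'a set \<Rightarrow> nat \<Rightarrow> ('a \<Rightarrow> real) \<Rightarrow> 'a \<Rightarrow> real" where
  "Q A n f = (T A ^^ n) (res A f)"

text \<open>The probability that the walk from \<open>x\<close> is in \<open>A\<close> at all times
  \<open>0, ..., n\<close>, that is, \<open>T_A > n\<close>.\<close>

abbreviation surv :: "'a set \<Rightarrow> nat \<Rightarrow> 'a \<Rightarrow> real" where
  "surv A n \<equiv> Q A n (\<lambda>_. 1)"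

lemma Q_0: "Q A 0 f = res A f"
  by (simp add: Q_def)

lemma Q_Suc: "Q A (Suc n) f = T A (Q A n f)"
  by (simp add: Q_def)

lemma T_out: "x \<notin> A \<Longrightarrow> T A f x = 0"
  by (simp add: T_def)

lemma T_in: "x \<in> A \<Longrightarrow> T A f x = (\<Sum>y\<in>nb x. P x y * f y)"
  by (simp add: T_def)

lemma Q_out: "x \<notin> A \<Longrightarrow> Q A n f x = 0"
  by (cases n) (simp_all add: Q_0 Q_Suc T_out res_def)

lemma res_id: "(\<And>x. x \<notin> A \<Longrightarrow> f x = 0) \<Longrightarrow> res A f = f"
  by (auto simp: res_def)

lemma res_Q [simp]: "res A (Q A n f) = Q A n f"
  by (rule res_id) (rule Q_out)

lemma res_UNIV [simp]: "res UNIV f = f"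
  by (rule res_id) simp

lemma Q_add: "Q A (m + n) f = Q A m (Q A n f)"
  by (simp add: Q_def[of A m] funpow_add Q_def[of A "m + n"]) (simp add: Q_def)

lemma Q_Suc2: "Q A (Suc n) f = Q A n (T A (res A f))"
  using Q_add[of A n 1 f] by (simp add: Q_0 Q_Suc)

lemma T_mono: "(\<And>y. f y \<le> g y) \<Longrightarrow> T A f x \<le> T A g x"
  by (auto simp: T_def intro!: sum_mono mult_left_mono P_nonneg)

lemma T_mono_nb:
  assumes "\<And>y. x \<in> A \<Longrightarrow> y \<in> nb x \<Longrightarrow> f y \<le> g y"
  shows "T A f x \<le> T A g x"
proof (cases "x \<in> A")
  case True
  then show ?thesis
    unfolding T_in[OF True] by (intro sum_mono mult_left_mono P_nonneg assms)
qed (simp add: T_out)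

lemma T_const: "x \<in> A \<Longrightarrow> T A (\<lambda>_. c) x = c"
  using sum_nb_P[of x] by (simp add: T_def flip: sum_distrib_right)

lemma T_add: "T A (\<lambda>x. f x + g x) x = T A f x + T A g x"
  by (simp add: T_def sum.distrib distrib_left)

lemma T_diff: "T A (\<lambda>x. f x - g x) x = T A f x - T A g x"
  by (simp add: T_def sum_subtractf right_diff_distrib)

lemma T_cmult: "T A (\<lambda>x. c * f x) x = c * T A f x"
  by (simp add: T_def sum_distrib_left mult.left_commute)

lemma T_nonneg: "(\<And>y. 0 \<le> f y) \<Longrightarrow> 0 \<le> T A f x"
  by (auto simp: T_def intro!: sum_nonneg mult_nonneg_nonneg P_nonneg)

lemma T_mono_set:
  assumes "A \<subseteq> A'" "\<And>y. 0 \<le> f y" "\<And>y. f y \<le> g y"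
  shows "T A f x \<le> T A' g x"
proof (cases "x \<in> A")
  case True
  then show ?thesis
    using assms by (auto simp: T_def intro!: sum_mono mult_left_mono P_nonneg)
next
  case False
  have "0 \<le> T A' g x"
    by (rule T_nonneg) (rule order_trans[OF assms(2,3)])
  with False show ?thesis
    by (simp add: T_out)
qed

lemma Q_mono: "(\<And>y. y \<in> A \<Longrightarrow> f y \<le> g y) \<Longrightarrow> Q A n f x \<le> Q A n g x"
proof (induction n arbitrary: x)
  case 0
  then show ?case by (simp add: Q_0 res_def)
next
  case (Suc n)
  then show ?case by (simp add: Q_Suc T_mono)
qed

lemma Q_nonneg: "(\<And>y. y \<in> A \<Longrightarrow> 0 \<le> f y) \<Longrightarrow> 0 \<le> Q A n f x"
proof (induction n arbitrary: x)
  case 0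
  then show ?case by (simp add: Q_0 res_def)
next
  case (Suc n)
  then show ?case by (simp add: Q_Suc T_nonneg)
qed

lemma Q_mono_set:
  assumes "A \<subseteq> A'" "\<And>y. 0 \<le> f y"
  shows "Q A n f x \<le> Q A' n f x"
proof (induction n arbitrary: x)
  case 0
  then show ?case using assms by (auto simp: Q_0 res_def)
next
  case (Suc n)
  then show ?case using assms by (simp add: Q_Suc T_mono_set Q_nonneg)
qed

lemma Q_add_fun: "Q A n (\<lambda>x. f x + g x) = (\<lambda>x. Q A n f x + Q A n g x)"
proof (induction n)
  case 0
  show ?case
    by (rule ext) (simp add: Q_0 res_def)
next
  case (Suc n)
  show ?case
    by (rule ext) (simp only: Q_Suc Suc T_add)
qed

lemma Q_cmult: "Q A n (\<lambda>x. c * f x) x = c * Q A n f x"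
proof (induction n arbitrary: x)
  case 0
  then show ?case by (auto simp: Q_0 res_def)
next
  case (Suc n)
  have "Q A n (\<lambda>x. c * f x) = (\<lambda>x. c * Q A n f x)"
    by (rule ext) (rule Suc)
  then show ?case by (simp only: Q_Suc T_cmult)
qed

lemma Q_const: "Q A n (\<lambda>_. c) x = c * surv A n x"
  using Q_cmult[of A n c "\<lambda>_. 1" x] by simp

lemma surv_nonneg: "0 \<le> surv A n x"
  by (rule Q_nonneg) simp

lemma surv_le1: "surv A n x \<le> 1"
proof (induction n arbitrary: x)
  case 0
  then show ?case by (simp add: Q_0 res_def)
next
  case (Suc n)
  then show ?case
    using T_mono[of "surv A n" "\<lambda>_. 1" A x] T_const[of x A 1]
    by (cases "x \<in> A") (auto simp: Q_Suc T_out)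
qed

lemma surv_decseq: "surv A (n + k) x \<le> surv A n x"
proof -
  have "surv A (n + k) x = Q A n (surv A k) x"
    by (simp add: Q_add)
  also have "\<dots> \<le> surv A n x"
    by (rule Q_mono) (rule surv_le1)
  finally show ?thesis .
qed

lemma surv_mono: "m \<le> n \<Longrightarrow> surv A n x \<le> surv A m x"
  using surv_decseq[of A m "n - m" x] by simp

lemma surv_1: "(\<And>y. d x y \<le> n \<Longrightarrow> y \<in> A) \<Longrightarrow> surv A n x = 1"
proof (induction n arbitrary: x)
  case 0
  then show ?case by (simp add: Q_0 res_def)
next
  case (Suc n)
  have "surv A n y = 1" if "y \<in> nb x" for y
  proof (rule Suc.IH)
    fix z assume "d y z \<le> n"
    then show "z \<in> A"
      using d_triangle[of x z y] d_nb[OF that] by (intro Suc.prems) linarith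
  qed
  moreover have "x \<in> A"
    by (rule Suc.prems) simp
  ultimately show ?case
    by (simp add: Q_Suc T_def sum_nb_P)
qed

text \<open>The walk follows the given path out of \<open>A\<close> with positive
  probability.\<close>

lemma surv_lt1:
  assumes "(x, o') \<in> adj ^^ n" "o' \<notin> A"
  shows "surv A n x < 1"
  using assms
proof (induction n arbitrary: x)
  case 0
  then show ?case by (simp add: Q_0 res_def)
next
  case (Suc n)
  obtain z where z: "(x, z) \<in> adj" "(z, o') \<in> adj ^^ n"
    using Suc.prems(1) by (meson relpow_Suc_D2)
  show ?case
  proof (cases "x \<in> A")
    case True
    have "(\<Sum>y\<in>nb x. P x y * surv A n y) < (\<Sum>y\<in>nb x. P x y * 1)"
      using z Suc.IH[OF z(2) Suc.prems(2)]
      by (intro sum_strict_mono_ex1 finite_nb ballI mult_left_mono surv_le1 P_nonneg bexI[of _ z])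
         (auto simp: nb_iff P_pos)
    then show ?thesis
      using True by (simp add: Q_Suc T_in sum_nb_P)
  qed (simp add: Q_out)
qed

text \<open>Some vertex lies outside the finite set \<open>A\<close>; a time \<open>N\<close>
  exceeding all distances from \<open>A\<close> to it serves every starting point, and the maximum
  over \<open>A\<close> gives a uniform \<open>q\<close>.\<close>

lemma surv_decay:
  assumes "finite A"
  obtains N q where "0 < N" "0 \<le> q" "q < 1" "\<And>x. surv A N x \<le> q"
proof -
  obtain o' where o: "o' \<notin> A"
    using infinite_vertices assms ex_new_if_finite by blast
  define N where "N = Suc (Max (insert 0 ((\<lambda>x. d x o') ` A)))"
  have lt: "surv A N x < 1" if "x \<in> A" for x
  proof -
    have "d x o' \<le> N"
      unfolding N_def using assms that by (intro le_SucI Max_ge) auto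
    then show ?thesis
      using surv_lt1[OF d_path o, of x] surv_mono[of "d x o'" N A x] by simp
  qed
  define q where "q = Max (insert 0 (surv A N ` A))"
  have "0 \<le> q" "q < 1"
    using assms lt by (auto simp: q_def)
  moreover have "surv A N x \<le> q" for x
    using assms by (cases "x \<in> A") (auto simp: q_def Q_out)
  ultimately show ?thesis
    by (intro that[of N q]) (auto simp: N_def)
qed

lemma surv_pow:
  assumes "\<And>x. surv A N x \<le> q" "0 \<le> q"
  shows "surv A (m * N) x \<le> q ^ m"
proof (induction m arbitrary: x)
  case 0
  then show ?case by (simp add: surv_le1)
next
  case (Suc m)
  have "surv A (Suc m * N) x = Q A N (surv A (m * N)) x"
    by (simp add: Q_add)
  also have "\<dots> \<le> Q A N (\<lambda>_. q ^ m) x"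
    by (rule Q_mono) (rule Suc)
  also have "\<dots> \<le> q ^ m * q"
    using assms by (subst Q_const) (intro mult_left_mono zero_le_power)
  finally show ?case by (simp add: mult.commute)
qed

text \<open>Survival decays geometrically along blocks of length \<open>N\<close>, so partial sums
  stay below \<open>N / (1 - q)\<close>. This makes mean exit times from finite sets finite.\<close>

lemma surv_summable:
  assumes "finite A"
  shows "summable (\<lambda>n. surv A n x)"
proof -
  obtain N q where N: "0 < N" "0 \<le> q" "q < 1" "\<And>x. surv A N x \<le> q"
    using surv_decay[OF assms] by blast
  show ?thesis
  proof (rule bounded_imp_summable)
    fix n
    have shift: "(\<Sum>k=m*N..<m*N+N. surv A k x) = (\<Sum>j<N. surv A (j + m * N) x)" for m
      using sum.shift_bounds_nat_ivl[of "\<lambda>k. surv A k x" 0 "m * N" N]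
      by (simp add: add.commute atLeast0LessThan)
    have "(\<Sum>k\<le>n. surv A k x) \<le> (\<Sum>k<Suc n * N. surv A k x)"
    proof (rule sum_mono2)
      show "{..n} \<subseteq> {..<Suc n * N}"
      proof
        fix k assume "k \<in> {..n}"
        then have "k < Suc n * 1" by simp
        also have "\<dots> \<le> Suc n * N" using N(1) by (intro mult_le_mono) auto
        finally show "k \<in> {..<Suc n * N}" by simp
      qed
    qed (auto intro: surv_nonneg)
    also have "\<dots> = (\<Sum>m<Suc n. \<Sum>j<N. surv A (j + m * N) x)"
      by (simp only: shift sum.nat_group[symmetric])
    also have "\<dots> \<le> (\<Sum>m<Suc n. \<Sum>j<N. q ^ m)"
      by (intro sum_mono order_trans[OF surv_mono surv_pow[OF N(4,2)]]) simp
    also have "\<dots> = N * (\<Sum>m<Suc n. q ^ m)"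
      by (simp add: sum_distrib_left del: sum.lessThan_Suc)
    also have "(\<Sum>m<Suc n. q ^ m) \<le> 1 / (1 - q)"
    proof -
      have "(\<Sum>m<Suc n. q ^ m) = (1 - q ^ Suc n) / (1 - q)"
        using N(3) by (intro sum_gp_strict[THEN trans]) simp
      also have "\<dots> \<le> 1 / (1 - q)"
        using N(2,3) zero_le_power[of q "Suc n"] by (intro divide_right_mono) (simp_all del: power_Suc)
      finally show ?thesis .
    qed
    finally show "(\<Sum>k\<le>n. surv A k x) \<le> N * (1 / (1 - q))"
      by (simp add: mult_left_mono)
  qed (rule surv_nonneg)
qed


section \<open>Killed walks as events on the path space\<close>

lemma walk_coord: "(\<lambda>\<omega>. \<omega> k) \<in> measurable (walk x) (count_space UNIV)"
  by (subst measurable_cong_sets[OF sets_walk refl]) (rule measurable_component_singleton, simp)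

lemma walk_sets: "Measurable.pred (walk x) F \<Longrightarrow> {\<omega>. F \<omega>} \<in> sets (walk x)"
  by (drule predE) (simp add: space_walk)

lemma walk_pred: "Measurable.pred (walk x) (\<lambda>\<omega>. F (\<omega> k))"
  by (rule measurable_compose[OF walk_coord]) simp

lemma walk_pred_stay:
  "Measurable.pred (walk x) (\<lambda>\<omega>. (\<forall>k\<le>m. \<omega> k = \<xi> k) \<and> (\<forall>k\<le>n. \<omega> (l + k) \<in> A) \<and> \<omega> i \<in> Y)"
  by (intro pred_intros_logic pred_intros_countable pred_intros_imp' walk_pred)

lemma walk_pred_stay':
  "Measurable.pred (walk x) (\<lambda>\<omega>. (\<forall>k\<le>n. \<omega> k \<in> A) \<and> \<omega> i \<in> Y)"
  by (intro pred_intros_logic pred_intros_countable pred_intros_imp' walk_pred)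

lemma emeasure_cylinder:
  "emeasure (walk x) {\<omega>. \<forall>k\<le>n. \<omega> k = \<xi> k} =
     ennreal (if \<xi> 0 = x then \<Prod>k<n. P (\<xi> k) (\<xi> (Suc k)) else 0)"
proof -
  interpret prob_space "walk x"
    by (rule prob_space_walk)
  show ?thesis
    by (simp add: emeasure_eq_measure measure_walk)
qed

text \<open>The Markov property, in the only form that is needed: after an initial segment \<open>\<xi>\<close> the walk
  stays in \<open>A\<close> for \<open>n\<close> more steps and ends in \<open>Y\<close>.\<close>

lemma emeasure_walk_stay:
  "emeasure (walk x)
      {\<omega>. (\<forall>k\<le>m. \<omega> k = \<xi> k) \<and> (\<forall>k\<le>n. \<omega> (m + k) \<in> A) \<and> \<omega> (m + n) \<in> Y} =
   ennreal ((if \<xi> 0 = x then \<Prod>k<m. P (\<xi> k) (\<xi> (Suc k)) else 0) * Q A n (indicator Y) (\<xi> m))"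
proof (induction n arbitrary: m \<xi>)
  case 0
  show ?case
  proof (cases "\<xi> m \<in> A \<and> \<xi> m \<in> Y")
    case True
    then have "{\<omega>. (\<forall>k\<le>m. \<omega> k = \<xi> k) \<and> (\<forall>k\<le>0. \<omega> (m + k) \<in> A) \<and> \<omega> (m + 0) \<in> Y} =
        {\<omega>. \<forall>k\<le>m. \<omega> k = \<xi> k}"
      by auto
    with True show ?thesis
      by (simp only: emeasure_cylinder) (simp add: Q_0 res_def)
  next
    case False
    then have "{\<omega>. (\<forall>k\<le>m. \<omega> k = \<xi> k) \<and> (\<forall>k\<le>0. \<omega> (m + k) \<in> A) \<and> \<omega> (m + 0) \<in> Y} = {}"
      by auto
    with False show ?thesis
      by (simp only:) (auto simp: Q_0 res_def)
  qed
next
  case (Suc n)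
  let ?w = "if \<xi> 0 = x then \<Prod>k<m. P (\<xi> k) (\<xi> (Suc k)) else 0"
  let ?C = "{\<omega>. (\<forall>k\<le>m. \<omega> k = \<xi> k) \<and> (\<forall>k\<le>Suc n. \<omega> (m + k) \<in> A) \<and> \<omega> (m + Suc n) \<in> Y}"
  show ?case
  proof (cases "\<xi> m \<in> A")
    case False
    then have "?C = {}"
      by (auto dest!: spec[of _ m] spec[of _ 0])
    then show ?thesis
      using False by (simp only:) (simp add: Q_out)
  next
    case True
    \<comment> \<open>The event is split by the position \<open>y\<close> at time
      \<open>Suc m\<close>, a countable disjoint union. The induction is general in \<open>m\<close>
      and \<xi> so that it applies to the segment prolonged by \<open>y\<close>.\<close>
    let ?\<xi> = "\<lambda>y. \<xi>(Suc m := y)"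
    let ?D = "\<lambda>y. {\<omega>. (\<forall>k\<le>Suc m. \<omega> k = ?\<xi> y k) \<and> (\<forall>k\<le>n. \<omega> (Suc m + k) \<in> A) \<and> \<omega> (Suc m + n) \<in> Y}"
    have w_nonneg: "0 \<le> ?w"
      by (auto intro!: prod_nonneg P_nonneg)
    have D_meas: "?D y \<in> sets (walk x)" for y
      by (rule walk_sets) (rule walk_pred_stay)
    have "?C = (\<Union>y. ?D y)"
    proof (intro set_eqI iffI)
      fix \<omega> assume \<omega>: "\<omega> \<in> ?C"
      have "\<omega> k = ?\<xi> (\<omega> (Suc m)) k" if "k \<le> Suc m" for k
        using \<omega> that by (cases "k = Suc m") auto
      moreover have "\<omega> (Suc m + k) \<in> A" if "k \<le> n" for k
      proof -
        have "\<omega> (m + Suc k) \<in> A"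
          using \<omega> that by blast
        then show ?thesis
          by simp
      qed
      moreover have "\<omega> (Suc m + n) \<in> Y"
        using \<omega> by simp
      ultimately have "\<omega> \<in> ?D (\<omega> (Suc m))"
        by blast
      then show "\<omega> \<in> (\<Union>y. ?D y)"
        by blast
    next
      fix \<omega> assume "\<omega> \<in> (\<Union>y. ?D y)"
      then obtain y where y: "\<omega> \<in> ?D y"
        by blast
      have *: "\<omega> k = \<xi> k" if "k \<le> m" for k
      proof -
        have "\<omega> k = ?\<xi> y k"
          using y that le_SucI by blast
        then show ?thesis
          using that by simp
      qed
      moreover have "\<omega> (m + k) \<in> A" if "k \<le> Suc n" for k
      proof (cases k)
        case 0
        then show ?thesis
          using *[of m] True by simp
      next
        case (Suc j)
        then have "\<omega> (Suc m + j) \<in> A"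
          using y that by blast
        then show ?thesis
          using Suc by simp
      qed
      moreover have "\<omega> (m + Suc n) \<in> Y"
        using y by simp
      ultimately show "\<omega> \<in> ?C"
        by blast
    qed
    then have "emeasure (walk x) ?C = emeasure (walk x) (\<Union>y. ?D y)"
      by simp
    also have "\<dots> = (\<integral>\<^sup>+y. emeasure (walk x) (?D y) \<partial>count_space UNIV)"
    proof (rule emeasure_UN_countable)
      show "disjoint_family_on ?D UNIV"
        unfolding disjoint_family_on_def
      proof (intro ballI impI equals0I)
        fix y z \<omega> assume "y \<noteq> z" and "\<omega> \<in> ?D y \<inter> ?D z"
        then have "\<omega> (Suc m) = ?\<xi> y (Suc m)" "\<omega> (Suc m) = ?\<xi> z (Suc m)"
          by blast+
        with \<open>y \<noteq> z\<close> show False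
          by simp
      qed
    qed (use D_meas countable_vertices in \<open>simp_all only: image_subset_iff\<close>)
    also have "\<dots> = (\<integral>\<^sup>+y. ennreal (?w * P (\<xi> m) y * Q A n (indicator Y) y) \<partial>count_space UNIV)"
    proof (intro nn_integral_cong)
      fix y
      have "(\<Prod>k<m. P (?\<xi> y k) (?\<xi> y (Suc k))) = (\<Prod>k<m. P (\<xi> k) (\<xi> (Suc k)))"
        by (rule prod.cong) auto
      then have "(if ?\<xi> y 0 = x then \<Prod>k<Suc m. P (?\<xi> y k) (?\<xi> y (Suc k)) else 0) = ?w * P (\<xi> m) y"
        by simp
      then show "emeasure (walk x) (?D y) = ennreal (?w * P (\<xi> m) y * Q A n (indicator Y) y)"
        unfolding Suc by (simp only: fun_upd_same)
    qed
    also have "\<dots> = (\<Sum>y\<in>nb (\<xi> m). ennreal (?w * P (\<xi> m) y * Q A n (indicator Y) y))"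
      by (rule nn_integral_count_space') (simp_all add: finite_nb P_nb)
    also have "\<dots> = ennreal (\<Sum>y\<in>nb (\<xi> m). ?w * P (\<xi> m) y * Q A n (indicator Y) y)"
      by (rule sum_ennreal) (intro mult_nonneg_nonneg w_nonneg P_nonneg Q_nonneg, simp)
    also have "(\<Sum>y\<in>nb (\<xi> m). ?w * P (\<xi> m) y * Q A n (indicator Y) y) = ?w * Q A (Suc n) (indicator Y) (\<xi> m)"
      using True by (simp add: Q_Suc T_in sum_distrib_left mult.assoc)
    finally show ?thesis .
  qed
qed

lemma AE_walk_start: "AE \<omega> in walk x. \<omega> 0 = x"
proof -
  interpret prob_space "walk x"
    by (rule prob_space_walk)
  have "prob {\<omega> \<in> space (walk x). \<omega> 0 = x} = 1"
    using measure_walk[of x 0 "\<lambda>_. x"] by (simp add: space_walk)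
  then show ?thesis
    using AE_prob_1[of "{\<omega>. \<omega> 0 = x}"] by (simp add: space_walk)
qed

lemma emeasure_walk_stay_start:
  "emeasure (walk x) {\<omega>. (\<forall>k\<le>n. \<omega> k \<in> A) \<and> \<omega> n \<in> Y} = ennreal (Q A n (indicator Y) x)"
proof -
  have "emeasure (walk x) {\<omega>. (\<forall>k\<le>n. \<omega> k \<in> A) \<and> \<omega> n \<in> Y} =
      emeasure (walk x) {\<omega>. (\<forall>k\<le>0. \<omega> k = x) \<and> (\<forall>k\<le>n. \<omega> (0 + k) \<in> A) \<and> \<omega> (0 + n) \<in> Y}"
  proof (rule emeasure_eq_AE)
    show "{\<omega>. (\<forall>k\<le>n. \<omega> k \<in> A) \<and> \<omega> n \<in> Y} \<in> sets (walk x)"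
      by (rule walk_sets) (rule walk_pred_stay')
    show "{\<omega>. (\<forall>k\<le>0. \<omega> k = x) \<and> (\<forall>k\<le>n. \<omega> (0 + k) \<in> A) \<and> \<omega> (0 + n) \<in> Y} \<in> sets (walk x)"
      by (rule walk_sets) (rule walk_pred_stay)
    show "AE \<omega> in walk x. \<omega> \<in> {\<omega>. (\<forall>k\<le>n. \<omega> k \<in> A) \<and> \<omega> n \<in> Y} \<longleftrightarrow>
        \<omega> \<in> {\<omega>. (\<forall>k\<le>0. \<omega> k = x) \<and> (\<forall>k\<le>n. \<omega> (0 + k) \<in> A) \<and> \<omega> (0 + n) \<in> Y}"
      using AE_walk_start[of x] by eventually_elim auto
  qed
  also have "\<dots> = ennreal (Q A n (indicator Y) x)"
    using emeasure_walk_stay[of x 0 "\<lambda>_. x" n A Y] by simp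
  finally show ?thesis .
qed

text \<open>The Dirac mass at \<open>y\<close> as a density with respect to \<mu>: pairing with it
  in \<open>ip\<close> evaluates at \<open>y\<close>, and \<open>Q A n (dens y)\<close> is the heat
  kernel killed outside \<open>A\<close>.\<close>

definition dens :: "'a \<Rightarrow> 'a \<Rightarrow> real" where
  "dens y x = (if x = y then 1 / \<mu> y else 0)"

lemma p_eq: "p n x y = Q UNIV n (dens y) x"
proof -
  have "emeasure (walk x) {\<omega> \<in> space (walk x). \<omega> n = y} = ennreal (Q UNIV n (indicator {y}) x)"
    using emeasure_walk_stay_start[of x n UNIV "{y}"] by (simp add: space_walk)
  then have "measure (walk x) {\<omega> \<in> space (walk x). \<omega> n = y} = Q UNIV n (indicator {y}) x"
    by (simp add: measure_def Q_nonneg)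
  moreover have "dens y = (\<lambda>x. 1 / \<mu> y * indicator {y} x)"
    by (auto simp: dens_def)
  ultimately show ?thesis
    by (simp only: p_def Q_cmult) simp
qed

text \<open>An integer-valued time is the number of \<open>n\<close> strictly below it, also when it
  is infinite.\<close>

lemma exit_time_eq_suminf:
  "ennreal_of_enat (exit_time A \<omega>) = (\<Sum>n. indicator {\<omega>. \<forall>k\<le>n. \<omega> k \<in> A} \<omega>)"
proof (cases "\<exists>k. \<omega> k \<notin> A")
  case False
  then have "exit_time A \<omega> = \<infinity>"
    by (simp add: exit_time_def top_enat_def)
  moreover have "(\<Sum>n. indicator {\<omega>. \<forall>k\<le>n. \<omega> k \<in> A} \<omega> :: ennreal) = (\<Sum>n. 1)"
    using False by simp
  moreover have "(\<Sum>n::nat. 1 :: ennreal) = \<infinity>"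
  proof (rule ccontr)
    assume "(\<Sum>n::nat. 1 :: ennreal) \<noteq> \<infinity>"
    then have "summable (\<lambda>n::nat. 1 :: real)"
      by (intro summable_suminf_not_top) simp_all
    then show False
      by (simp add: summable_const_iff)
  qed
  ultimately show ?thesis
    by simp
next
  case True
  define N where "N = (LEAST k. \<omega> k \<notin> A)"
  have N: "\<omega> N \<notin> A" "\<And>k. k < N \<Longrightarrow> \<omega> k \<in> A"
    unfolding N_def by (rule LeastI_ex[OF True], drule not_less_Least, blast)
  have "exit_time A \<omega> = enat N"
    unfolding exit_time_def
  proof (rule antisym)
    show "(INF k\<in>{k. \<omega> k \<notin> A}. enat k) \<le> enat N"
      using N(1) by (intro INF_lower) simp
    show "enat N \<le> (INF k\<in>{k. \<omega> k \<notin> A}. enat k)"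
    proof (rule INF_greatest)
      fix k assume "k \<in> {k. \<omega> k \<notin> A}"
      then show "enat N \<le> enat k"
        using N(2)[of k] by (cases "k < N") simp_all
    qed
  qed
  moreover have "(\<Sum>n. indicator {\<omega>. \<forall>k\<le>n. \<omega> k \<in> A} \<omega> :: ennreal) = (\<Sum>n<N. indicator {\<omega>. \<forall>k\<le>n. \<omega> k \<in> A} \<omega>)"
  proof (rule suminf_finite)
    fix n assume "n \<notin> {..<N}"
    then have "\<not> (\<forall>k\<le>n. \<omega> k \<in> A)"
      using N(1) by (meson lessThan_iff not_le)
    then show "indicator {\<omega>. \<forall>k\<le>n. \<omega> k \<in> A} \<omega> = (0 :: ennreal)"
      by (simp add: indicator_def)
  qed simp
  moreover have "(\<Sum>n<N. indicator {\<omega>. \<forall>k\<le>n. \<omega> k \<in> A} \<omega> :: ennreal) = (\<Sum>n<N. 1)"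
  proof (rule sum.cong)
    fix n assume "n \<in> {..<N}"
    then have "\<forall>k\<le>n. \<omega> k \<in> A"
      using N(2) by auto
    then show "indicator {\<omega>. \<forall>k\<le>n. \<omega> k \<in> A} \<omega> = (1 :: ennreal)"
      by (simp add: indicator_def)
  qed simp
  ultimately show ?thesis
    by simp
qed

lemma mean_exit_eq_suminf: "mean_exit x A = (\<Sum>n. ennreal (surv A n x))"
proof -
  have meas: "{\<omega>. \<forall>k\<le>n. \<omega> k \<in> A} \<in> sets (walk x)" for n
    using walk_sets[OF walk_pred_stay'[where Y = UNIV and A = A and n = n and x = x]] by simp
  have "mean_exit x A = (\<Sum>n. \<integral>\<^sup>+\<omega>. indicator {\<omega>. \<forall>k\<le>n. \<omega> k \<in> A} \<omega> \<partial>walk x)"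
    unfolding mean_exit_def exit_time_eq_suminf by (intro nn_integral_suminf borel_measurable_indicator meas)
  also have "\<dots> = (\<Sum>n. ennreal (surv A n x))"
  proof (intro suminf_cong)
    fix n
    have "(\<lambda>_::'a. 1::real) = indicator UNIV"
      by auto
    then show "(\<integral>\<^sup>+\<omega>. indicator {\<omega>. \<forall>k\<le>n. \<omega> k \<in> A} \<omega> \<partial>walk x) = ennreal (surv A n x)"
      using emeasure_walk_stay_start[of x n A UNIV] by (simp only: nn_integral_indicator[OF meas]) simp
  qed
  finally show ?thesis .
qed

subsection \<open>Mean exit times\<close>

definition mx :: "'a set \<Rightarrow> 'a \<Rightarrow> real" where
  "mx A x = (\<Sum>n. surv A n x)"

lemma mean_exit_eq: "finite A \<Longrightarrow> mean_exit x A = ennreal (mx A x)"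
  unfolding mean_exit_eq_suminf mx_def
  by (intro suminf_ennreal2 surv_nonneg surv_summable)

lemma mx_out: "x \<notin> A \<Longrightarrow> mx A x = 0"
  by (simp add: mx_def Q_out)

lemma mx_nonneg: "finite A \<Longrightarrow> 0 \<le> mx A x"
  unfolding mx_def by (intro suminf_nonneg surv_summable surv_nonneg)

lemma mx_rec:
  assumes "finite A" "x \<in> A"
  shows "mx A x = 1 + T A (mx A) x"
proof -
  note s = surv_summable[OF assms(1)]
  have "mx A x = surv A 0 x + (\<Sum>n. surv A (Suc n) x)"
    unfolding mx_def using suminf_split_head[OF s, of x] by simp
  also have "surv A 0 x = 1"
    using assms(2) by (simp add: Q_0 res_def)
  also have "(\<Sum>n. surv A (Suc n) x) = (\<Sum>n. \<Sum>y\<in>nb x. P x y * surv A n y)"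
    using assms(2) by (simp add: Q_Suc T_in)
  also have "\<dots> = (\<Sum>y\<in>nb x. \<Sum>n. P x y * surv A n y)"
    by (rule suminf_sum) (intro summable_mult s)
  also have "\<dots> = T A (mx A) x"
    using assms(2) by (simp add: T_in mx_def suminf_mult[OF s])
  finally show ?thesis .
qed

lemma mx_ge1: "finite A \<Longrightarrow> x \<in> A \<Longrightarrow> 1 \<le> mx A x"
  using mx_rec[of A x] T_nonneg[of "mx A" A x] mx_nonneg by simp

lemma mx_mono: "finite A' \<Longrightarrow> A \<subseteq> A' \<Longrightarrow> mx A x \<le> mx A' x"
  unfolding mx_def by (intro suminf_le surv_summable Q_mono_set) (auto intro: finite_subset)

lemma Q_cong: "(\<And>y. y \<in> A \<Longrightarrow> f y = g y) \<Longrightarrow> Q A n f = Q A n g"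
  unfolding Q_def by (rule arg_cong[where f = "T A ^^ n"]) (auto simp: res_def)

text \<open>Markov property at time \<open>n\<close>: the time spent before \<open>n\<close> plus
  the mean remaining time of the survivors.\<close>

lemma mx_tail:
  assumes "finite A"
  shows "mx A x = (\<Sum>k<n. surv A k x) + Q A n (mx A) x"
proof (induction n)
  case 0
  show ?case
    by (simp add: Q_0 res_def mx_out)
next
  case (Suc n)
  have "Q A n (mx A) x = Q A n (\<lambda>x. 1 + T A (mx A) x) x"
    using mx_rec[OF assms] by (intro fun_cong[OF Q_cong]) auto
  also have "\<dots> = surv A n x + Q A (Suc n) (mx A) x"
    using res_id[of A "mx A"] by (simp add: Q_add_fun Q_Suc2 mx_out)
  finally show ?case
    using Suc by simp
qed

text \<open>It serves in both directions: if \<open>n\<close> is at most half of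
  \<open>mx A x\<close>, the walk survives to time \<open>n\<close> with probability at least
  \<open>mx A x / (2 * M)\<close>.\<close>

lemma mx_bound_tail:
  assumes "finite A" "\<And>y. y \<in> A \<Longrightarrow> mx A y \<le> M"
  shows "mx A x \<le> real n + M * surv A n x"
proof -
  have "(\<Sum>k<n. surv A k x) \<le> real n"
    using sum_bounded_above[of "{..<n}" "\<lambda>k. surv A k x" 1] by (simp add: surv_le1)
  moreover have "Q A n (mx A) x \<le> M * surv A n x"
    using Q_mono[of A "mx A" "\<lambda>_. M" n x] assms(2) by (simp add: Q_const[of _ _ M])
  ultimately show ?thesis
    using mx_tail[OF assms(1), of x n] by simp
qed

text \<open>At a point where \<open>mx A\<close> attains its maximum \<open>M\<close>, the tail
  bound reads \<open>M \<le> n + M / 2\<close>.\<close>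

lemma mx_le_half:
  assumes "finite A" "\<And>y. y \<in> A \<Longrightarrow> surv A n y \<le> 1/2"
  shows "mx A x \<le> 2 * real n"
proof (cases "A = {}")
  case True
  then show ?thesis by (simp add: mx_out)
next
  case False
  define M where "M = Max (mx A ` A)"
  have M: "mx A y \<le> M" if "y \<in> A" for y
    using assms(1) that by (simp add: M_def)
  obtain z where z: "z \<in> A" "mx A z = M"
  proof -
    have "M \<in> mx A ` A"
      unfolding M_def using assms(1) False by (intro Max_in) auto
    then show ?thesis
      using that by auto
  qed
  have "0 \<le> M"
    using mx_nonneg[of A z] z assms(1) by simp
  have "M \<le> real n + M * surv A n z"
    using mx_bound_tail[OF assms(1) M, of z n] z by simp
  also have "M * surv A n z \<le> M * (1/2)"
    using assms(2)[OF z(1)] \<open>0 \<le> M\<close> by (intro mult_left_mono)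
  finally have "M \<le> 2 * real n"
    by simp
  then show ?thesis
    using M[of x] mx_out[of x A] by (cases "x \<in> A") auto
qed

text \<open>With \<open>- M\<close> the minimum of \<open>h\<close> on \<open>A\<close>, iterating
  \<open>T A h \<le> h\<close> bounds \<open>h\<close> from below by \<open>- M\<close> times the
  survival probability, which tends to 0 because \<open>A\<close> is finite.\<close>

lemma minimum_principle:
  assumes "finite A"
    and super: "\<And>x. x \<in> A \<Longrightarrow> T A h x \<le> h x"
    and bdry: "\<And>x y. x \<in> A \<Longrightarrow> y \<in> nb x \<Longrightarrow> y \<notin> A \<Longrightarrow> 0 \<le> h y"
    and "x \<in> A"
  shows "0 \<le> h x"
proof -
  define M where "M = Max ((\<lambda>x. - h x) ` A)"
  have M: "- M \<le> h y" if "y \<in> A" for y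
    using Max_ge[of "(\<lambda>x. - h x) ` A" "- h y"] assms(1) that by (simp add: M_def minus_le_iff)
  have "Q A n (\<lambda>_. - M) x \<le> h x" for n
    using \<open>x \<in> A\<close>
  proof (induction n arbitrary: x)
    case 0
    then show ?case
      using M by (simp add: Q_0 res_def)
  next
    case (Suc n)
    have "Q A (Suc n) (\<lambda>_. - M) x \<le> T A h x"
      unfolding Q_Suc
    proof (rule T_mono_nb)
      fix y assume "y \<in> nb x"
      then show "Q A n (\<lambda>_. - M) y \<le> h y"
        using Suc.IH[of y] bdry[OF Suc.prems] by (cases "y \<in> A") (auto simp: Q_out)
    qed
    then show ?case
      using super[OF Suc.prems] by simp
  qed
  then have "- M * surv A n x \<le> h x" for n
    by (subst Q_const[symmetric])
  moreover have "(\<lambda>n. - M * surv A n x) \<longlonglongrightarrow> - M * 0"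
    by (intro tendsto_mult_left summable_LIMSEQ_zero surv_summable assms(1))
  ultimately show ?thesis
    using LIMSEQ_le_const2[of "\<lambda>n. - M * surv A n x" "- M * 0" "h x"] by auto
qed

section \<open>Mean exit times from balls\<close>

definition Er :: "'a \<Rightarrow> real \<Rightarrow> real" where
  "Er x R = mx (B x R) x"

lemma E_eq: "E x R = ennreal (Er x R)"
  by (simp add: E_def Er_def mean_exit_eq)

lemma Er_nonneg: "0 \<le> Er x R"
  by (simp add: Er_def mx_nonneg)

lemma Er_nonpos: "R \<le> 0 \<Longrightarrow> Er x R = 0"
  by (simp add: Er_def mx_out B_iff)

lemma Er_ge1: "0 < R \<Longrightarrow> 1 \<le> Er x R"
  by (simp add: Er_def mx_ge1 center_B)

lemma Er_mono: "r \<le> R \<Longrightarrow> Er x r \<le> Er x R"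
  unfolding Er_def by (intro mx_mono finite_B B_mono)

text \<open>The walk moves by distance at most 1 per step, so it stays in the ball up to time
  \<open>n - 1\<close>. This makes \<open>e x n\<close> well defined.\<close>

lemma Er_ge_nat: "real n \<le> Er x (real n)"
proof -
  have "surv (B x (real n)) k x = 1" if "k < n" for k
    using that by (intro surv_1) (simp add: B_iff)
  then have "(\<Sum>k<n. surv (B x (real n)) k x) = real n"
    by simp
  then show ?thesis
    using mx_tail[of "B x (real n)" x n] Q_nonneg[of "B x (real n)" "mx (B x (real n))" n x] mx_nonneg[of "B x (real n)"]
    by (simp add: Er_def)
qed

text \<open>Loops are allowed, so a vertex can be its own neighbour; only connectedness and infinity
  force a second one.\<close>

lemma nb_other: "\<exists>z\<in>nb x. z \<noteq> x"
proof (rule ccontr)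
  assume *: "\<not> (\<exists>z\<in>nb x. z \<noteq> x)"
  have "y = x" if "(x, y) \<in> adj ^^ n" for y n
    using that
  proof (induction n arbitrary: y)
    case (Suc n)
    then obtain z where "(x, z) \<in> adj ^^ n" "(z, y) \<in> adj"
      by auto
    with Suc.IH[of z] * show ?case
      by (auto simp: nb_iff)
  qed simp
  then have "UNIV = {x}"
    using d_path[of x] by auto
  then show False
    using infinite_vertices by (metis finite.emptyI finite_insert)
qed

text \<open>The ball is \<open>{x}\<close>, and the exit time is geometric with mean
  \<open>1 / (1 - P x x)\<close>; the step to another neighbour keeps the denominator away from 0
  uniformly in \<open>x\<close>.\<close>

lemma Er_1_le: "\<exists>c\<ge>1. \<forall>x. Er x 1 \<le> c"
proof -
  obtain q where q: "0 < q" "q \<le> 1" "\<And>x y. y \<in> nb x \<Longrightarrow> q \<le> P x y"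
    by (rule p0E) blast
  have "Er x 1 \<le> 1 / q" for x
  proof -
    obtain z where z: "z \<in> nb x" "z \<noteq> x"
      using nb_other by blast
    have "P x x + P x z \<le> 1"
      using sum_P_le[of "{x, z}" x] z by simp
    then have Pxx: "q \<le> 1 - P x x"
      using q(3)[OF z(1)] by simp
    let ?u = "mx {x} x"
    have "T {x} (mx {x}) x = (\<Sum>y\<in>nb x. P x y * mx {x} y)"
      by (simp add: T_in)
    also have "\<dots> = (\<Sum>y\<in>nb x. if y = x then P x x * ?u else 0)"
      by (intro sum.cong) (auto simp: mx_out)
    also have "\<dots> = P x x * ?u"
      using P_nb[of x x] by (simp add: finite_nb)
    finally have u: "?u = 1 + P x x * ?u"
      using mx_rec[of "{x}" x] by simp
    have "q * ?u \<le> (1 - P x x) * ?u"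
      by (intro mult_right_mono Pxx mx_nonneg) simp
    also have "\<dots> = 1"
      using u by (simp add: algebra_simps)
    finally show ?thesis
      using q(1) by (simp add: Er_def B_le1 field_simps)
  qed
  moreover have "1 \<le> 1 / q"
    using q by simp
  ultimately show ?thesis
    by blast
qed

end

section \<open>Reciprocals of extended nonnegative reals\<close>

lemma inverse_ennreal_le_iff:
  assumes "0 < k"
  shows "inverse (a :: ennreal) \<le> ennreal k \<longleftrightarrow> ennreal (1 / k) \<le> a"
proof (cases a)
  case (real r)
  show ?thesis
  proof (cases "r = 0")
    case True
    then show ?thesis
      using real assms by (auto simp: top_unique ennreal_le_iff2)
  next
    case False
    then have "0 < r"
      using real by simp
    then have "inverse a \<le> ennreal k \<longleftrightarrow> inverse r \<le> k"
      using real assms by (simp add: inverse_ennreal ennreal_le_iff)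
    also have "\<dots> \<longleftrightarrow> 1 / k \<le> r"
      using \<open>0 < r\<close> assms by (simp add: field_simps)
    finally show ?thesis
      using real by (simp add: ennreal_le_iff)
  qed
qed simp

lemma inverse_ennreal_antimono:
  assumes "a \<le> b"
  shows "inverse b \<le> inverse (a :: ennreal)"
proof (cases a)
  case (real k)
  show ?thesis
  proof (cases "k = 0")
    case False
    then show ?thesis
      using real assms inverse_ennreal_le_iff[of "1 / k" b] by (simp add: inverse_ennreal inverse_eq_divide)
  qed (use real in simp)
qed (use assms in \<open>simp add: top_unique\<close>)

context weighted_graph_p0 begin

subsection \<open>Inner product and energy\<close>

text \<open>Summing over the support of the product leaves one factor free, for instance the
  constant 1, as long as the other has finite support.\<close>

definition ip :: "('a \<Rightarrow> real) \<Rightarrow> ('a \<Rightarrow> real) \<Rightarrow> real" where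
  "ip f g = (\<Sum>x\<in>{x. f x * g x \<noteq> 0}. f x * g x * \<mu> x)"

definition fs :: "('a \<Rightarrow> real) \<Rightarrow> bool" where
  "fs f \<longleftrightarrow> finite {x. f x \<noteq> 0}"

text \<open>The quadratic form of \<open>I - P\<close>, equal to the Dirichlet form for finitely
  supported \<open>f\<close>. In this form it pairs directly with the iterates of the walk.\<close>

definition en :: "('a \<Rightarrow> real) \<Rightarrow> real" where
  "en f = ip f f - ip f (T UNIV f)"

lemma ip_eq: "finite S \<Longrightarrow> (\<And>x. x \<notin> S \<Longrightarrow> f x * g x = 0) \<Longrightarrow> ip f g = (\<Sum>x\<in>S. f x * g x * \<mu> x)"
  unfolding ip_def by (rule sum.mono_neutral_left) force+

lemma fsI: "finite S \<Longrightarrow> (\<And>x. x \<notin> S \<Longrightarrow> f x = 0) \<Longrightarrow> fs f"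
  unfolding fs_def by (rule finite_subset[of _ S]) auto

lemma fsE:
  assumes "fs f"
  obtains S where "finite S" "\<And>x. x \<notin> S \<Longrightarrow> f x = 0"
  by (rule that[of "{x. f x \<noteq> 0}"]) (use assms in \<open>simp_all add: fs_def\<close>)

lemma fsE2:
  assumes "fs f" "fs g"
  obtains S where "finite S" "\<And>x. x \<notin> S \<Longrightarrow> f x = 0" "\<And>x. x \<notin> S \<Longrightarrow> g x = 0"
  by (rule that[of "{x. f x \<noteq> 0} \<union> {x. g x \<noteq> 0}"]) (use assms in \<open>simp_all add: fs_def\<close>)

lemma fs_add: "fs f \<Longrightarrow> fs g \<Longrightarrow> fs (\<lambda>x. f x + g x)"
  by (erule (1) fsE2, erule fsI) simp

lemma fs_diff: "fs f \<Longrightarrow> fs g \<Longrightarrow> fs (\<lambda>x. f x - g x)"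
  by (erule (1) fsE2, erule fsI) simp

lemma fs_T:
  assumes "fs f"
  shows "fs (T A f)"
proof -
  obtain S where S: "finite S" "\<And>x. x \<notin> S \<Longrightarrow> f x = 0"
    using fsE[OF assms] by blast
  show ?thesis
  proof (rule fsI)
    show "finite (\<Union>y\<in>S. nb y)"
      using S finite_nb by blast
    fix x assume "x \<notin> (\<Union>y\<in>S. nb y)"
    then have "f y = 0" if "y \<in> nb x" for y
      using S(2)[of y] nb_sym[of y x] that by blast
    then show "T A f x = 0"
      by (simp add: T_def)
  qed
qed

lemma fs_Q: "fs f \<Longrightarrow> fs (Q A n f)"
proof (induction n)
  case 0
  then show ?case
    unfolding Q_0 by (rule fsE, elim fsI) (simp add: res_def)
next
  case (Suc n)
  then show ?case
    by (simp add: Q_Suc fs_T)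
qed

lemma fs_dens: "fs (dens y)"
  by (rule fsI[of "{y}"]) (auto simp: dens_def)

lemma ip_commute: "ip f g = ip g f"
  by (simp add: ip_def mult.commute)

lemma ip_cong: "(\<And>x. f x * g x = f' x * g' x) \<Longrightarrow> ip f g = ip f' g'"
  by (simp add: ip_def)

lemma ip_add:
  assumes "fs f" "fs g"
  shows "ip (\<lambda>x. f x + g x) h = ip f h + ip g h"
proof -
  obtain S where S: "finite S" "\<And>x. x \<notin> S \<Longrightarrow> f x = 0" "\<And>x. x \<notin> S \<Longrightarrow> g x = 0"
    using fsE2[OF assms] by blast
  then show ?thesis
    by (simp add: ip_eq[of S] sum.distrib algebra_simps)
qed

lemma ip_diff:
  assumes "fs f" "fs g"
  shows "ip (\<lambda>x. f x - g x) h = ip f h - ip g h"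
proof -
  obtain S where S: "finite S" "\<And>x. x \<notin> S \<Longrightarrow> f x = 0" "\<And>x. x \<notin> S \<Longrightarrow> g x = 0"
    using fsE2[OF assms] by blast
  then show ?thesis
    by (simp add: ip_eq[of S] sum_subtractf algebra_simps)
qed

lemma ip_add2: "fs f \<Longrightarrow> fs g \<Longrightarrow> ip h (\<lambda>x. f x + g x) = ip h f + ip h g"
  using ip_add[of f g h] by (simp add: ip_commute)

lemma ip_diff2: "fs f \<Longrightarrow> fs g \<Longrightarrow> ip h (\<lambda>x. f x - g x) = ip h f - ip h g"
  using ip_diff[of f g h] by (simp add: ip_commute)

lemma ip_nonneg: "(\<And>x. 0 \<le> f x) \<Longrightarrow> (\<And>x. 0 \<le> g x) \<Longrightarrow> 0 \<le> ip f g"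
  unfolding ip_def by (intro sum_nonneg mult_nonneg_nonneg \<mu>_nonneg)

lemma ip_self_nonneg: "0 \<le> ip f f"
  unfolding ip_def by (intro sum_nonneg mult_nonneg_nonneg[OF _ \<mu>_nonneg]) simp

lemma ip_mono:
  assumes "fs f" "fs g" "\<And>x. f x * f' x \<le> g x * g' x"
  shows "ip f f' \<le> ip g g'"
proof -
  obtain S where S: "finite S" "\<And>x. x \<notin> S \<Longrightarrow> f x = 0" "\<And>x. x \<notin> S \<Longrightarrow> g x = 0"
    using fsE2[OF assms(1,2)] by blast
  then show ?thesis
    using assms(3) by (simp add: ip_eq[of S] sum_mono mult_right_mono \<mu>_nonneg)
qed

lemma ip_self_pos:
  assumes "fs f" "f x \<noteq> 0"
  shows "0 < ip f f"
proof -
  have "0 < f x * f x * \<mu> x"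
    using assms(2) \<mu>_pos[of x] by (auto simp: zero_less_mult_iff linorder_neq_iff)
  also have "\<dots> \<le> ip f f"
    unfolding ip_def using assms
    by (intro member_le_sum) (auto simp: fs_def \<mu>_nonneg)
  finally show ?thesis .
qed

lemma ip_Cauchy_Schwarz:
  assumes "fs f" "fs g"
  shows "(ip f g)\<^sup>2 \<le> ip f f * ip g g"
proof -
  obtain S where S: "finite S" "\<And>x. x \<notin> S \<Longrightarrow> f x = 0" "\<And>x. x \<notin> S \<Longrightarrow> g x = 0"
    using fsE2[OF assms] by blast
  have *: "ip f g = (\<Sum>x\<in>S. (f x * sqrt (\<mu> x)) * (g x * sqrt (\<mu> x)))"
    using S by (simp add: ip_eq[of S] mult.assoc mult.left_commute[of "sqrt _"] \<mu>_nonneg)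
  have **: "ip h h = (\<Sum>x\<in>S. (h x * sqrt (\<mu> x))\<^sup>2)" if "\<And>x. x \<notin> S \<Longrightarrow> h x = 0" for h
    using S that by (simp add: ip_eq[of S] power2_eq_square mult.assoc mult.left_commute[of "sqrt _"] \<mu>_nonneg)
  show ?thesis
    unfolding * **[of f, OF S(2), simplified] **[of g, OF S(3), simplified]
    by (rule Cauchy_Schwarz_ineq_sum)
qed

lemma ip_dens: "ip f (dens y) = f y"
  by (subst ip_eq[of "{y}"]) (auto simp: dens_def)

lemma T_sum:
  assumes "finite S" "\<And>y. y \<notin> S \<Longrightarrow> f y = 0" "x \<in> A"
  shows "T A f x * \<mu> x = (\<Sum>y\<in>S. w x y * f y)"
proof -
  have "T A f x * \<mu> x = (\<Sum>y\<in>nb x. w x y * f y)"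
    using assms(3) by (simp add: T_in sum_distrib_right mult.assoc flip: \<mu>_P) (simp add: mult_ac)
  also have "\<dots> = (\<Sum>y\<in>nb x \<union> S. w x y * f y)"
    using assms finite_nb by (intro sum.mono_neutral_left) (auto simp: w_nb)
  also have "\<dots> = (\<Sum>y\<in>S. w x y * f y)"
    using assms finite_nb by (intro sum.mono_neutral_right) auto
  finally show ?thesis .
qed

lemma ip_T:
  assumes S: "finite S" "\<And>x. x \<notin> S \<Longrightarrow> f x = 0" "\<And>x. x \<notin> S \<Longrightarrow> g x = 0"
    and A: "\<And>x. x \<notin> A \<Longrightarrow> g x = 0"
  shows "ip (T A f) g = (\<Sum>x\<in>S. \<Sum>y\<in>S. w x y * f y * g x)"
proof -
  have "ip (T A f) g = (\<Sum>x\<in>S. T A f x * g x * \<mu> x)"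
    using S by (simp add: ip_eq[of S])
  also have "\<dots> = (\<Sum>x\<in>S. \<Sum>y\<in>S. w x y * f y * g x)"
  proof (rule sum.cong)
    fix x assume "x \<in> S"
    show "T A f x * g x * \<mu> x = (\<Sum>y\<in>S. w x y * f y * g x)"
    proof (cases "x \<in> A")
      case True
      then show ?thesis
        using T_sum[of S f x A] S by (simp add: mult.commute mult.left_commute sum_distrib_left)
    qed (simp add: A)
  qed simp
  finally show ?thesis .
qed

lemma ip_T_sym:
  assumes "fs f" "fs g" and A: "\<And>x. x \<notin> A \<Longrightarrow> f x = 0" "\<And>x. x \<notin> A \<Longrightarrow> g x = 0"
  shows "ip (T A f) g = ip f (T A g)"
proof -
  obtain S where S: "finite S" "\<And>x. x \<notin> S \<Longrightarrow> f x = 0" "\<And>x. x \<notin> S \<Longrightarrow> g x = 0"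
    using fsE2[OF assms(1,2)] by blast
  have "ip f (T A g) = (\<Sum>x\<in>S. \<Sum>y\<in>S. w x y * g y * f x)"
    unfolding ip_commute[of f] by (rule ip_T) (use S A in auto)
  also have "\<dots> = (\<Sum>y\<in>S. \<Sum>x\<in>S. w x y * g y * f x)"
    by (rule sum.swap)
  also have "\<dots> = ip (T A f) g"
    by (subst ip_T[OF S A(2)]) (auto simp: weight_sym mult.commute mult.left_commute intro!: sum.cong)
  finally show ?thesis ..
qed

lemma ip_Q_sym:
  assumes "fs f" "fs g" and A: "\<And>x. x \<notin> A \<Longrightarrow> f x = 0" "\<And>x. x \<notin> A \<Longrightarrow> g x = 0"
  shows "ip (Q A n f) g = ip f (Q A n g)"
  using assms(2,4)
proof (induction n arbitrary: g)
  case 0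
  then show ?case
    using A(1) by (simp add: Q_0 res_id)
next
  case (Suc n)
  have "ip (Q A (Suc n) f) g = ip (Q A n f) (T A g)"
    unfolding Q_Suc using Suc.prems assms(1) by (intro ip_T_sym fs_Q) (auto simp: Q_out)
  also have "\<dots> = ip f (Q A n (T A g))"
    using Suc.prems by (intro Suc.IH fs_T) (auto simp: T_out)
  also have "Q A n (T A g) = Q A (Suc n) g"
    using Suc.prems by (simp add: Q_Suc2 res_id)
  finally show ?case .
qed

lemma en_killed: "(\<And>x. x \<notin> A \<Longrightarrow> f x = 0) \<Longrightarrow> en f = ip f f - ip f (T A f)"
  unfolding en_def by (intro arg_cong2[where f = "(-)"] ip_cong refl) (auto simp: T_def)

lemma double_sum_square:
  assumes "finite S"
  shows "(\<Sum>x\<in>S. \<Sum>y\<in>S. w x y * (f x)\<^sup>2) + (\<Sum>x\<in>S. \<Sum>y\<in>S. w x y * (f y)\<^sup>2) =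
    2 * (\<Sum>x\<in>S. (f x)\<^sup>2 * (\<Sum>y\<in>S. w x y))"
proof -
  have "(\<Sum>x\<in>S. \<Sum>y\<in>S. w x y * (f y)\<^sup>2) = (\<Sum>y\<in>S. \<Sum>x\<in>S. w x y * (f y)\<^sup>2)"
    by (rule sum.swap)
  also have "\<dots> = (\<Sum>x\<in>S. \<Sum>y\<in>S. w x y * (f x)\<^sup>2)"
    by (simp add: weight_sym)
  finally have "(\<Sum>x\<in>S. \<Sum>y\<in>S. w x y * (f x)\<^sup>2) + (\<Sum>x\<in>S. \<Sum>y\<in>S. w x y * (f y)\<^sup>2) =
      2 * (\<Sum>x\<in>S. \<Sum>y\<in>S. w x y * (f x)\<^sup>2)"
    by simp
  moreover have "(\<Sum>x\<in>S. \<Sum>y\<in>S. w x y * (f x)\<^sup>2) = (\<Sum>x\<in>S. (f x)\<^sup>2 * (\<Sum>y\<in>S. w x y))"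
    by (simp add: sum_distrib_left mult.commute[of "w _ _"])
  ultimately show ?thesis
    by simp
qed

text \<open>The second sum collects the edges leaving \<open>S\<close>, where \<open>f\<close> drops
  to 0; each is met in both orders, hence the factor 2.\<close>

lemma en_repr:
  assumes S: "finite S" "\<And>x. x \<notin> S \<Longrightarrow> f x = 0"
  shows "2 * en f = (\<Sum>x\<in>S. \<Sum>y\<in>S. w x y * (f x - f y)\<^sup>2) + 2 * (\<Sum>x\<in>S. (f x)\<^sup>2 * (\<mu> x - (\<Sum>y\<in>S. w x y)))"
proof -
  have 1: "ip f (T UNIV f) = (\<Sum>x\<in>S. \<Sum>y\<in>S. w x y * f y * f x)"
    unfolding ip_commute[of f] by (rule ip_T) (use S in auto)
  have 2: "ip f f = (\<Sum>x\<in>S. (f x)\<^sup>2 * \<mu> x)"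
    using S by (simp add: ip_eq[of S] power2_eq_square)
  have "(\<Sum>x\<in>S. \<Sum>y\<in>S. w x y * (f x - f y)\<^sup>2) =
      (\<Sum>x\<in>S. \<Sum>y\<in>S. w x y * (f x)\<^sup>2) + (\<Sum>x\<in>S. \<Sum>y\<in>S. w x y * (f y)\<^sup>2) - 2 * (\<Sum>x\<in>S. \<Sum>y\<in>S. w x y * f y * f x)"
    by (simp add: power2_eq_square algebra_simps sum.distrib sum_subtractf sum_distrib_left)
  then show ?thesis
    unfolding en_def 1 2 using double_sum_square[OF S(1), of f]
    by (simp add: right_diff_distrib sum_subtractf)
qed

text \<open>The spectrum of the killed operator lies above -1: this is the energy computation with
  \<open>f x + f y\<close> in place of \<open>f x - f y\<close>.\<close>

lemma ip_T_ge:
  assumes "fs f" "\<And>x. x \<notin> A \<Longrightarrow> f x = 0"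
  shows "0 \<le> ip f f + ip f (T A f)"
proof -
  obtain S where S: "finite S" "\<And>x. x \<notin> S \<Longrightarrow> f x = 0"
    using fsE[OF assms(1)] by blast
  have 1: "ip f (T A f) = (\<Sum>x\<in>S. \<Sum>y\<in>S. w x y * f y * f x)"
    unfolding ip_commute[of f] by (rule ip_T) (use S assms in auto)
  have 2: "ip f f = (\<Sum>x\<in>S. (f x)\<^sup>2 * \<mu> x)"
    using S by (simp add: ip_eq[of S] power2_eq_square)
  have "0 \<le> (\<Sum>x\<in>S. \<Sum>y\<in>S. w x y * (f x + f y)\<^sup>2) + 2 * (\<Sum>x\<in>S. (f x)\<^sup>2 * (\<mu> x - (\<Sum>y\<in>S. w x y)))"
    by (intro add_nonneg_nonneg sum_nonneg mult_nonneg_nonneg weight_nonneg)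
       (auto simp: sum_w_le[OF S(1)])
  also have "(\<Sum>x\<in>S. \<Sum>y\<in>S. w x y * (f x + f y)\<^sup>2) =
      (\<Sum>x\<in>S. \<Sum>y\<in>S. w x y * (f x)\<^sup>2) + (\<Sum>x\<in>S. \<Sum>y\<in>S. w x y * (f y)\<^sup>2) + 2 * (\<Sum>x\<in>S. \<Sum>y\<in>S. w x y * f y * f x)"
    by (simp add: power2_eq_square algebra_simps sum.distrib sum_subtractf sum_distrib_left)
  finally show ?thesis
    unfolding 1 2 using double_sum_square[OF S(1), of f]
    by (simp add: right_diff_distrib sum_subtractf)
qed

lemma en_nonneg: "fs f \<Longrightarrow> 0 \<le> en f"
proof (erule fsE)
  fix S assume S: "finite S" "\<And>x. x \<notin> S \<Longrightarrow> f x = 0"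
  have "0 \<le> (\<Sum>x\<in>S. \<Sum>y\<in>S. w x y * (f x - f y)\<^sup>2) + 2 * (\<Sum>x\<in>S. (f x)\<^sup>2 * (\<mu> x - (\<Sum>y\<in>S. w x y)))"
    by (intro add_nonneg_nonneg sum_nonneg mult_nonneg_nonneg weight_nonneg)
       (auto simp: sum_w_le[OF S(1)])
  then show ?thesis
    using en_repr[of S f, OF S] by linarith
qed

text \<open>In \<open>en_repr\<close> the squares carry nonnegative coefficients, so domination may
  be checked pair by pair. One function gives the contraction property of the energy; a family is
  what truncation at many levels uses.\<close>

lemma en_sum_le:
  assumes "fs f" "finite K"
    and diff: "\<And>x y. (\<Sum>k\<in>K. (g k x - g k y)\<^sup>2) \<le> (f x - f y)\<^sup>2"
    and sq: "\<And>x. (\<Sum>k\<in>K. (g k x)\<^sup>2) \<le> (f x)\<^sup>2"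
  shows "(\<Sum>k\<in>K. en (g k)) \<le> en f"
proof -
  obtain S where S: "finite S" "\<And>x. x \<notin> S \<Longrightarrow> f x = 0"
    using fsE[OF assms(1)] by blast
  have g: "g k x = 0" if "x \<notin> S" "k \<in> K" for k x
  proof -
    have "(\<Sum>k\<in>K. (g k x)\<^sup>2) = 0"
      using sq[of x] S(2)[OF that(1)] by (simp add: order_antisym sum_nonneg)
    then show ?thesis
      using \<open>finite K\<close> that(2) by (simp add: sum_nonneg_eq_0_iff)
  qed
  have "2 * (\<Sum>k\<in>K. en (g k)) = (\<Sum>k\<in>K. (\<Sum>x\<in>S. \<Sum>y\<in>S. w x y * (g k x - g k y)\<^sup>2) +
      2 * (\<Sum>x\<in>S. (g k x)\<^sup>2 * (\<mu> x - (\<Sum>y\<in>S. w x y))))"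
    by (subst sum_distrib_left) (intro sum.cong refl en_repr S g)
  also have "\<dots> = (\<Sum>x\<in>S. \<Sum>y\<in>S. w x y * (\<Sum>k\<in>K. (g k x - g k y)\<^sup>2)) +
      2 * (\<Sum>x\<in>S. (\<Sum>k\<in>K. (g k x)\<^sup>2) * (\<mu> x - (\<Sum>y\<in>S. w x y)))"
    by (simp only: sum.distrib sum_distrib_left sum_distrib_right sum.swap[of _ K S])
  also have "\<dots> \<le> (\<Sum>x\<in>S. \<Sum>y\<in>S. w x y * (f x - f y)\<^sup>2) + 2 * (\<Sum>x\<in>S. (f x)\<^sup>2 * (\<mu> x - (\<Sum>y\<in>S. w x y)))"
    by (intro add_mono sum_mono mult_left_mono mult_right_mono diff sq weight_nonneg)
       (auto simp: sum_w_le[OF S(1)])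
  also have "\<dots> = 2 * en f"
    by (rule en_repr[OF S, symmetric])
  finally show ?thesis
    by simp
qed

lemma en_mono:
  assumes "fs f" "\<And>x y. (g x - g y)\<^sup>2 \<le> (f x - f y)\<^sup>2" "\<And>x. (g x)\<^sup>2 \<le> (f x)\<^sup>2"
  shows "en g \<le> en f"
  using en_sum_le[OF assms(1), of "{()}" "\<lambda>_. g"] assms(2,3) by simp

lemma norm2_eq:
  assumes "fs f"
  shows "norm2 f = ennreal (ip f f)"
proof -
  obtain S where S: "finite S" "\<And>x. x \<notin> S \<Longrightarrow> f x = 0"
    using fsE[OF assms] by blast
  have "norm2 f = (\<Sum>\<^sub>\<infinity>x\<in>S. ennreal ((f x)\<^sup>2 * \<mu> x))"
    unfolding norm2_def using S by (intro infsum_cong_neutral) auto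
  also have "\<dots> = (\<Sum>x\<in>S. ennreal ((f x)\<^sup>2 * \<mu> x))"
    using S by simp
  also have "\<dots> = ennreal (\<Sum>x\<in>S. (f x)\<^sup>2 * \<mu> x)"
    by (rule sum_ennreal) (simp add: \<mu>_nonneg)
  also have "(\<Sum>x\<in>S. (f x)\<^sup>2 * \<mu> x) = ip f f"
    using S by (simp add: ip_eq[of S] power2_eq_square)
  finally show ?thesis .
qed

lemma dirichlet_form_eq:
  assumes "fs f"
  shows "dirichlet_form f = ennreal (en f)"
proof -
  obtain S where S: "finite S" "\<And>x. x \<notin> S \<Longrightarrow> f x = 0"
    using fsE[OF assms] by blast
  \<comment> \<open>With the neighbours included, every contributing pair lies in
    \<open>S' \<times> S'\<close> and the boundary term of \<open>en_repr\<close> vanishes.\<close>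
  define S' where "S' = S \<union> (\<Union>x\<in>S. nb x)"
  have S': "finite S'" "\<And>x. x \<notin> S' \<Longrightarrow> f x = 0"
    using S finite_nb by (auto simp: S'_def)
  have zero: "w x y * (f x - f y)\<^sup>2 = 0" if "(x, y) \<notin> S' \<times> S'" for x y
  proof (cases "y \<in> nb x")
    case True
    then have "x \<notin> S" "y \<notin> S"
      using that nb_sym[of x y] by (auto simp: S'_def)
    then show ?thesis
      using S by simp
  qed (simp add: w_nb)
  have "dirichlet_form f = (\<Sum>\<^sub>\<infinity>(x, y)\<in>S' \<times> S'. ennreal (w x y * (f x - f y)\<^sup>2)) / 2"
    unfolding dirichlet_form_def
    by (intro arg_cong2[where f = "(/)"] infsum_cong_neutral refl) (clarsimp simp: zero split: prod.splits)+
  also have "(\<Sum>\<^sub>\<infinity>(x, y)\<in>S' \<times> S'. ennreal (w x y * (f x - f y)\<^sup>2)) =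
      (\<Sum>(x, y)\<in>S' \<times> S'. ennreal (w x y * (f x - f y)\<^sup>2))"
    using S' by simp
  also have "\<dots> = ennreal (\<Sum>(x, y)\<in>S' \<times> S'. w x y * (f x - f y)\<^sup>2)"
    by (subst sum_ennreal[symmetric]) (auto simp: weight_nonneg intro!: sum.cong)
  also have "(\<Sum>(x, y)\<in>S' \<times> S'. w x y * (f x - f y)\<^sup>2) = (\<Sum>x\<in>S'. \<Sum>y\<in>S'. w x y * (f x - f y)\<^sup>2)"
    by (simp add: sum.cartesian_product)
  also have "\<dots> = 2 * en f"
  proof -
    have "(f x)\<^sup>2 * (\<mu> x - (\<Sum>y\<in>S'. w x y)) = 0" for x
    proof (cases "x \<in> S")
      case True
      then have "nb x \<subseteq> S'"
        by (auto simp: S'_def)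
      then have "(\<Sum>y\<in>S'. w x y) = (\<Sum>y\<in>nb x. w x y)"
        using S'(1) by (intro sum.mono_neutral_right) (auto simp: w_nb)
      then show ?thesis
        by (simp add: sum_nb_w)
    qed (simp add: S)
    then have "(\<Sum>x\<in>S'. (f x)\<^sup>2 * (\<mu> x - (\<Sum>y\<in>S'. w x y))) = 0"
      by (intro sum.neutral) blast
    then show ?thesis
      using en_repr[of S' f, OF S'] by linarith
  qed
  also have "ennreal (2 * en f) / 2 = ennreal (en f)"
    using en_nonneg[OF assms] by (simp add: ennreal_divide_numeral)
  finally show ?thesis .
qed

subsection \<open>Real-valued forms of the conditions\<close>

definition bnd :: "real \<Rightarrow> real \<Rightarrow> 'a \<Rightarrow> real \<Rightarrow> 'a set \<Rightarrow> real" where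
  "bnd C \<delta> x R A = C * Er x R * (vol A / V x (3 * R)) powr \<delta>"

text \<open>Multiplied out, without quotient or reciprocal, so that \<open>f = 0\<close> and
  \<open>A = {}\<close> are covered too.\<close>

definition FKr :: "real \<Rightarrow> real \<Rightarrow> bool" where
  "FKr C \<delta> \<longleftrightarrow> (\<forall>x R A f. R > 0 \<longrightarrow> A \<subseteq> B x (3 * R) \<longrightarrow> (\<forall>x. x \<notin> A \<longrightarrow> f x = 0) \<longrightarrow>
     ip f f \<le> bnd C \<delta> x R A * en f)"

text \<open>Condition (\<rho>) read as a lower bound for the capacity, which is the reciprocal of
  the resistance.\<close>

definition capr :: "real \<Rightarrow> real \<Rightarrow> bool" where
  "capr C \<delta> \<longleftrightarrow> (\<forall>x R A D f. R > 0 \<longrightarrow> D \<noteq> {} \<longrightarrow> D \<subseteq> A \<longrightarrow> A \<subseteq> B x (3 * R) \<longrightarrow>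
     (\<forall>x\<in>D. f x = 1) \<longrightarrow> (\<forall>x. x \<notin> A \<longrightarrow> f x = 0) \<longrightarrow> vol D \<le> bnd C \<delta> x R A * en f)"

definition Eexit :: "real \<Rightarrow> real \<Rightarrow> bool" where
  "Eexit C \<delta> \<longleftrightarrow> (\<forall>x R A y. R > 0 \<longrightarrow> A \<subseteq> B x (3 * R) \<longrightarrow> y \<in> A \<longrightarrow> mx A y \<le> bnd C \<delta> x R A)"

lemma ennreal_bnd:
  "0 < C \<Longrightarrow> ennreal C * E x R * ennreal ((vol A / V x (3 * R)) powr \<delta>) = ennreal (bnd C \<delta> x R A)"
  by (simp add: E_eq bnd_def Er_nonneg flip: ennreal_mult)

lemma bnd_pos:
  assumes "0 < C" "R > 0" "A \<noteq> {}" "A \<subseteq> B x (3 * R)"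
  shows "0 < bnd C \<delta> x R A"
proof -
  have "0 < vol A"
    using assms by (intro vol_pos) (auto intro: finite_subset)
  moreover have "0 < V x (3 * R)"
    using assms by (simp add: V_pos)
  ultimately show ?thesis
    using assms Er_ge1[of R x] by (simp add: bnd_def)
qed

lemma cond_E_iff: "cond_E \<longleftrightarrow> (\<exists>C>0. \<exists>\<delta>>0. Eexit C \<delta>)"
proof -
  have "max_exit A \<le> ennreal C * E x R * ennreal ((vol A / V x (3 * R)) powr \<delta>) \<longleftrightarrow>
      (\<forall>y\<in>A. mx A y \<le> bnd C \<delta> x R A)"
    if "0 < C" "R > 0" "A \<noteq> {}" "A \<subseteq> B x (3 * R)" for C R A x \<delta>
  proof -
    have "finite A"
      using that by (auto intro: finite_subset)
    then show ?thesis
      using bnd_pos[OF that, of \<delta>] mx_nonneg[of A] that(1)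
      by (simp add: ennreal_bnd max_exit_def SUP_le_iff mean_exit_eq ennreal_le_iff less_imp_le)
  qed
  then show ?thesis
    unfolding cond_E_def Eexit_def by (metis empty_iff)
qed

lemma inverse_eigenvalue_le_iff:
  assumes fin: "finite A" and k: "0 < k"
  shows "inverse (eigenvalue A) \<le> ennreal k \<longleftrightarrow>
    (\<forall>f. (\<forall>x. x \<notin> A \<longrightarrow> f x = 0) \<longrightarrow> ip f f \<le> k * en f)"
proof -
  have one: "ennreal (1 / k) \<le> dirichlet_form f / norm2 f \<longleftrightarrow> ip f f \<le> k * en f"
    if f: "f \<noteq> (\<lambda>_. 0)" "\<forall>x. x \<notin> A \<longrightarrow> f x = 0" for f
  proof -
    have fs: "fs f"
      using fin f(2) by (auto intro: fsI)
    obtain z where "f z \<noteq> 0"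
      using f(1) by auto
    then have pos: "0 < ip f f"
      using ip_self_pos[OF fs] by blast
    show ?thesis
      unfolding dirichlet_form_eq[OF fs] norm2_eq[OF fs] divide_ennreal[OF en_nonneg[OF fs] pos]
      using k pos en_nonneg[OF fs] by (simp add: field_simps)
  qed
  have "inverse (eigenvalue A) \<le> ennreal k \<longleftrightarrow>
      (\<forall>f. f \<noteq> (\<lambda>_. 0) \<and> (\<forall>x. x \<notin> A \<longrightarrow> f x = 0) \<longrightarrow> ip f f \<le> k * en f)"
    unfolding inverse_ennreal_le_iff[OF k] eigenvalue_def le_INF_iff by (auto simp: one)
  also have "\<dots> \<longleftrightarrow> (\<forall>f. (\<forall>x. x \<notin> A \<longrightarrow> f x = 0) \<longrightarrow> ip f f \<le> k * en f)"
  proof (intro all_cong1 iffI impI)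
    fix f assume "f \<noteq> (\<lambda>_. 0) \<and> (\<forall>x. x \<notin> A \<longrightarrow> f x = 0) \<longrightarrow> ip f f \<le> k * en f" "\<forall>x. x \<notin> A \<longrightarrow> f x = 0"
    then show "ip f f \<le> k * en f"
      by (cases "f = (\<lambda>_. 0)") (simp_all add: ip_def en_def)
  qed blast
  finally show ?thesis .
qed

lemma cond_FK_iff: "cond_FK \<longleftrightarrow> (\<exists>C>0. \<exists>\<delta>>0. FKr C \<delta>)"
proof -
  have "(\<forall>x R A. R > 0 \<longrightarrow> A \<noteq> {} \<longrightarrow> A \<subseteq> B x (3 * R) \<longrightarrow>
      inverse (eigenvalue A) \<le> ennreal C * E x R * ennreal ((vol A / V x (3 * R)) powr \<delta>)) \<longleftrightarrow> FKr C \<delta>"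
    (is "?L \<longleftrightarrow> _") if C: "0 < C" for C \<delta>
  proof -
    have iff: "inverse (eigenvalue A) \<le> ennreal (bnd C \<delta> x R A) \<longleftrightarrow>
        (\<forall>f. (\<forall>x. x \<notin> A \<longrightarrow> f x = 0) \<longrightarrow> ip f f \<le> bnd C \<delta> x R A * en f)"
      if "R > 0" "A \<noteq> {}" "A \<subseteq> B x (3 * R)" for x R A
      using that C by (intro inverse_eigenvalue_le_iff bnd_pos) (auto intro: finite_subset[OF _ finite_B])
    have empty: "ip f f \<le> k * en f" if "\<forall>x. f x = 0" for f :: "'a \<Rightarrow> real" and k
      using that by (simp add: ip_def en_def T_def)
    show ?thesis
    proof
      assume L: ?L
      show "FKr C \<delta>"
        unfolding FKr_def
      proof (intro allI impI)
        fix x R A and f :: "'a \<Rightarrow> real"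
        assume A: "R > 0" "A \<subseteq> B x (3 * R)" and f: "\<forall>x. x \<notin> A \<longrightarrow> f x = 0"
        show "ip f f \<le> bnd C \<delta> x R A * en f"
        proof (cases "A = {}")
          case True
          with f show ?thesis
            by (intro empty) simp
        next
          case False
          have "inverse (eigenvalue A) \<le> ennreal (bnd C \<delta> x R A)"
            using L[rule_format, OF A(1) False A(2)] by (simp only: ennreal_bnd[OF C])
          with f show ?thesis
            unfolding iff[OF A(1) False A(2)] by simp
        qed
      qed
    next
      assume FK: "FKr C \<delta>"
      show ?L
        unfolding ennreal_bnd[OF C]
      proof (intro allI impI)
        fix x R A assume "R > 0" "A \<noteq> {}" "A \<subseteq> B x (3 * R)"
        then show "inverse (eigenvalue A) \<le> ennreal (bnd C \<delta> x R A)"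
          using FK by (simp add: iff FKr_def)
      qed
    qed
  qed
  then show ?thesis
    unfolding cond_FK_def by (simp only: cong: conj_cong)
qed

lemma cond_rho_imp_capr:
  assumes cond_rho
  shows "\<exists>C>0. \<exists>\<delta>>0. capr C \<delta>"
proof -
  obtain C \<delta> where C: "C > 0" "\<delta> > 0" and
    H: "\<And>x R A D. R > 0 \<Longrightarrow> D \<noteq> {} \<Longrightarrow> D \<subseteq> A \<Longrightarrow> A \<subseteq> B x (3 * R) \<Longrightarrow>
        resistance D (UNIV - A) * ennreal (vol D) \<le> ennreal C * E x R * ennreal ((vol A / V x (3 * R)) powr \<delta>)"
    using assms unfolding cond_rho_def by blast
  have "capr C \<delta>"
    unfolding capr_def
  proof (intro allI impI)
    fix x R A D and f :: "'a \<Rightarrow> real" assume R: "R > 0" and D: "D \<noteq> {}" "D \<subseteq> A" "A \<subseteq> B x (3 * R)"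
      and f: "\<forall>x\<in>D. f x = 1" "\<forall>x. x \<notin> A \<longrightarrow> f x = 0"
    let ?k = "bnd C \<delta> x R A"
    have fin: "finite A"
      using D by (auto intro: finite_subset)
    have k: "0 < ?k"
      using C R D by (intro bnd_pos) auto
    have vol: "0 < vol D"
      using D finite_subset[OF D(2) fin] by (intro vol_pos)
    have fs: "fs f"
      using fin f(2) by (auto intro: fsI)
    have "(INF f\<in>{f. (\<forall>x\<in>D. f x = 1) \<and> (\<forall>x\<in>UNIV - A. f x = 0)}. dirichlet_form f) \<le> ennreal (en f)"
      using f dirichlet_form_eq[OF fs] by (intro INF_lower2[of f]) auto
    then have "inverse (ennreal (en f)) \<le> resistance D (UNIV - A)"
      unfolding resistance_def by (rule inverse_ennreal_antimono)
    then have "inverse (ennreal (en f)) * ennreal (vol D) \<le> ennreal ?k"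
      using H[OF R D] unfolding ennreal_bnd[OF C(1)] by (meson mult_right_mono order_trans zero_le)
    \<comment> \<open>Zero energy would make the left-hand side infinite.\<close>
    moreover have "en f \<noteq> 0"
      using calculation vol by (auto simp: ennreal_top_mult top_unique)
    then have "0 < en f"
      using en_nonneg[OF fs] by simp
    ultimately have "vol D / en f \<le> ?k"
      using k vol by (simp add: inverse_ennreal divide_inverse mult.commute flip: ennreal_mult'')
    then show "vol D \<le> ?k * en f"
      using \<open>0 < en f\<close> by (simp add: field_simps)
  qed
  with C show ?thesis
    by blast
qed

lemma FK_imp_rho:
  assumes cond_FK
  shows cond_rho
proof -
  obtain C \<delta> where C: "C > 0" "\<delta> > 0" "FKr C \<delta>"
    using assms cond_FK_iff by blast
  show ?thesis
    unfolding cond_rho_def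
  proof (rule exI[of _ C], intro conjI C, rule exI[of _ \<delta>], intro conjI allI impI C)
    fix x R A D assume R: "R > 0" and D: "D \<noteq> {}" "D \<subseteq> A" "A \<subseteq> B x (3 * R)"
    let ?k = "bnd C \<delta> x R A"
    have fin: "finite A" "finite D"
      using D finite_subset[OF D(2)] finite_subset[OF D(3)] by auto
    have k: "0 < ?k"
      using C R D by (intro bnd_pos) auto
    have vol: "0 < vol D"
      using D fin by (intro vol_pos)
    have "ennreal (1 / (?k / vol D)) \<le> dirichlet_form f"
      if f: "\<forall>x\<in>D. f x = 1" "\<forall>x\<in>UNIV - A. f x = 0" for f
    proof -
      have fs: "fs f"
        using fin f(2) by (auto intro: fsI)
      have "vol D = ip (indicator D) (indicator D)"
        using fin(2) by (subst ip_eq[of D]) (auto simp: vol_eq)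
      also have "\<dots> \<le> ip f f"
        using f(1) by (intro ip_mono fs fsI[OF fin(2)]) (auto simp: indicator_def)
      also have "\<dots> \<le> ?k * en f"
        using C(3) R D f(2) by (auto simp: FKr_def)
      finally show ?thesis
        using k by (simp add: dirichlet_form_eq[OF fs] ennreal_leI field_simps)
    qed
    then have "resistance D (UNIV - A) \<le> ennreal (?k / vol D)"
      unfolding resistance_def using k vol by (subst inverse_ennreal_le_iff) (auto intro!: INF_greatest)
    then have "resistance D (UNIV - A) * ennreal (vol D) \<le> ennreal (?k / vol D) * ennreal (vol D)"
      by (rule mult_right_mono) simp
    also have "\<dots> = ennreal ?k"
      using k vol by (simp flip: ennreal_mult)
    finally show "resistance D (UNIV - A) * ennreal (vol D)
        \<le> ennreal C * E x R * ennreal ((vol A / V x (3 * R)) powr \<delta>)"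
      by (simp add: ennreal_bnd[OF C(1)])
  qed
qed

end

section \<open>Elementary inequalities for truncations and decaying sequences\<close>

lemma sum_squares_le_square_sum:
  fixes z :: "'b \<Rightarrow> real"
  assumes "finite K" "\<And>k. k \<in> K \<Longrightarrow> 0 \<le> z k"
  shows "(\<Sum>k\<in>K. (z k)\<^sup>2) \<le> (\<Sum>k\<in>K. z k)\<^sup>2"
  using assms
proof (induction K rule: finite_induct)
  case (insert a K)
  have "0 \<le> z a * (\<Sum>k\<in>K. z k)"
    using insert.prems by (intro mult_nonneg_nonneg sum_nonneg) auto
  then show ?case
    using insert by (simp add: power2_sum)
qed simp

lemma sum_truncations:
  fixes t :: "nat \<Rightarrow> real"
  assumes "incseq t"
  shows "(\<Sum>k<n. min (max a (t k)) (t (Suc k)) - t k) = min (max a (t 0)) (t n) - t 0"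
proof (induction n)
  case (Suc n)
  have "t 0 \<le> t n" "t n \<le> t (Suc n)"
    using assms by (auto simp: incseq_def)
  then show ?case
    using Suc by (auto simp: min_def max_def)
qed simp

text \<open>Discrete form of the equation \<open>a' = - c * a^(1+\<delta>)\<close>: each step raises
  \<open>a^(-\<delta>)\<close> by at least \<open>\<delta> * c\<close>, by Bernoulli's inequality
  with a negative exponent.\<close>

lemma power_decay:
  fixes a :: "nat \<Rightarrow> real"
  assumes "0 < c" "0 < \<delta>" and nonneg: "\<And>k. 0 \<le> a k"
    and step: "\<And>k. a (Suc k) \<le> a k - c * a k powr (1 + \<delta>)"
    and "0 < n"
  shows "a n \<le> (1 / (\<delta> * c * real n)) powr (1 / \<delta>)"
proof (cases "a n = 0")
  case False
  then have n: "0 < a n"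
    using nonneg[of n] by simp
  have "real k * (\<delta> * c) \<le> a k powr - \<delta>" if "0 < a k" for k
    using that
  proof (induction k)
    case (Suc k)
    define z where "z = c * a k powr \<delta>"
    have "a (Suc k) \<le> a k"
      using step[of k] assms(1) by (smt (verit) mult_nonneg_nonneg powr_ge_zero)
    then have pos: "0 < a k"
      using Suc.prems by simp
    have "a k powr (1 + \<delta>) = a k * a k powr \<delta>"
      using pos by (simp add: powr_add)
    then have le: "a (Suc k) \<le> a k * (1 - z)"
      using step[of k] by (simp add: z_def algebra_simps)
    have z: "0 < z" "z < 1"
    proof -
      show "0 < z"
        using pos assms(1) by (simp add: z_def)
      have "0 < a k * (1 - z)"
        using le Suc.prems by linarith
      then show "z < 1"
        using pos by (simp add: zero_less_mult_iff)
    qed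
    have "1 + \<delta> * z \<le> 1 + \<delta> * - ln (1 - z)"
      using ln_le_minus_one[of "1 - z"] z assms(2) by (intro add_left_mono mult_left_mono) auto
    also have "\<dots> \<le> exp (\<delta> * - ln (1 - z))"
      by (rule exp_ge_add_one_self)
    also have "\<dots> = (1 - z) powr - \<delta>"
      using z by (simp add: powr_def)
    finally have bern: "1 + \<delta> * z \<le> (1 - z) powr - \<delta>" .
    have "real (Suc k) * (\<delta> * c) = real k * (\<delta> * c) + \<delta> * c"
      by (simp add: algebra_simps)
    also have "\<dots> \<le> a k powr - \<delta> + \<delta> * c"
      using Suc.IH[OF pos] by simp
    also have "\<dots> = a k powr - \<delta> * (1 + \<delta> * z)"
      using pos by (simp add: z_def powr_minus field_simps)
    also have "\<dots> \<le> a k powr - \<delta> * (1 - z) powr - \<delta>"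
      by (intro mult_left_mono bern) simp
    also have "\<dots> = (a k * (1 - z)) powr - \<delta>"
      using pos z by (simp add: powr_mult)
    also have "\<dots> \<le> a (Suc k) powr - \<delta>"
      using le Suc.prems assms(2) by (intro powr_mono2') auto
    finally show ?case .
  qed simp
  from this[OF n] have *: "\<delta> * c * real n \<le> a n powr - \<delta>"
    by (simp add: mult_ac)
  have "a n = (a n powr - \<delta>) powr (- 1 / \<delta>)"
    using n assms(2) by (simp add: powr_powr)
  also have "\<dots> \<le> (\<delta> * c * real n) powr (- 1 / \<delta>)"
    using * assms by (intro powr_mono2') (auto simp: divide_nonpos_pos)
  also have "\<dots> = (1 / (\<delta> * c * real n)) powr (1 / \<delta>)"
    using assms by (simp add: powr_minus_divide powr_divide)
  finally show ?thesis .
qed simp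

context weighted_graph_p0 begin

subsection \<open>Exit times and eigenvalues\<close>

text \<open>The mean exit time \<open>u\<close> satisfies \<open>u - Pu = 1\<close> on \<open>A\<close>, and
  \<open>2 f(x) f(y) \<le> f(x)\<^sup>2 u(y)/u(x) + f(y)\<^sup>2 u(x)/u(y)\<close> turns this into a lower bound for the energy.\<close>

lemma ip_le_mx_en:
  assumes fin: "finite A" and f: "\<And>x. x \<notin> A \<Longrightarrow> f x = 0" and M: "\<And>x. x \<in> A \<Longrightarrow> mx A x \<le> M"
  shows "ip f f \<le> M * en f"
proof -
  define u where "u = mx A"
  have u1: "1 \<le> u x" if "x \<in> A" for x
    using mx_ge1[OF fin that] by (simp add: u_def)
  let ?s = "\<Sum>x\<in>A. \<Sum>y\<in>A. w x y * ((f x)\<^sup>2 * u y / u x)"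
  have "2 * ip f (T A f) = (\<Sum>x\<in>A. \<Sum>y\<in>A. w x y * (2 * f x * f y))"
    unfolding ip_commute[of f] by (subst ip_T[of A]) (use fin f in \<open>auto simp: sum_distrib_left mult_ac\<close>)
  also have "\<dots> \<le> (\<Sum>x\<in>A. \<Sum>y\<in>A. w x y * ((f x)\<^sup>2 * u y / u x + (f y)\<^sup>2 * u x / u y))"
  proof (intro sum_mono mult_left_mono weight_nonneg)
    fix x y assume "x \<in> A" "y \<in> A"
    then have pos: "0 < u x" "0 < u y"
      using u1[of x] u1[of y] by auto
    have "0 \<le> (f x * u y - f y * u x)\<^sup>2"
      by simp
    then show "2 * f x * f y \<le> (f x)\<^sup>2 * u y / u x + (f y)\<^sup>2 * u x / u y"
      using pos by (simp add: field_simps power2_eq_square)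
  qed
  also have "\<dots> = ?s + (\<Sum>x\<in>A. \<Sum>y\<in>A. w x y * ((f y)\<^sup>2 * u x / u y))"
    by (simp add: distrib_left sum.distrib)
  also have "(\<Sum>x\<in>A. \<Sum>y\<in>A. w x y * ((f y)\<^sup>2 * u x / u y)) = ?s"
    by (subst sum.swap) (simp add: weight_sym)
  finally have "ip f (T A f) \<le> ?s"
    by simp
  also have "?s = (\<Sum>x\<in>A. (f x)\<^sup>2 * \<mu> x * (1 - 1 / u x))"
  proof (rule sum.cong)
    fix x assume x: "x \<in> A"
    have "(\<Sum>y\<in>A. w x y * ((f x)\<^sup>2 * u y / u x)) = (f x)\<^sup>2 / u x * (\<Sum>y\<in>A. w x y * u y)"
      by (simp add: sum_distrib_left sum_divide_distrib mult_ac)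
    also have "(\<Sum>y\<in>A. w x y * u y) = (u x - 1) * \<mu> x"
      using T_sum[OF fin _ x, of u] mx_rec[OF fin x] by (simp add: u_def mx_out)
    also have "(f x)\<^sup>2 / u x * ((u x - 1) * \<mu> x) = (f x)\<^sup>2 * \<mu> x * (1 - 1 / u x)"
      using u1[OF x] by (simp add: field_simps)
    finally show "(\<Sum>y\<in>A. w x y * ((f x)\<^sup>2 * u y / u x)) = (f x)\<^sup>2 * \<mu> x * (1 - 1 / u x)" .
  qed simp
  also have "\<dots> = ip f f - (\<Sum>x\<in>A. (f x)\<^sup>2 * \<mu> x / u x)"
    using fin f by (simp add: ip_eq[of A] right_diff_distrib sum_subtractf power2_eq_square)
  finally have le: "(\<Sum>x\<in>A. (f x)\<^sup>2 * \<mu> x / u x) \<le> en f"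
    using en_killed[of A f] f by simp
  show ?thesis
  proof (cases "A = {}")
    case True
    then show ?thesis
      using f by (simp add: ip_def en_def)
  next
    case False
    then have "1 \<le> M"
      using u1 M unfolding u_def by (meson all_not_in_conv order_trans)
    have "ip f f = (\<Sum>x\<in>A. (f x)\<^sup>2 * \<mu> x)"
      using fin f by (simp add: ip_eq[of A] power2_eq_square)
    also have "\<dots> \<le> (\<Sum>x\<in>A. M * ((f x)\<^sup>2 * \<mu> x / u x))"
    proof (rule sum_mono)
      fix x assume x: "x \<in> A"
      have "(f x)\<^sup>2 * \<mu> x * u x \<le> (f x)\<^sup>2 * \<mu> x * M"
        using M[OF x] by (intro mult_left_mono) (auto simp: u_def \<mu>_nonneg)
      then show "(f x)\<^sup>2 * \<mu> x \<le> M * ((f x)\<^sup>2 * \<mu> x / u x)"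
        using u1[OF x] by (simp add: field_simps)
    qed
    also have "\<dots> = M * (\<Sum>x\<in>A. (f x)\<^sup>2 * \<mu> x / u x)"
      by (simp only: sum_distrib_left)
    also have "\<dots> \<le> M * en f"
      using le \<open>1 \<le> M\<close> by (intro mult_left_mono) auto
    finally show ?thesis .
  qed
qed

lemma Eexit_imp_FKr: "Eexit C \<delta> \<Longrightarrow> FKr C \<delta>"
  unfolding FKr_def
proof (intro allI impI)
  fix x R A and f :: "'a \<Rightarrow> real"
  assume E: "Eexit C \<delta>" and "R > 0" "A \<subseteq> B x (3 * R)" "\<forall>x. x \<notin> A \<longrightarrow> f x = 0"
  then show "ip f f \<le> bnd C \<delta> x R A * en f"
    by (intro ip_le_mx_en[of A]) (auto simp: Eexit_def intro: finite_subset[OF _ finite_B])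
qed

subsection \<open>Resistances and eigenvalues\<close>

lemma en_cmult: "en (\<lambda>x. c * f x) = c\<^sup>2 * en f"
proof -
  have "ip (\<lambda>x. c * f x) (\<lambda>x. c * g x) = c\<^sup>2 * ip f g" for g
  proof (cases "c = 0")
    case False
    then show ?thesis
      by (simp add: ip_def power2_eq_square sum_distrib_left mult_ac)
  qed (simp add: ip_def)
  moreover have "T UNIV (\<lambda>x. c * f x) = (\<lambda>x. c * T UNIV f x)"
    by (rule ext) (rule T_cmult)
  ultimately show ?thesis
    by (simp add: en_def right_diff_distrib)
qed

text \<open>The truncations of \<open>|f|\<close> between the dyadic levels \<open>t\<^sub>k\<close> and \<open>t\<^sub>k\<^sub>+\<^sub>1\<close> are test functions for
  the capacities of the level sets, and their energies add up to at most that of \<open>f\<close>.\<close>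

lemma capr_imp_FKr:
  assumes C: "0 < C" and cap: "capr C \<delta>"
  shows "FKr (16 * C) \<delta>"
  unfolding FKr_def
proof (intro allI impI)
  fix x0 R A and f :: "'a \<Rightarrow> real"
  assume R: "R > 0" and A: "A \<subseteq> B x0 (3 * R)" and "\<forall>x. x \<notin> A \<longrightarrow> f x = 0"
  then have f: "\<And>x. x \<notin> A \<Longrightarrow> f x = 0"
    by blast
  have fin: "finite A"
    using A by (auto intro: finite_subset)
  have fs: "fs f"
    using fin f by (rule fsI)
  show "ip f f \<le> bnd (16 * C) \<delta> x0 R A * en f"
  proof (cases "\<exists>z. f z \<noteq> 0")
    case False
    then show ?thesis
      by (simp add: ip_def en_def)
  next
    case True
    let ?S = "{x\<in>A. f x \<noteq> 0}"
    have S: "finite ?S" "?S \<noteq> {}"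
      using fin True f by auto
    define m where "m = Min ((\<lambda>x. \<bar>f x\<bar>) ` ?S)"
    define M where "M = Max ((\<lambda>x. \<bar>f x\<bar>) ` ?S)"
    have m: "0 < m"
      using S by (auto simp: m_def)
    have mM: "m \<le> \<bar>f x\<bar>" "\<bar>f x\<bar> \<le> M" if "f x \<noteq> 0" for x
      using S that f[of x] by (auto simp: m_def M_def intro!: Min_le Max_ge)
    obtain n where n: "M / m < 2 ^ n"
      using real_arch_pow[of 2 "M / m"] by auto
    \<comment> \<open>Since \<open>t 1 = m\<close>, the whole support of \<open>f\<close> lies in
      the lowest level set \<open>D 0\<close>; by the choice of \<open>n\<close>, no point reaches
      level \<open>t (Suc n)\<close>.\<close>
    define t where "t k = m / 2 * 2 ^ k" for k :: nat
    have t_pos: "0 < t k" for k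
      using m by (simp add: t_def)
    have t_Suc: "t (Suc k) = 2 * t k" for k
      by (simp add: t_def)
    have t_inc: "incseq t"
      using t_pos t_Suc by (intro incseq_SucI) (simp add: less_imp_le)
    define g where "g k x = min (max \<bar>f x\<bar> (t k)) (t (Suc k)) - t k" for k x
    have g_nonneg: "0 \<le> g k x" for k x
      using t_pos[of k] by (simp add: g_def t_Suc)
    have g_sum: "(\<Sum>k<n. g k x) = min (max \<bar>f x\<bar> (t 0)) (t n) - t 0" for x
      unfolding g_def by (rule sum_truncations[OF t_inc])
    have "(\<Sum>k<n. en (g k)) \<le> en f"
    proof (rule en_sum_le[OF fs])
      \<comment> \<open>Once the two values are ordered, all slices differ with the same sign, so
        the sum of squares is at most the square of the sum.\<close>
      have *: "(\<Sum>k<n. (g k x - g k y)\<^sup>2) \<le> (f x - f y)\<^sup>2" if le: "\<bar>f y\<bar> \<le> \<bar>f x\<bar>" for x y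
      proof -
        have "0 \<le> g k x - g k y" for k
          using le by (simp add: g_def min_def max_def)
        then have "(\<Sum>k<n. (g k x - g k y)\<^sup>2) \<le> (\<Sum>k<n. g k x - g k y)\<^sup>2"
          and "0 \<le> (\<Sum>k<n. g k x - g k y)"
          by (auto intro!: sum_squares_le_square_sum sum_nonneg)
        moreover have "(\<Sum>k<n. g k x - g k y) \<le> \<bar>f x\<bar> - \<bar>f y\<bar>"
          using le unfolding sum_subtractf g_sum by (simp add: min_def max_def)
        moreover have "\<bar>f x\<bar> - \<bar>f y\<bar> \<le> \<bar>f x - f y\<bar>"
          by simp
        ultimately have "(\<Sum>k<n. g k x - g k y)\<^sup>2 \<le> \<bar>f x - f y\<bar>\<^sup>2"
          by (intro power_mono) linarith+
        with \<open>(\<Sum>k<n. (g k x - g k y)\<^sup>2) \<le> _\<close> show ?thesis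
          by simp
      qed
      fix x y
      show "(\<Sum>k<n. (g k x - g k y)\<^sup>2) \<le> (f x - f y)\<^sup>2"
        using *[of x y] *[of y x] by (cases "\<bar>f y\<bar> \<le> \<bar>f x\<bar>") (simp_all add: power2_commute)
      have "(\<Sum>k<n. (g k x)\<^sup>2) \<le> (\<Sum>k<n. g k x)\<^sup>2"
        by (intro sum_squares_le_square_sum g_nonneg) simp
      also have "\<dots> \<le> \<bar>f x\<bar>\<^sup>2"
      proof (rule power_mono)
        show "(\<Sum>k<n. g k x) \<le> \<bar>f x\<bar>"
          unfolding g_sum using t_pos[of 0] by (auto simp: min_def max_def)
      qed (intro sum_nonneg g_nonneg)
      finally show "(\<Sum>k<n. (g k x)\<^sup>2) \<le> (f x)\<^sup>2"
        by simp
    qed simp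
    let ?K = "bnd C \<delta> x0 R A"
    have K: "0 < ?K"
      using C R A S by (intro bnd_pos) auto
    define D where "D k = {x\<in>A. t (Suc k) \<le> \<bar>f x\<bar>}" for k
    have capD: "(t k)\<^sup>2 * vol (D k) \<le> ?K * en (g k)" for k
    proof (cases "D k = {}")
      case True
      have "fs (g k)"
      proof (rule fsI[OF fin])
        fix x assume "x \<notin> A"
        then show "g k x = 0"
          using t_pos[of k] by (simp add: g_def f t_Suc)
      qed
      then show ?thesis
        using True K by (simp add: vol_def en_nonneg)
    next
      case False
      \<comment> \<open>On \<open>D k\<close> the slice is full, of height
        \<open>t (Suc k) - t k = t k\<close>, so \<open>h\<close> is 1 there.\<close>
      define h where "h x = (1 / t k) * g k x" for x
      have "vol (D k) \<le> ?K * en h"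
        using cap unfolding capr_def
      proof (elim allE impE)
        show "\<forall>x\<in>D k. h x = 1"
          using t_pos[of k] by (auto simp: D_def h_def g_def t_Suc)
        show "\<forall>x. x \<notin> A \<longrightarrow> h x = 0"
          using t_pos[of k] by (auto simp: h_def g_def t_Suc f)
      qed (use False R A in \<open>auto simp: D_def\<close>)
      also have "en h = (1 / t k)\<^sup>2 * en (g k)"
        unfolding h_def by (rule en_cmult)
      finally show ?thesis
        using t_pos[of k] by (simp add: field_simps)
    qed
    have low: "(f x)\<^sup>2 \<le> 16 * (\<Sum>k<n. (t k)\<^sup>2 * indicator (D k) x)" if x: "x \<in> A" for x
    proof (cases "f x = 0")
      case True
      then show ?thesis
        by (simp add: sum_nonneg)
    next
      case False
      define P where "P k \<longleftrightarrow> t (Suc k) \<le> \<bar>f x\<bar>" for k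
      have P0: "P 0"
        using mM(1)[OF False] by (simp add: P_def t_def)
      have Pn: "\<not> P k" if "n \<le> k" for k
      proof -
        have "\<bar>f x\<bar> < m * 2 ^ n"
          using mM(2)[OF False] n m by (simp add: field_simps)
        also have "\<dots> \<le> m * 2 ^ k"
          using that m by (intro mult_left_mono) auto
        finally show ?thesis
          by (simp add: P_def t_def)
      qed
      \<comment> \<open>The highest level set containing \<open>x\<close>. Failing the next one
        means \<open>\<bar>f x\<bar> < 4 * t k\<close>, and squaring produces the factor 16.\<close>
      define k where "k = (GREATEST k. P k)"
      have bound: "j \<le> n" if "P j" for j
        using Pn[of j] that by (cases "j \<le> n") auto
      have k: "P k"
        unfolding k_def using P0 bound by (rule GreatestI_nat)
      have "\<not> P (Suc k)"
        using Greatest_le_nat[of P "Suc k" n] bound by (auto simp: k_def)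
      then have "\<bar>f x\<bar> \<le> 4 * t k"
        by (simp add: P_def t_Suc)
      then have "\<bar>f x\<bar>\<^sup>2 \<le> (4 * t k)\<^sup>2"
        by (intro power_mono) auto
      then have "(f x)\<^sup>2 \<le> 16 * (t k)\<^sup>2"
        by (simp add: power_mult_distrib)
      also have "(t k)\<^sup>2 = (t k)\<^sup>2 * indicator (D k) x"
        using k x by (simp add: P_def D_def)
      also have "\<dots> \<le> (\<Sum>k<n. (t k)\<^sup>2 * indicator (D k) x)"
        using Pn[of k] k by (intro member_le_sum) (auto simp: not_le[symmetric])
      finally show ?thesis
        by simp
    qed
    have "ip f f = (\<Sum>x\<in>A. (f x)\<^sup>2 * \<mu> x)"
      using fin f by (simp add: ip_eq[of A] power2_eq_square)
    also have "\<dots> \<le> (\<Sum>x\<in>A. 16 * (\<Sum>k<n. (t k)\<^sup>2 * indicator (D k) x) * \<mu> x)"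
      by (intro sum_mono mult_right_mono low \<mu>_nonneg)
    also have "\<dots> = 16 * (\<Sum>k<n. (t k)\<^sup>2 * (\<Sum>x\<in>A. indicator (D k) x * \<mu> x))"
      by (simp only: sum_distrib_left sum_distrib_right mult.assoc) (rule sum.swap)
    also have "\<dots> = 16 * (\<Sum>k<n. (t k)\<^sup>2 * vol (D k))"
    proof -
      have "(\<Sum>x\<in>A. indicator (D k) x * \<mu> x) = vol (D k)" for k
      proof -
        have "D k \<subseteq> A"
          by (auto simp: D_def)
        then show ?thesis
          using fin by (simp add: vol_eq finite_subset indicator_def if_distrib[of "\<lambda>z. z * _"] sum.If_cases Int_absorb1 cong: if_cong)
      qed
      then show ?thesis
        by simp
    qed
    also have "\<dots> \<le> 16 * (\<Sum>k<n. ?K * en (g k))"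
      by (intro mult_left_mono sum_mono capD) simp
    also have "\<dots> \<le> 16 * (?K * en f)"
      using \<open>(\<Sum>k<n. en (g k)) \<le> en f\<close> K by (simp flip: sum_distrib_left)
    also have "\<dots> = bnd (16 * C) \<delta> x0 R A * en f"
      by (simp add: bnd_def)
    finally show ?thesis .
  qed
qed

subsection \<open>Nash's argument for killed walks\<close>

lemma ip_one_eq: "finite A \<Longrightarrow> (\<And>x. x \<notin> A \<Longrightarrow> v x = 0) \<Longrightarrow> ip v (\<lambda>_. 1) = (\<Sum>x\<in>A. v x * \<mu> x)"
  by (simp add: ip_eq[of A])

text \<open>By symmetry of the killed operator, the total mass of the killed kernel is the survival
  probability from \<open>y\<close>.\<close>

lemma surv_eq_ip:
  assumes "finite A" "y \<in> A"
  shows "ip (Q A n (dens y)) (\<lambda>_. 1) = surv A n y"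
proof -
  have "ip (Q A n (dens y)) (\<lambda>_. 1) = ip (Q A n (dens y)) (indicator A)"
    by (rule ip_cong) (auto simp: indicator_def Q_out)
  also have "\<dots> = ip (dens y) (Q A n (indicator A))"
    using assms by (intro ip_Q_sym fs_dens fsI[of A]) (auto simp: dens_def)
  also have "\<dots> = Q A n (indicator A) y"
    unfolding ip_commute[of "dens y"] by (rule ip_dens)
  also have "Q A n (indicator A) = surv A n"
    by (rule Q_cong) simp
  finally show ?thesis .
qed

text \<open>Chapman-Kolmogorov for the killed kernel, combined with its symmetry.\<close>

lemma ip_Q_dens:
  assumes "x \<in> A" "y \<in> A"
  shows "ip (Q A m (dens x)) (Q A n (dens y)) = Q A (m + n) (dens y) x"
proof -
  have "ip (Q A m (dens x)) (Q A n (dens y)) = ip (dens x) (Q A m (Q A n (dens y)))"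
    using assms by (intro ip_Q_sym fs_dens fs_Q) (auto simp: dens_def Q_out)
  also have "\<dots> = Q A (m + n) (dens y) x"
    unfolding ip_commute[of "dens x"] ip_dens by (simp add: Q_add)
  finally show ?thesis .
qed

lemma Q_dens_nonneg: "0 \<le> Q A n (dens y) x"
  by (rule Q_nonneg) (simp add: dens_def \<mu>_nonneg)

text \<open>With \<open>v = (I + P)f\<close> in place of \<open>f\<close>, periodicity does no harm:
  \<open>(I - P)(I + P) - (I - P)(I + P)\<^sup>2/2 = (I - P)(I + P)(I - P)/2\<close> is positive semidefinite.\<close>

lemma ip_T_decay:
  assumes fs: "fs f" and f: "\<And>x. x \<notin> A \<Longrightarrow> f x = 0"
  shows "en (\<lambda>x. f x + T A f x) / 2 \<le> ip f f - ip (T A f) (T A f)"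
proof -
  define f1 where "f1 = T A f"
  define f2 where "f2 = T A f1"
  define f3 where "f3 = T A f2"
  have fs': "fs f1" "fs f2" "fs f3"
    using fs by (simp_all add: f1_def f2_def f3_def fs_T)
  have zero: "f1 x = 0" "f2 x = 0" "f3 x = 0" if "x \<notin> A" for x
    using that by (simp_all add: f1_def f2_def f3_def T_out)
  have sym: "ip f1 f1 = ip f f2" "ip f1 f2 = ip f f3"
    unfolding f1_def f2_def f3_def
    by (rule ip_T_sym; use fs f in \<open>auto simp: fs_T T_out\<close>)+
  have T1: "T A (\<lambda>x. f x + f1 x) = (\<lambda>x. f1 x + f2 x)" "T A (\<lambda>x. f x - f1 x) = (\<lambda>x. f1 x - f2 x)"
    by (rule ext, simp add: T_add T_diff f1_def f2_def)+
  have "en (\<lambda>x. f x + f1 x) = ip (\<lambda>x. f x + f1 x) (\<lambda>x. f x + f1 x) - ip (\<lambda>x. f x + f1 x) (\<lambda>x. f1 x + f2 x)"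
    using f zero by (subst en_killed[of A]) (auto simp: T1)
  also have "\<dots> = ip f f + ip f f1 - ip f f2 - ip f f3"
    using fs fs' sym ip_commute[of f1 f] by (simp add: ip_add ip_add2 fs_add)
  finally have 1: "en (\<lambda>x. f x + f1 x) = ip f f + ip f f1 - ip f f2 - ip f f3" .
  have "0 \<le> ip (\<lambda>x. f x - f1 x) (\<lambda>x. f x - f1 x) + ip (\<lambda>x. f x - f1 x) (\<lambda>x. f1 x - f2 x)"
    using ip_T_ge[of "\<lambda>x. f x - f1 x" A] fs fs' f zero by (simp add: T1 fs_diff)
  also have "\<dots> = ip f f - ip f f1 - ip f f2 + ip f f3"
    using fs fs' sym ip_commute[of f1 f] by (simp add: ip_diff ip_diff2 fs_diff)
  finally show ?thesis
    using 1 sym unfolding f1_def[symmetric] by simp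
qed

lemma ip_T_le:
  assumes "fs f" "\<And>x. x \<notin> A \<Longrightarrow> f x = 0"
  shows "ip (T A f) (T A f) \<le> ip f f"
  using ip_T_decay[of f A, OF assms] en_nonneg[OF fs_add[OF assms(1) fs_T[OF assms(1), of A]]] by simp

text \<open>Nash inequality from Faber-Krahn: the latter is applied to the positive part of
  \<open>v - s\<close>, supported in \<open>{v > s}\<close>, a set of measure at most
  \<open>2 / s\<close> because \<open>v\<close> has mass at most 2. Cutting at \<open>s\<close>
  costs at most \<open>2 * s * ip v 1 \<le> 4 * s\<close>, and \<open>s = ip v v / 8\<close> makes
  this half of \<open>ip v v\<close>.\<close>

lemma nash:
  assumes FK: "FKr C \<delta>" and C: "0 < C" "0 < \<delta>" and R: "0 < R" and A: "A \<subseteq> B x (3 * R)"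
    and fs: "fs v" and v: "\<And>x. x \<notin> A \<Longrightarrow> v x = 0" "\<And>x. 0 \<le> v x" and L: "ip v (\<lambda>_. 1) \<le> 2"
    and N: "0 < ip v v"
  shows "ip v v \<le> 2 * C * Er x R * (16 / (ip v v * V x (3 * R))) powr \<delta> * en v"
proof -
  let ?N = "ip v v"
  define s where "s = ?N / 8"
  define g where "g x = max (v x - s) 0" for x
  have s: "0 < s"
    using N by (simp add: s_def)
  have fin: "finite A"
    using A by (auto intro: finite_subset)
  define A' where "A' = {x\<in>A. s < v x}"
  have A': "A' \<subseteq> A" "finite A'"
    using fin by (auto simp: A'_def)
  have gz: "g x = 0" if "x \<notin> A'" for x
    using that v(1)[of x] s by (cases "x \<in> A") (auto simp: g_def A'_def)
  have fsg: "fs g"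
    using A'(2) gz by (rule fsI)
  have "ip v v - 2 * s * ip v (\<lambda>_. 1) = (\<Sum>x\<in>A. (v x * v x - 2 * s * v x) * \<mu> x)"
    using fin v by (simp add: ip_eq[of A] left_diff_distrib sum_subtractf sum_distrib_left mult.assoc)
  also have "\<dots> \<le> (\<Sum>x\<in>A. g x * g x * \<mu> x)"
  proof (intro sum_mono mult_right_mono \<mu>_nonneg)
    fix x
    have "0 \<le> s * s"
      by simp
    moreover have "v x * v x \<le> 2 * s * v x" if "v x \<le> s"
      using that v(2)[of x] s mult_right_mono[of "v x" "2 * s" "v x"] by simp
    ultimately show "v x * v x - 2 * s * v x \<le> g x * g x"
      by (cases "v x \<le> s") (auto simp: g_def max_def algebra_simps)
  qed
  also have "\<dots> = ip g g"
    using fin gz A' by (subst ip_eq[of A]) auto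
  finally have "ip v v - 2 * s * ip v (\<lambda>_. 1) \<le> ip g g" .
  moreover have "2 * s * ip v (\<lambda>_. 1) \<le> 2 * s * 2"
    using L s by (intro mult_left_mono) auto
  ultimately have half: "?N / 2 \<le> ip g g"
    by (simp add: s_def)
  have "s * vol A' \<le> (\<Sum>x\<in>A'. v x * \<mu> x)"
    unfolding vol_eq[OF A'(2)] sum_distrib_left
    by (intro sum_mono mult_right_mono \<mu>_nonneg) (auto simp: A'_def)
  also have "\<dots> \<le> (\<Sum>x\<in>A. v x * \<mu> x)"
    using A' fin v by (intro sum_mono2) (auto simp: \<mu>_nonneg)
  also have "\<dots> \<le> 2"
    using L ip_one_eq[OF fin v(1)] by simp
  finally have vol: "vol A' \<le> 16 / ?N"
    using N by (simp add: s_def field_simps)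
  have Vp: "0 < V x (3 * R)"
    using R by (simp add: V_pos)
  have "ip g g \<le> bnd C \<delta> x R A' * en g"
    using FK R A A' gz unfolding FKr_def by (meson order_trans)
  also have "\<dots> \<le> bnd C \<delta> x R A' * en v"
  proof (rule mult_left_mono)
    show "en g \<le> en v"
    proof (rule en_mono[OF fs])
      fix x y
      have "\<bar>g x - g y\<bar> \<le> \<bar>v x - v y\<bar>"
        by (auto simp: g_def max_def)
      then show "(g x - g y)\<^sup>2 \<le> (v x - v y)\<^sup>2"
        by (simp add: abs_le_square_iff)
      have "\<bar>g x\<bar> \<le> \<bar>v x\<bar>"
        using v(2)[of x] s by (auto simp: g_def max_def)
      then show "(g x)\<^sup>2 \<le> (v x)\<^sup>2"
        by (simp add: abs_le_square_iff)
    qed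
    show "0 \<le> bnd C \<delta> x R A'"
      using C by (simp add: bnd_def Er_nonneg)
  qed
  also have "bnd C \<delta> x R A' \<le> C * Er x R * (16 / (?N * V x (3 * R))) powr \<delta>"
    unfolding bnd_def
  proof (intro mult_left_mono powr_mono2)
    show "vol A' / V x (3 * R) \<le> 16 / (?N * V x (3 * R))"
      using vol Vp by (simp add: divide_right_mono flip: divide_divide_eq_left)
    show "0 \<le> vol A' / V x (3 * R)"
      using vol_nonneg[OF A'(2)] Vp by simp
  qed (use C in \<open>auto simp: Er_nonneg\<close>)
  finally have "ip g g \<le> C * Er x R * (16 / (?N * V x (3 * R))) powr \<delta> * en v"
    using en_nonneg[OF fs] by (simp add: mult_right_mono)
  then show ?thesis
    using half by simp
qed

text \<open>Here \<open>a k = ip (u k) (u k)\<close> is the killed return density at time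
  \<open>2 * k\<close>. The Nash inequality is applied to \<open>v = u k + u (Suc k)\<close>, a
  function of mass at most 2 whose energy is at most twice the loss \<open>a k - a (Suc k)\<close>;
  \<open>power_decay\<close> then integrates the resulting inequality.\<close>

lemma FKr_heat_kernel:
  assumes FK: "FKr C \<delta>" and C: "0 < C" "0 < \<delta>" and R: "0 < R" and A: "A \<subseteq> B x (3 * R)"
    and y: "y \<in> A" and n: "0 < n"
  shows "Q A (2 * n) (dens y) y \<le> 16 / V x (3 * R) * (4 * C * Er x R / (\<delta> * real n)) powr (1 / \<delta>)"
proof -
  define u where "u k = Q A k (dens y)" for k
  define a where "a k = ip (u k) (u k)" for k
  let ?V = "V x (3 * R)"
  have Vp: "0 < ?V"
    using R by (simp add: V_pos)
  have E1: "1 \<le> Er x R"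
    using R by (rule Er_ge1)
  have fin: "finite A"
    using A by (auto intro: finite_subset)
  have u_nonneg: "0 \<le> u k x" for k x
    by (simp add: u_def Q_dens_nonneg)
  have fs: "fs (u k)" for k
    by (simp add: u_def fs_Q fs_dens)
  \<comment> \<open>The Nash inequality reads
    \<open>en v \<ge> 2 * c * ip v v powr (1 + \<delta>)\<close>.\<close>
  define c where "c = ?V powr \<delta> / (4 * C * Er x R * 16 powr \<delta>)"
  have c: "0 < c"
    using Vp C E1 by (simp add: c_def)
  have "a (Suc k) \<le> a k - c * a k powr (1 + \<delta>)" for k
  proof -
    define v where "v x = u k x + u (Suc k) x" for x
    have decay: "en v / 2 \<le> a k - a (Suc k)"
      using ip_T_decay[OF fs, of A k] by (simp add: a_def v_def[abs_def] u_def Q_Suc Q_out)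
    show ?thesis
    proof (cases "a k = 0")
      case True
      have "0 \<le> en v"
        unfolding v_def by (intro en_nonneg fs_add fs)
      then show ?thesis
        using decay True by simp
    next
      case False
      then have apos: "0 < a k"
        using ip_self_nonneg[of "u k"] by (simp add: a_def)
      have "a k \<le> ip v v"
        unfolding a_def v_def
        by (intro ip_mono fs fs_add mult_mono) (auto simp: u_nonneg add_nonneg_nonneg)
      with apos have N: "0 < ip v v"
        by simp
      have "ip v (\<lambda>_. 1) = surv A k y + surv A (Suc k) y"
        unfolding v_def using y fin by (subst ip_add[OF fs fs]) (simp add: u_def surv_eq_ip)
      then have L: "ip v (\<lambda>_. 1) \<le> 2"
        using surv_le1[of A k y] surv_le1[of A "Suc k" y] by simp
      have "ip v v \<le> 2 * C * Er x R * (16 / (ip v v * ?V)) powr \<delta> * en v"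
      proof (rule nash[OF FK C R A _ _ _ L N])
        show "fs v"
          unfolding v_def by (intro fs_add fs)
        show "v z = 0" if "z \<notin> A" for z
          using that by (simp add: v_def u_def Q_out)
        show "0 \<le> v z" for z
          by (simp add: v_def u_nonneg)
      qed
      also have "(16 / (ip v v * ?V)) powr \<delta> = 16 powr \<delta> / (ip v v powr \<delta> * ?V powr \<delta>)"
        using N Vp by (simp add: powr_divide powr_mult)
      finally have "ip v v powr (1 + \<delta>) * (?V powr \<delta>) \<le> 2 * C * Er x R * 16 powr \<delta> * en v"
        using N Vp by (simp add: powr_add field_simps)
      then have "2 * c * ip v v powr (1 + \<delta>) \<le> en v"
        using C E1 by (simp add: c_def field_simps)
      moreover have "c * a k powr (1 + \<delta>) \<le> c * ip v v powr (1 + \<delta>)"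
        using c apos \<open>a k \<le> ip v v\<close> C by (intro mult_left_mono powr_mono2) auto
      ultimately show ?thesis
        using decay by simp
    qed
  qed
  then have "a n \<le> (1 / (\<delta> * c * real n)) powr (1 / \<delta>)"
    using c C n by (intro power_decay) (auto simp: a_def ip_self_nonneg)
  also have "1 / (\<delta> * c * real n) = (4 * C * Er x R / (\<delta> * real n)) * (16 powr \<delta> * ?V powr - \<delta>)"
    using Vp by (simp add: c_def powr_minus field_simps)
  also have "\<dots> powr (1 / \<delta>) = (4 * C * Er x R / (\<delta> * real n)) powr (1 / \<delta>) * (16 * ?V powr - 1)"
    using C E1 Vp n by (subst powr_mult) (auto simp: powr_mult powr_powr)
  also have "?V powr - 1 = 1 / ?V"
    using Vp by (simp add: powr_minus_divide)
  finally have "a n \<le> 16 / ?V * (4 * C * Er x R / (\<delta> * real n)) powr (1 / \<delta>)"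
    by (simp add: mult_ac)
  moreover have "a n = Q A (2 * n) (dens y) y"
    using ip_Q_dens[OF y y, of n n] by (simp add: a_def u_def mult_2)
  ultimately show ?thesis
    by simp
qed

text \<open>Cauchy-Schwarz for the indicator of \<open>A\<close> and the killed kernel: a small
  return density forces a small total mass.\<close>

lemma surv_square_le:
  assumes "finite A" "y \<in> A"
  shows "(surv A n y)\<^sup>2 \<le> vol A * Q A (2 * n) (dens y) y"
proof -
  have "(surv A n y)\<^sup>2 = (ip (indicator A) (Q A n (dens y)))\<^sup>2"
    using surv_eq_ip[OF assms, of n] unfolding ip_commute[of "indicator A"]
    by (subst ip_cong[of _ _ "Q A n (dens y)" "\<lambda>_. 1"]) (auto simp: indicator_def Q_out)
  also have "\<dots> \<le> ip (indicator A) (indicator A) * ip (Q A n (dens y)) (Q A n (dens y))"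
    by (intro ip_Cauchy_Schwarz fs_Q fs_dens fsI[OF assms(1)]) simp
  also have "ip (indicator A) (indicator A) = vol A"
    using assms(1) by (subst ip_eq[of A]) (auto simp: vol_eq)
  also have "ip (Q A n (dens y)) (Q A n (dens y)) = Q A (2 * n) (dens y) y"
    using ip_Q_dens[OF assms(2,2), of n n] by (simp add: mult_2)
  finally show ?thesis .
qed

lemma FKr_imp_Eexit:
  assumes FK: "FKr C \<delta>" and C: "0 < C" "0 < \<delta>"
  shows "Eexit ((8 * 64 powr \<delta> / \<delta> + 2) * C) \<delta>"
unfolding Eexit_def
proof (intro allI impI)
  fix x R A y assume R: "R > 0" and A: "A \<subseteq> B x (3 * R)" and y: "y \<in> A"
  let ?V = "V x (3 * R)" and ?k = "bnd C \<delta> x R A"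
  have fin: "finite A"
    using A by (auto intro: finite_subset)
  have Vp: "0 < ?V" and volp: "0 < vol A"
    using R y fin by (auto intro: V_pos vol_pos)
  \<comment> \<open>The energy of a point mass is at most its squared norm, so the eigenvalue is at
    most 1. This absorbs the rounding of \<nu> into the constant.\<close>
  have k1: "1 \<le> ?k"
  proof -
    have pos: "0 < ip (dens y) (dens y)"
      by (rule ip_self_pos[OF fs_dens, of _ y]) (simp add: dens_def)
    have "ip (dens y) (dens y) \<le> ?k * en (dens y)"
      using FK R A y by (auto simp: FKr_def dens_def)
    also have "\<dots> \<le> ?k * ip (dens y) (dens y)"
    proof (rule mult_left_mono)
      show "en (dens y) \<le> ip (dens y) (dens y)"
        unfolding en_def using ip_nonneg[of "dens y" "T UNIV (dens y)"]
        by (simp add: T_nonneg dens_def \<mu>_nonneg)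
      show "0 \<le> ?k"
        using C by (simp add: bnd_def Er_nonneg)
    qed
    finally show ?thesis
      using pos by simp
  qed
  \<comment> \<open>At time \<nu> the heat kernel bound equals \<open>1 / (4 * vol A)\<close>, which
    makes survival at most 1/2; \<open>64 = 16 * 4\<close>.\<close>
  define \<nu> where "\<nu> = 4 * 64 powr \<delta> / \<delta> * ?k"
  have \<nu>: "0 < \<nu>"
    using C k1 by (simp add: \<nu>_def)
  define n where "n = nat \<lceil>\<nu>\<rceil>"
  have n: "0 < n" "\<nu> \<le> real n" "real n \<le> \<nu> + 1"
    using \<nu> unfolding n_def by linarith+
  have "surv A n z \<le> 1 / 2" if z: "z \<in> A" for z
  proof -
    have "4 * C * Er x R / (\<delta> * real n) \<le> 4 * C * Er x R / (\<delta> * \<nu>)"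
      using n \<nu> C Er_nonneg[of x R] by (intro divide_left_mono mult_left_mono) auto
    also have "\<dots> = 1 / (64 powr \<delta> * (vol A / ?V) powr \<delta>)"
      using C Er_ge1[OF R, of x] Vp volp by (simp add: \<nu>_def bnd_def field_simps)
    also have "\<dots> = (?V / (64 * vol A)) powr \<delta>"
      using Vp volp by (simp add: powr_divide powr_mult)
    finally have "(4 * C * Er x R / (\<delta> * real n)) powr (1 / \<delta>) \<le> ((?V / (64 * vol A)) powr \<delta>) powr (1 / \<delta>)"
      using C n Er_nonneg[of x R] by (intro powr_mono2) auto
    also have "\<dots> = ?V / (64 * vol A)"
      using C Vp volp by (simp add: powr_powr)
    finally have "(4 * C * Er x R / (\<delta> * real n)) powr (1 / \<delta>) \<le> ?V / (64 * vol A)" .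
    then have "16 / ?V * (4 * C * Er x R / (\<delta> * real n)) powr (1 / \<delta>) \<le> 16 / ?V * (?V / (64 * vol A))"
      using Vp by (intro mult_left_mono) auto
    also have "16 / ?V * (?V / (64 * vol A)) = 1 / (4 * vol A)"
      using Vp by simp
    finally have "Q A (2 * n) (dens z) z \<le> 1 / (4 * vol A)"
      using FKr_heat_kernel[OF FK C R A z n(1)] by (rule order_trans[rotated])
    then have "vol A * Q A (2 * n) (dens z) z \<le> 1 / 4"
      using volp by (simp add: field_simps)
    then have "(surv A n z)\<^sup>2 \<le> (1 / 2)\<^sup>2"
      using surv_square_le[OF fin z, of n] by (simp add: power2_eq_square)
    then show ?thesis
      by (rule power2_le_imp_le) simp
  qed
  then have "mx A y \<le> 2 * real n"
    by (rule mx_le_half[OF fin])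
  also have "\<dots> \<le> 2 * \<nu> + 2 * ?k"
    using n k1 by simp
  also have "\<dots> = bnd ((8 * 64 powr \<delta> / \<delta> + 2) * C) \<delta> x R A"
    by (simp add: \<nu>_def bnd_def algebra_simps)
  finally show "mx A y \<le> bnd ((8 * 64 powr \<delta> / \<delta> + 2) * C) \<delta> x R A" .
qed

subsection \<open>Volume doubling and time comparison\<close>

lemma cond_TC_iff: "cond_TC \<longleftrightarrow> (\<exists>C>1. \<forall>x R. R > 0 \<longrightarrow> (\<forall>y\<in>B x R. Er y (2 * R) \<le> C * Er x R))"
proof -
  have "E y (2 * R) \<le> ennreal C * E x R \<longleftrightarrow> Er y (2 * R) \<le> C * Er x R" if "1 < C" for C x y R
    using that by (simp add: E_eq ennreal_le_iff Er_nonneg flip: ennreal_mult)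
  then show ?thesis
    unfolding cond_TC_def by (intro ex_cong1 conj_cong refl) auto
qed

text \<open>Taking \<open>A = B x (3 * R)\<close> makes the measure ratio 1, and this ball contains
  \<open>B y (2 * R)\<close> for every \<open>y\<close> in \<open>B x R\<close>.\<close>

lemma Eexit_imp_TC:
  assumes "Eexit C \<delta>"
  shows cond_TC
  unfolding cond_TC_iff
proof (intro exI[of _ "max C 2"] conjI allI impI ballI)
  fix x R y assume R: "R > 0" and y: "y \<in> B x R"
  have "Er y (2 * R) \<le> mx (B x (3 * R)) y"
    unfolding Er_def using y by (intro mx_mono finite_B B_subset) (simp add: B_iff)
  also have "\<dots> \<le> bnd C \<delta> x R (B x (3 * R))"
    using assms R y B_mono[of R "3 * R" x] by (auto simp: Eexit_def)
  also have "\<dots> = C * Er x R"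
    using V_pos[of "3 * R" x] R by (simp add: bnd_def V_def)
  also have "\<dots> \<le> max C 2 * Er x R"
    by (intro mult_right_mono Er_nonneg) simp
  finally show "Er y (2 * R) \<le> max C 2 * Er x R" .
qed simp

text \<open>For \<open>A = B x R\<close> and starting point \<open>x\<close> the mean exit time
  stands on both sides; cancelling it leaves a lower bound for
  \<open>V x R / V x (3 * R)\<close>.\<close>

lemma Eexit_imp_VD:
  assumes E: "Eexit C \<delta>" and C: "0 < C" "0 < \<delta>"
  shows cond_VD
  unfolding cond_VD_def
proof (intro exI[of _ "C powr (1 / \<delta>)"] conjI allI impI)
  fix x R assume R: "(R::real) > 0"
  have Vp: "0 < V x R" "0 < V x (3 * R)"
    using R by (auto intro: V_pos)
  have "Er x R \<le> bnd C \<delta> x R (B x R)"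
    unfolding Er_def[of x R] using E R B_mono[of R "3 * R" x] center_B[OF R, of x]
    by (simp add: Eexit_def)
  then have "1 * Er x R \<le> (C * (V x R / V x (3 * R)) powr \<delta>) * Er x R"
    by (simp add: bnd_def V_def mult_ac)
  then have "1 \<le> C * (V x R / V x (3 * R)) powr \<delta>"
    using Er_ge1[OF R, of x] by (simp add: mult_le_cancel_right)
  then have "1 \<le> (C * (V x R / V x (3 * R)) powr \<delta>) powr (1 / \<delta>)"
    using C by (intro ge_one_powr_ge_zero) auto
  also have "\<dots> = C powr (1 / \<delta>) * (V x R / V x (3 * R))"
    using C Vp by (simp add: powr_mult powr_powr)
  finally have "V x (3 * R) \<le> C powr (1 / \<delta>) * V x R"
    using Vp by (simp add: field_simps)
  then show "V x (2 * R) \<le> C powr (1 / \<delta>) * V x R"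
    using V_mono[of "2 * R" "3 * R" x] R by simp
qed (use C in simp)

end

section \<open>Power laws from bounds on one scale\<close>

lemma doubling_scale:
  fixes F :: "real \<Rightarrow> real"
  assumes mono: "\<And>r R. r \<le> R \<Longrightarrow> F r \<le> F R" and nonneg: "\<And>r. 0 \<le> F r"
    and dbl: "\<And>R. 0 < R \<Longrightarrow> F (2 * R) \<le> 2 powr a * F R"
    and r: "0 < r" "r \<le> R" and a: "0 \<le> a"
  shows "F R \<le> 2 powr a * (R / r) powr a * F r"
proof -
  define k where "k = nat \<lceil>log 2 (R / r)\<rceil>"
  have lg: "0 \<le> log 2 (R / r)"
    using r by simp
  have k1: "log 2 (R / r) \<le> real k" and k2: "real k \<le> log 2 (R / r) + 1"
    using lg unfolding k_def by linarith+
  have "R / r = 2 powr (log 2 (R / r))"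
    using r by simp
  also have "\<dots> \<le> 2 powr real k"
    using k1 by (intro powr_mono) auto
  finally have R: "R \<le> 2 ^ k * r"
    using r by (simp add: powr_realpow field_simps)
  have "(2::real) ^ k = 2 powr real k"
    by (simp add: powr_realpow)
  also have "\<dots> \<le> 2 powr (log 2 (R / r) + 1)"
    using k2 by (intro powr_mono) auto
  also have "\<dots> = 2 * (R / r)"
    using r by (simp add: powr_add)
  finally have k3: "2 ^ k \<le> 2 * (R / r)" .
  have it: "F (2 ^ j * r) \<le> (2 ^ j) powr a * F r" for j
  proof (induction j)
    case (Suc j)
    have "F (2 ^ Suc j * r) \<le> 2 powr a * F (2 ^ j * r)"
      using dbl[of "2 ^ j * r"] r by (simp add: mult.assoc)
    also have "\<dots> \<le> 2 powr a * ((2 ^ j) powr a * F r)"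
      using Suc by (intro mult_left_mono) auto
    finally show ?case
      by (simp add: powr_mult mult.assoc)
  qed simp
  have "F R \<le> F (2 ^ k * r)"
    using R by (rule mono)
  also have "\<dots> \<le> (2 ^ k) powr a * F r"
    by (rule it)
  also have "\<dots> \<le> (2 * (R / r)) powr a * F r"
    using k3 a nonneg by (intro mult_right_mono powr_mono2) auto
  finally show ?thesis
    using r by (simp only: powr_mult)
qed

text \<open>The factor 4 is the scale on which mean exit times are shown to grow; radii start at 1
  because all smaller balls are single points.\<close>

lemma antidoubling_scale:
  fixes F :: "real \<Rightarrow> real"
  assumes mono: "\<And>r R. r \<le> R \<Longrightarrow> F r \<le> F R" and nonneg: "\<And>r. 0 \<le> F r"
    and dbl: "\<And>R. 1 \<le> R \<Longrightarrow> 4 powr a * F R \<le> F (4 * R)"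
    and r: "1 \<le> r" "r \<le> R" and a: "0 \<le> a"
  shows "(R / r) powr a * F r \<le> 4 powr a * F R"
proof -
  define k where "k = nat \<lfloor>log 4 (R / r)\<rfloor>"
  have lg: "0 \<le> log 4 (R / r)"
    using r by simp
  have k1: "log 4 (R / r) \<le> real k + 1" and k2: "real k \<le> log 4 (R / r)"
    using lg unfolding k_def by linarith+
  have "(4::real) ^ k = 4 powr real k"
    by (simp add: powr_realpow)
  also have "\<dots> \<le> 4 powr (log 4 (R / r))"
    using k2 by (intro powr_mono) auto
  also have "\<dots> = R / r"
    using r by simp
  finally have R: "4 ^ k * r \<le> R"
    using r by (simp add: field_simps)
  have "R / r = 4 powr (log 4 (R / r))"
    using r by simp
  also have "\<dots> \<le> 4 powr (real k + 1)"
    using k1 by (intro powr_mono) auto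
  also have "\<dots> = 4 * 4 ^ k"
    by (simp add: powr_add powr_realpow)
  finally have k3: "R / r \<le> 4 * 4 ^ k" .
  have it: "(4 ^ j) powr a * F r \<le> F (4 ^ j * r)" for j
  proof (induction j)
    case (Suc j)
    have "1 * 1 \<le> 4 ^ j * r"
      using r by (intro mult_mono) auto
    have "(4 ^ Suc j) powr a * F r = 4 powr a * ((4 ^ j) powr a * F r)"
      by (simp add: powr_mult mult.assoc)
    also have "\<dots> \<le> 4 powr a * F (4 ^ j * r)"
      using Suc by (intro mult_left_mono) auto
    also have "\<dots> \<le> F (4 ^ Suc j * r)"
      using dbl[of "4 ^ j * r"] \<open>1 * 1 \<le> 4 ^ j * r\<close> by (simp add: mult.assoc)
    finally show ?case .
  qed simp
  have "(R / r) powr a * F r \<le> (4 * 4 ^ k) powr a * F r"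
    using k3 a r nonneg by (intro mult_right_mono powr_mono2) auto
  also have "\<dots> = 4 powr a * ((4 ^ k) powr a * F r)"
    by (simp add: powr_mult)
  also have "\<dots> \<le> 4 powr a * F (4 ^ k * r)"
    by (intro mult_left_mono it) auto
  also have "\<dots> \<le> 4 powr a * F R"
    by (intro mult_left_mono mono R) auto
  finally show ?thesis .
qed

context weighted_graph_p0 begin

section \<open>The inverse of the mean exit time\<close>

lemma e_iff: "of_nat n \<le> E x r \<longleftrightarrow> real n \<le> Er x r"
  by (simp add: E_eq ennreal_le_iff Er_nonneg flip: ennreal_of_nat_eq_real_of_nat)

lemma e_ge: "real n \<le> Er x (real (e x n))"
proof -
  have "of_nat n \<le> E x (real (e x n))"
    unfolding e_def by (rule LeastI[of _ n]) (simp add: e_iff Er_ge_nat)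
  then show ?thesis
    by (simp add: e_iff)
qed

lemma e_le: "real n \<le> Er x (real r) \<Longrightarrow> e x n \<le> r"
  unfolding e_def by (rule Least_le) (simp add: e_iff)

lemma e_le_self: "e x n \<le> n"
  by (rule e_le) (rule Er_ge_nat)

lemma e_mono: "m \<le> n \<Longrightarrow> e x m \<le> e x n"
  using e_ge[of n x] by (intro e_le) linarith

lemma e_pos: "0 < n \<Longrightarrow> 1 \<le> e x n"
  using e_ge[of n x] Er_nonpos[of 0 x] by (cases "e x n") auto

lemma e_1: "e x 1 = 1"
  using e_pos[of 1 x] e_le_self[of x 1] by simp

subsection \<open>Exit from a set before a given time\<close>

text \<open>If \<open>u\<^sub>k\<close> solves the heat equation, decompose at the exit from \<open>A\<close>: the walk either stays in
  \<open>A\<close> up to time \<open>n\<close> or leaves it through the outer boundary.\<close>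

lemma heat_exit_le:
  assumes u: "\<And>k z. u (Suc k) z = T UNIV (u k) z"
    and S: "\<And>k y z. k \<le> n \<Longrightarrow> z \<in> A \<Longrightarrow> y \<in> nb z \<Longrightarrow> y \<notin> A \<Longrightarrow> u k y \<le> S"
    and "x \<in> A"
  shows "u n x \<le> Q A n (u 0) x + (1 - surv A n x) * S"
  using assms(2,3)
proof (induction n arbitrary: x)
  case 0
  then show ?case
    by (simp add: Q_0 res_def)
next
  case (Suc n)
  have "u (Suc n) x = T A (u n) x"
    using Suc.prems(2) by (simp add: u T_def)
  also have "\<dots> \<le> T A (\<lambda>y. Q A n (u 0) y + (1 - surv A n y) * S) x"
  proof (rule T_mono_nb)
    fix y assume y: "y \<in> nb x"
    show "u n y \<le> Q A n (u 0) y + (1 - surv A n y) * S"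
    proof (cases "y \<in> A")
      case True
      then show ?thesis
        using Suc.prems(1) by (intro Suc.IH) auto
    next
      case False
      then show ?thesis
        using Suc.prems(1)[of n x y] Suc.prems(2) y by (simp add: Q_out)
    qed
  qed
  also have "\<dots> = Q A (Suc n) (u 0) x + (1 - surv A (Suc n) x) * S"
  proof -
    have "(\<lambda>y. (1 - surv A n y) * S) = (\<lambda>y. S * (1 - surv A n y))"
      by (simp add: mult.commute)
    then have "T A (\<lambda>y. (1 - surv A n y) * S) x = S * (1 - T A (surv A n) x)"
      using Suc.prems(2) by (simp only: T_cmult[of A S "\<lambda>y. 1 - surv A n y"] T_diff T_const)
    then have "T A (\<lambda>y. (1 - surv A n y) * S) x = (1 - T A (surv A n) x) * S"
      by (simp only: mult.commute)
    then show ?thesis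
      by (simp add: T_add Q_Suc)
  qed
  finally show ?case .
qed

text \<open>\<open>J A \<sigma> n\<close> is the expectation of \<open>\<sigma>\<^sup>\<tau>\<close> over the event \<open>\<tau> \<le> n\<close>, for the exit time \<open>\<tau>\<close> of \<open>A\<close>.\<close>

primrec J :: "'a set \<Rightarrow> real \<Rightarrow> nat \<Rightarrow> 'a \<Rightarrow> real" where
  "J A \<sigma> 0 = (\<lambda>x. if x \<in> A then 0 else 1)"
| "J A \<sigma> (Suc n) = (\<lambda>x. if x \<in> A then \<sigma> * T A (J A \<sigma> n) x else 1)"

lemma J_out: "x \<notin> A \<Longrightarrow> J A \<sigma> n x = 1"
  by (cases n) auto

text \<open>The weight \<open>\<sigma>^\<tau>\<close> is at most 1 for \<open>\<tau> \<le> m\<close>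
  and at most \<open>\<sigma>^m\<close> for later exits. As \<open>m\<close> is free, the bound is
  uniform in \<open>n\<close>.\<close>

lemma J_le_surv:
  assumes \<sigma>: "0 \<le> \<sigma>" "\<sigma> \<le> 1"
  shows "J A \<sigma> n x \<le> 1 - (1 - \<sigma> ^ m) * surv A m x"
proof (induction n arbitrary: m x)
  case 0
  have "(1 - \<sigma> ^ m) * surv A m x \<le> 1 * 1"
    using \<sigma> by (intro mult_mono surv_le1 surv_nonneg) auto
  then show ?case
    by (simp add: Q_out)
next
  case (Suc n)
  show ?case
  proof (cases "x \<in> A")
    case False
    then show ?thesis
      by (simp add: Q_out)
  next
    case True
    have le: "J A \<sigma> (Suc n) x \<le> \<sigma> * (1 - (1 - \<sigma> ^ k) * surv A (Suc k) x)" for k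
    proof -
      have "T A (J A \<sigma> n) x \<le> T A (\<lambda>y. 1 - (1 - \<sigma> ^ k) * surv A k y) x"
        by (rule T_mono) (rule Suc)
      also have "\<dots> = 1 - (1 - \<sigma> ^ k) * surv A (Suc k) x"
        using True by (simp only: T_diff T_cmult T_const Q_Suc)
      finally show ?thesis
        using True \<sigma> by (simp add: mult_left_mono)
    qed
    show ?thesis
    proof (cases m)
      case 0
      then show ?thesis
        using le[of 0] \<sigma> by simp
    next
      case (Suc k)
      have "0 \<le> (1 - \<sigma>) * (1 - surv A (Suc k) x)"
        using \<sigma> surv_le1[of A "Suc k" x] by (intro mult_nonneg_nonneg) auto
      then show ?thesis
        using le[of k] unfolding Suc by (simp add: algebra_simps del: J.simps)
    qed
  qed
qed

text \<open>Leaving from inside takes at least one step.\<close>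

lemma J_le_\<sigma>:
  assumes \<sigma>: "0 \<le> \<sigma>" "\<sigma> \<le> 1" and "x \<in> A"
  shows "J A \<sigma> n x \<le> \<sigma>"
proof (cases n)
  case (Suc k)
  have "T A (J A \<sigma> k) x \<le> T A (\<lambda>_. 1) x"
    using J_le_surv[OF \<sigma>, of A k _ 0] by (intro T_mono) simp
  then show ?thesis
    using assms Suc by (simp add: T_const mult_left_le)
qed (use assms in simp)

text \<open>Decomposition at the exit time \<tau>: there \<open>F\<close> has time
  \<open>n - \<tau>\<close> left and is at most \<open>c * (1/\<sigma>)^(n - \<tau>)\<close>, which
  is \<open>c * (1/\<sigma>)^n\<close> times the weight \<open>\<sigma>^\<tau>\<close> averaged by
  \<open>J\<close>.\<close>

lemma exit_le_J:
  assumes rec: "\<And>n z. z \<in> A \<Longrightarrow> F (Suc n) z = T A (F n) z"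
    and F0: "\<And>z. z \<in> A \<Longrightarrow> F 0 z = 0"
    and bdry: "\<And>n y z. z \<in> A \<Longrightarrow> y \<in> nb z \<Longrightarrow> y \<notin> A \<Longrightarrow> F n y \<le> c * (1 / \<sigma>) ^ n"
    and \<sigma>: "0 < \<sigma>" and "x \<in> A"
  shows "F n x \<le> c * (1 / \<sigma>) ^ n * J A \<sigma> n x"
  using \<open>x \<in> A\<close>
proof (induction n arbitrary: x)
  case 0
  then show ?case
    by (simp add: F0)
next
  case (Suc n)
  have "F (Suc n) x \<le> T A (\<lambda>y. c * (1 / \<sigma>) ^ n * J A \<sigma> n y) x"
    unfolding rec[OF Suc.prems]
  proof (rule T_mono_nb)
    fix y assume "y \<in> nb x"
    then show "F n y \<le> c * (1 / \<sigma>) ^ n * J A \<sigma> n y"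
      using Suc.IH[of y] bdry[OF Suc.prems, of y n] by (cases "y \<in> A") (auto simp: J_out)
  qed
  also have "\<dots> = c * (1 / \<sigma>) ^ Suc n * J A \<sigma> (Suc n) x"
    using Suc.prems \<sigma> by (simp add: T_cmult)
  finally show ?case .
qed

text \<open>From within distance \<open>(N - i) * r\<close> of the centre, the walk must leave
  \<open>i\<close> successive balls of radius \<open>r\<close> before it can leave the large one.
  Each exit contributes a factor \<open>q\<close> through \<open>J\<close>;
  \<open>(1/\<sigma>)^n\<close> is the price of the exponential weight, as in Chebyshev's
  inequality.\<close>

lemma exit_chain:
  assumes \<sigma>: "0 < \<sigma>" "\<sigma> \<le> 1" and q: "0 \<le> q" and r: "0 < r"
    and J: "\<And>y n. y \<in> B x (real (N * r)) \<Longrightarrow> J (B y (real r)) \<sigma> n y \<le> q"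
    and i: "i \<le> N" "d x y \<le> (N - i) * r"
  shows "1 - surv (B x (real (N * r))) n y \<le> q ^ i * (1 / \<sigma>) ^ n"
  using i
proof (induction i arbitrary: y n)
  case 0
  have "1 - surv (B x (real (N * r))) n y \<le> 1"
    by (simp add: surv_nonneg)
  also have "\<dots> \<le> (1 / \<sigma>) ^ n"
    using \<sigma> by (intro one_le_power) simp
  finally show ?case
    by simp
next
  case (Suc i)
  let ?A = "B x (real (N * r))" and ?B = "B y (real r)"
  have "d x y + r \<le> (N - Suc i) * r + r"
    using Suc.prems by simp
  also have "\<dots> = (N - i) * r"
    using Suc.prems(1) by (metis Suc_diff_Suc Suc_le_lessD add.commute mult_Suc)
  finally have dr: "d x y + r \<le> (N - i) * r" .
  also have "\<dots> \<le> N * r"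
    by (intro mult_right_mono) auto
  finally have "real (d x y + r) \<le> real (N * r)"
    by (rule of_nat_mono)
  then have sub: "?B \<subseteq> ?A"
    by (intro B_subset) simp
  have y: "y \<in> ?B"
    using r by (simp add: center_B)
  have "1 - surv ?A n y \<le> q ^ i * (1 / \<sigma>) ^ n * J ?B \<sigma> n y"
  proof (rule exit_le_J[OF _ _ _ \<sigma>(1) y])
    fix n z assume z: "z \<in> ?B"
    have "T ?B (\<lambda>z. 1 - surv ?A n z) z = 1 - T ?B (surv ?A n) z"
      using z by (simp only: T_diff T_const)
    also have "T ?B (surv ?A n) z = T ?A (surv ?A n) z"
      using z sub by (auto simp: T_def)
    finally show "1 - surv ?A (Suc n) z = T ?B (\<lambda>z. 1 - surv ?A n z) z"
      by (simp add: Q_Suc)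
  next
    fix z assume "z \<in> ?B"
    then show "1 - surv ?A 0 z = 0"
      using sub by (auto simp: Q_0 res_def)
  next
    fix n v z assume "z \<in> ?B" "v \<in> nb z"
    \<comment> \<open>The radius is an integer, so the first point outside is at distance at most
      \<open>r\<close>, without loss.\<close>
    then have "d y v \<le> r"
      using d_nb_le[of v z y] by (simp add: B_iff)
    then have "d x v \<le> (N - i) * r"
      using d_triangle[of x v y] dr by linarith
    then show "1 - surv ?A n v \<le> q ^ i * (1 / \<sigma>) ^ n"
      using Suc.prems by (intro Suc.IH) auto
  qed
  also have "\<dots> \<le> q ^ i * (1 / \<sigma>) ^ n * q"
    using J[of y n] sub y \<sigma> q by (intro mult_left_mono) auto
  finally show ?case
    by (simp add: mult_ac)
qed

end

section \<open>Consequences of volume doubling and time comparison\<close>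

locale doubling_graph = weighted_graph_p0 +
  assumes VD: cond_VD and TC: cond_TC
begin

lemma V_scale: "\<exists>C\<ge>1. \<exists>\<alpha>>0. \<forall>x r R. 0 < r \<longrightarrow> r \<le> R \<longrightarrow> V x R \<le> C * (R / r) powr \<alpha> * V x r"
proof -
  obtain D where D: "\<And>x R. R > 0 \<Longrightarrow> V x (2 * R) \<le> D * V x R"
    using VD unfolding cond_VD_def by blast
  define \<alpha> where "\<alpha> = log 2 (max D 2)"
  have \<alpha>: "0 < \<alpha>" "2 powr \<alpha> = max D 2"
    by (auto simp: \<alpha>_def)
  have V_nonneg: "0 \<le> V x R" for x R
    unfolding V_def by (rule vol_nonneg) simp
  have "V x R \<le> 2 powr \<alpha> * (R / r) powr \<alpha> * V x r" if "0 < r" "r \<le> R" for x r R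
  proof (rule doubling_scale[where F = "V x"])
    fix R :: real assume "0 < R"
    then have "V x (2 * R) \<le> D * V x R"
      by (rule D)
    also have "\<dots> \<le> 2 powr \<alpha> * V x R"
      unfolding \<alpha>(2) by (intro mult_right_mono V_nonneg) simp
    finally show "V x (2 * R) \<le> 2 powr \<alpha> * V x R" .
  qed (use that \<alpha> V_mono V_nonneg in auto)
  moreover have "1 \<le> 2 powr \<alpha>"
    unfolding \<alpha>(2) by simp
  ultimately show ?thesis
    using \<alpha>(1) by blast
qed

lemma Er_scale:
  "\<exists>C\<ge>1. \<exists>\<beta>>1. \<forall>x y r R. 0 < r \<longrightarrow> r \<le> R \<longrightarrow> real (d x y) < R \<longrightarrow>
     Er y R \<le> C * (R / r) powr \<beta> * Er x r"
proof -
  obtain C where C: "1 < C" "\<And>x y R. R > 0 \<Longrightarrow> y \<in> B x R \<Longrightarrow> Er y (2 * R) \<le> C * Er x R"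
    using TC unfolding cond_TC_iff by blast
  \<comment> \<open>The 4 forces \<open>\<beta> > 1\<close>, which the exponent
    \<open>1 / (\<beta> - 1)\<close> requires.\<close>
  define \<beta> where "\<beta> = log 2 (max C 4)"
  have \<beta>: "2 powr \<beta> = max C 4"
    by (auto simp: \<beta>_def)
  have "log 2 2 < \<beta>"
    unfolding \<beta>_def by (subst log_less_cancel_iff) auto
  then have \<beta>1: "1 < \<beta>"
    by simp
  have "Er y R \<le> (C * 2 powr \<beta>) * (R / r) powr \<beta> * Er x r"
    if "0 < r" "r \<le> R" "real (d x y) < R" for x y r R
  proof -
    have "Er y R \<le> Er y (2 * R)"
      using that by (intro Er_mono) simp
    also have "\<dots> \<le> C * Er x R"
      using that by (intro C(2)) (auto simp: B_iff)
    also have "Er x R \<le> 2 powr \<beta> * (R / r) powr \<beta> * Er x r"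
    proof (rule doubling_scale[where F = "Er x"])
      fix R :: real assume "0 < R"
      then have "Er x (2 * R) \<le> C * Er x R"
        by (intro C(2) center_B)
      also have "\<dots> \<le> 2 powr \<beta> * Er x R"
        unfolding \<beta> by (intro mult_right_mono Er_nonneg) simp
      finally show "Er x (2 * R) \<le> 2 powr \<beta> * Er x R" .
    qed (use that \<beta>1 Er_mono Er_nonneg in auto)
    finally show ?thesis
      using C(1) by (simp add: mult.assoc)
  qed
  moreover have "1 * 1 \<le> C * 2 powr \<beta>"
    unfolding \<beta> using C(1) by (intro mult_mono) auto
  ultimately show ?thesis
    using \<beta>1 by (metis mult_1)
qed

text \<open>On leaving \<open>B x r\<close> at a point \<open>y\<close>, the walk still has to leave
  \<open>B y (2 * r)\<close>, a subset of \<open>B x (4 * r)\<close>; by (TC) this takes mean time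
  at least \<open>Er x (4 * r) / C\<close>. So the mean exit time grows by the factor
  \<open>C / (C - 1)\<close> from \<open>r\<close> to \<open>4 * r\<close>. The bound
  \<open>1 \<le> r\<close> keeps \<open>y\<close> within \<open>2 * r\<close> of
  \<open>x\<close>.\<close>

lemma Er_antiscale:
  "\<exists>C\<ge>1. \<exists>\<gamma>>0. \<forall>x r R. 1 \<le> r \<longrightarrow> r \<le> R \<longrightarrow> (R / r) powr \<gamma> * Er x r \<le> C * Er x R"
proof -
  obtain C where C: "1 < C" "\<And>x y R. R > 0 \<Longrightarrow> y \<in> B x R \<Longrightarrow> Er y (2 * R) \<le> C * Er x R"
    using TC unfolding cond_TC_iff by blast
  have step: "Er x r \<le> (1 - 1 / C) * Er x (4 * r)" if r: "1 \<le> r" for x r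
  proof -
    define m where "m = Er x (4 * r) / C"
    define h where "h z = mx (B x (4 * r)) z - mx (B x r) z - m" for z
    have sub: "B x r \<subseteq> B x (4 * r)"
      using r by (intro B_mono) simp
    have "0 \<le> h x"
    proof (rule minimum_principle[where A = "B x r"])
      fix z assume z: "z \<in> B x r"
      have "T (B x r) h z = T (B x r) (mx (B x (4 * r))) z - T (B x r) (mx (B x r)) z - m"
        unfolding h_def using z by (simp only: T_diff T_const)
      also have "T (B x r) (mx (B x (4 * r))) z = T (B x (4 * r)) (mx (B x (4 * r))) z"
        using z sub by (auto simp: T_def)
      also have "\<dots> = mx (B x (4 * r)) z - 1"
        using mx_rec[of "B x (4 * r)" z] z sub by auto
      also have "T (B x r) (mx (B x r)) z = mx (B x r) z - 1"
        using mx_rec[of "B x r" z] z by auto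
      finally show "T (B x r) h z \<le> h z"
        by (simp add: h_def[abs_def])
    next
      fix z y assume z: "z \<in> B x r" and y: "y \<in> nb z" "y \<notin> B x r"
      have "real (d x y) < 2 * r"
        using d_nb_le[OF y(1), of x] z r by (simp add: B_iff)
      then have "Er x (2 * (2 * r)) \<le> C * Er y (2 * r)"
        using r by (intro C(2)) (auto simp: B_iff d_sym)
      moreover have "Er y (2 * r) \<le> mx (B x (4 * r)) y"
        unfolding Er_def using \<open>real (d x y) < 2 * r\<close> by (intro mx_mono finite_B B_subset) simp
      ultimately have "Er x (4 * r) \<le> C * mx (B x (4 * r)) y"
        using C(1) by (smt (verit) mult_left_mono mult.assoc)
      then have "m \<le> mx (B x (4 * r)) y"
        using C(1) by (simp add: m_def field_simps)
      then show "0 \<le> h y"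
        using y(2) by (simp add: h_def mx_out)
    qed (use r in \<open>auto simp: center_B\<close>)
    then show ?thesis
      by (simp add: h_def m_def Er_def algebra_simps)
  qed
  define \<gamma> where "\<gamma> = log 4 (C / (C - 1))"
  have \<gamma>: "4 powr \<gamma> = C / (C - 1)"
    using C(1) by (simp add: \<gamma>_def)
  have \<gamma>0: "0 < \<gamma>"
    unfolding \<gamma>_def using C(1) by (intro zero_less_log_cancel_iff[THEN iffD2]) auto
  have "(R / r) powr \<gamma> * Er x r \<le> 4 powr \<gamma> * Er x R" if "1 \<le> r" "r \<le> R" for x r R
  proof (rule antidoubling_scale[where F = "Er x"])
    fix R :: real assume "1 \<le> R"
    from step[OF this, of x] show "4 powr \<gamma> * Er x R \<le> Er x (4 * R)"
      unfolding \<gamma> using C(1) by (simp add: field_simps)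
  qed (use that \<gamma>0 Er_mono Er_nonneg in auto)
  moreover have "1 \<le> 4 powr \<gamma>"
    unfolding \<gamma> using C(1) by simp
  ultimately show ?thesis
    using \<gamma>0 by blast
qed

text \<open>\<open>E(x,r)\<close> does not jump far past \<open>n\<close>: by minimality it is below
  \<open>n\<close> at radius \<open>e x n - 1\<close>, and doubling that radius costs a
  constant.\<close>

lemma Er_e_le: "\<exists>C\<ge>1. \<forall>x n. 1 \<le> n \<longrightarrow> Er x (real (e x n)) \<le> C * real n"
proof -
  obtain C where C: "1 < C" "\<And>x y R. R > 0 \<Longrightarrow> y \<in> B x R \<Longrightarrow> Er y (2 * R) \<le> C * Er x R"
    using TC unfolding cond_TC_iff by blast
  obtain c0 where c0: "1 \<le> c0" "\<And>x. Er x 1 \<le> c0"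
    using Er_1_le by blast
  have "Er x (real (e x n)) \<le> max C c0 * real n" if n: "1 \<le> n" for x n
  proof (cases "e x n = 1")
    case True
    have "Er x 1 \<le> c0 * 1"
      using c0(2)[of x] by simp
    also have "\<dots> \<le> max C c0 * real n"
      using n c0 by (intro mult_mono) auto
    finally show ?thesis
      using True by simp
  next
    case False
    define r where "r = e x n - 1"
    have r: "1 \<le> r" "e x n = Suc r"
      using e_pos[of n x] n False by (auto simp: r_def)
    have "\<not> real n \<le> Er x (real r)"
      using e_le[of n x r] r by auto
    then have "Er x (real r) \<le> real n"
      by simp
    have "Er x (real (e x n)) \<le> Er x (2 * real r)"
      using r by (intro Er_mono) simp
    also have "\<dots> \<le> C * Er x (real r)"
      using r by (intro C(2) center_B) auto
    also have "\<dots> \<le> max C c0 * real n"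
      using \<open>Er x (real r) \<le> real n\<close> C(1) by (intro mult_mono) (auto simp: Er_nonneg)
    finally show ?thesis .
  qed
  then show ?thesis
    using C(1) by (intro exI[of _ "max C c0"]) auto
qed

text \<open>Both volumes are measured against \<open>V v (2 * M)\<close> with
  \<open>M = max (e x k) R\<close>. If \<open>2 * M\<close> exceeds \<open>e v j\<close>,
  \<open>Er_antiscale\<close> bounds the ratio of these radii by the ratio of mean exit times to the
  power \<open>1 / \<gamma>\<close>, and (VD) turns it into a ratio of volumes. The 4 leaves room
  for halving an integer time.\<close>

lemma V_compare:
  "\<exists>C\<ge>1. \<exists>\<alpha>>0. \<forall>x v k j R. 1 \<le> k \<longrightarrow> k \<le> 4 * j \<longrightarrow> 1 \<le> R \<longrightarrow> real (d x v) \<le> R \<longrightarrow>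
     V x (real (e x k)) \<le> C * (1 + Er x R / real k) powr \<alpha> * V v (real (e v j))"
proof -
  obtain Cv \<alpha> where Cv: "1 \<le> Cv" "0 < \<alpha>"
    "\<And>x r R. 0 < r \<Longrightarrow> r \<le> R \<Longrightarrow> V x R \<le> Cv * (R / r) powr \<alpha> * V x r"
    using V_scale by blast
  obtain Ce \<beta> where Ce: "1 \<le> Ce" "1 < \<beta>"
    "\<And>x y r R. 0 < r \<Longrightarrow> r \<le> R \<Longrightarrow> real (d x y) < R \<Longrightarrow> Er y R \<le> Ce * (R / r) powr \<beta> * Er x r"
    using Er_scale by blast
  obtain Ca \<gamma> where Ca: "1 \<le> Ca" "0 < \<gamma>"
    "\<And>x r R. 1 \<le> r \<Longrightarrow> r \<le> R \<Longrightarrow> (R / r) powr \<gamma> * Er x r \<le> Ca * Er x R"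
    using Er_antiscale by blast
  obtain C1 where C1: "1 \<le> C1" "\<And>x n. 1 \<le> n \<Longrightarrow> Er x (real (e x n)) \<le> C1 * real n"
    using Er_e_le by blast
  define C3 where "C3 = 4 * Ca * Ce * 2 powr \<beta> * C1"
  have C3: "1 \<le> C3"
  proof -
    have "1 * 1 * 1 * 1 * 1 \<le> 4 * Ca * Ce * 2 powr \<beta> * C1"
      using Ca Ce C1 by (intro mult_mono) (auto intro: ge_one_powr_ge_zero)
    then show ?thesis
      by (simp add: C3_def)
  qed
  have "V x (real (e x k)) \<le> Cv * C3 powr (\<alpha> / \<gamma>) * (1 + Er x R / real k) powr (\<alpha> / \<gamma>) * V v (real (e v j))"
    if k: "1 \<le> k" "k \<le> 4 * j" and R: "1 \<le> R" "real (d x v) \<le> R" for x v k j R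
  proof -
    define s where "s = real (e v j)"
    define S where "S = real (e x k)"
    define M where "M = max S R"
    define t where "t = 1 + Er x R / real k"
    have t: "1 \<le> t"
      by (simp add: t_def Er_nonneg)
    have s: "1 \<le> s"
      using e_pos[of j v] k by (simp add: s_def)
    have M: "1 \<le> M" "R \<le> M" "S \<le> M"
      using R by (auto simp: M_def)
    have "V x S \<le> V v (S + R)"
      using R by (intro V_subset) (simp add: d_sym)
    also have "\<dots> \<le> V v (2 * M)"
      using M by (intro V_mono) simp
    finally have 1: "V x S \<le> V v (2 * M)" .
    have Vs: "0 \<le> V v s"
      using V_pos[of s v] s by simp
    show ?thesis
    proof (cases "2 * M \<le> s")
      case True
      have "1 * 1 * 1 \<le> Cv * C3 powr (\<alpha> / \<gamma>) * t powr (\<alpha> / \<gamma>)"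
        using Cv C3 t Ca by (intro mult_mono) (auto intro: ge_one_powr_ge_zero)
      then have "1 * V v s \<le> Cv * C3 powr (\<alpha> / \<gamma>) * t powr (\<alpha> / \<gamma>) * V v s"
        using Vs by (intro mult_right_mono) auto
      moreover have "V v (2 * M) \<le> V v s"
        using True by (rule V_mono)
      ultimately show ?thesis
        using 1 by (simp add: t_def S_def s_def)
    next
      case False
      have "Er x M \<le> C1 * real k * t"
      proof (cases "S \<le> R")
        case True
        have "1 * Er x R \<le> C1 * (real k + Er x R)"
          using C1(1) by (intro mult_mono) (auto simp: Er_nonneg)
        moreover have "C1 * real k * t = C1 * (real k + Er x R)"
          using k by (simp add: t_def field_simps)
        ultimately show ?thesis
          using True by (simp only: M_def max_absorb2 mult_1)
      next
        case False
        have "Er x M \<le> C1 * real k * 1"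
          using C1(2)[OF k(1), of x] False by (simp add: M_def S_def)
        also have "\<dots> \<le> C1 * real k * t"
          using C1(1) t by (intro mult_left_mono) auto
        finally show ?thesis .
      qed
      moreover have "Er v (2 * M) \<le> Ce * (2 * M / M) powr \<beta> * Er x M"
        using M R by (intro Ce(3)) auto
      ultimately have "Er v (2 * M) \<le> Ce * 2 powr \<beta> * (C1 * real k * t)"
        using M(1) Ce(1) by (simp, smt (verit) mult_left_mono mult_nonneg_nonneg powr_ge_zero)
      have "(2 * M / s) powr \<gamma> * (real k / 4) \<le> (2 * M / s) powr \<gamma> * Er v s"
        using e_ge[of j v] k by (intro mult_left_mono) (auto simp: s_def)
      also have "\<dots> \<le> Ca * Er v (2 * M)"
        using False s by (intro Ca(3)) auto
      also have "\<dots> \<le> Ca * (Ce * 2 powr \<beta> * (C1 * real k * t))"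
        using \<open>Er v (2 * M) \<le> Ce * 2 powr \<beta> * (C1 * real k * t)\<close> Ca by (intro mult_left_mono) auto
      finally have "(2 * M / s) powr \<gamma> \<le> C3 * t"
        using k by (simp add: C3_def field_simps)
      then have "((2 * M / s) powr \<gamma>) powr (\<alpha> / \<gamma>) \<le> (C3 * t) powr (\<alpha> / \<gamma>)"
        using Cv Ca by (intro powr_mono2) auto
      then have ms: "(2 * M / s) powr \<alpha> \<le> C3 powr (\<alpha> / \<gamma>) * t powr (\<alpha> / \<gamma>)"
        using Ca t C3 by (simp add: powr_powr powr_mult)
      have "V v (2 * M) \<le> Cv * (2 * M / s) powr \<alpha> * V v s"
        using False s by (intro Cv(3)) auto
      also have "\<dots> \<le> Cv * (C3 powr (\<alpha> / \<gamma>) * t powr (\<alpha> / \<gamma>)) * V v s"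
        using ms Cv(1) Vs by (intro mult_right_mono mult_left_mono) auto
      finally show ?thesis
        using 1 by (simp add: t_def S_def s_def mult.assoc)
    qed
  qed
  moreover have "1 * 1 \<le> Cv * C3 powr (\<alpha> / \<gamma>)"
    using Cv C3 Ca by (intro mult_mono) (auto intro: ge_one_powr_ge_zero)
  moreover have "0 < \<alpha> / \<gamma>"
    using Cv Ca by simp
  ultimately show ?thesis
    by (metis mult_1)
qed

section \<open>Leaving a ball early\<close>

text \<open>By (TC) the mean exit time from any point of the ball is at most
  \<open>C * Er y r\<close>, so \<open>mx_bound_tail\<close> at a time \<open>m\<close> near
  \<open>Er y r / 2\<close> gives survival at least \<open>1 / (2 * C)\<close>. The 8 makes
  \<open>\<sigma>^m \<le> 1/2\<close>.\<close>

lemma J_uniform: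
  "\<exists>q>0. q < 1 \<and> (\<forall>y r E0 n. 0 < r \<longrightarrow> 0 < E0 \<longrightarrow> E0 \<le> Er y r \<longrightarrow> J (B y r) (exp (- 8 / E0)) n y \<le> q)"
proof -
  obtain C where C: "1 < C" "\<And>x y R. R > 0 \<Longrightarrow> y \<in> B x R \<Longrightarrow> Er y (2 * R) \<le> C * Er x R"
    using TC unfolding cond_TC_iff by blast
  define q where "q = 1 - 1 / (4 * C)"
  have q: "1 / 2 \<le> q" "q < 1"
    using C(1) by (auto simp: q_def field_simps)
  have exp2: "exp (- 2) \<le> (1 / 2 :: real)"
    using exp_ge_add_one_self[of "2::real"] by (simp add: exp_minus field_simps)
  have "J (B y r) (exp (- 8 / E0)) n y \<le> q" if r: "0 < r" and E0: "0 < E0" "E0 \<le> Er y r" for y r E0 n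
  proof -
    let ?\<sigma> = "exp (- 8 / E0)"
    have \<sigma>: "0 \<le> ?\<sigma>" "?\<sigma> \<le> 1"
      using E0 by auto
    have y: "y \<in> B y r"
      using r by (rule center_B)
    show ?thesis
    \<comment> \<open>For small \<open>Er y r\<close> integer rounding spoils \<open>m\<close>, but
      then \<sigma> itself is at most 1/2.\<close>
    proof (cases "Er y r < 4")
      case True
      then have "- 8 / E0 \<le> - 2"
        using E0 by (simp add: field_simps)
      then have "?\<sigma> \<le> 1 / 2"
        using exp2 by (meson exp_le_cancel_iff order_trans)
      then show ?thesis
        using J_le_\<sigma>[OF \<sigma> y, of n] q by linarith
    next
      case False
      define m where "m = nat \<lfloor>Er y r / 2\<rfloor>"
      have m: "Er y r / 4 \<le> real m" "real m \<le> Er y r / 2"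
        using False unfolding m_def by linarith+
      have "8 * E0 \<le> real m * 8 * 4"
        using m(1) E0 by simp
      then have "real m * (- 8 / E0) \<le> - 2"
        using E0 by (simp add: field_simps)
      then have "exp (real m * (- 8 / E0)) \<le> exp (- 2)"
        by (simp only: exp_le_cancel_iff)
      then have \<sigma>m: "?\<sigma> ^ m \<le> 1 / 2"
        using exp2 unfolding exp_of_nat_mult by linarith
      have "mx (B y r) z \<le> C * Er y r" if "z \<in> B y r" for z
      proof -
        have "mx (B y r) z \<le> Er z (2 * r)"
          using that unfolding Er_def by (intro mx_mono finite_B B_subset) (simp add: B_iff d_sym)
        also have "\<dots> \<le> C * Er y r"
          using r that by (rule C(2))
        finally show ?thesis .
      qed
      then have "Er y r \<le> real m + C * Er y r * surv (B y r) m y"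
        unfolding Er_def[of y r] by (intro mx_bound_tail finite_B) (simp add: Er_def)
      then have "Er y r * 1 \<le> Er y r * (2 * C * surv (B y r) m y)"
        using m(2) by (simp add: algebra_simps)
      then have surv: "1 / (2 * C) \<le> surv (B y r) m y"
        using False C(1) by (simp add: field_simps)
      have "(1 / 2) * (1 / (2 * C)) \<le> (1 - ?\<sigma> ^ m) * surv (B y r) m y"
        using \<sigma>m surv C(1) by (intro mult_mono) auto
      then show ?thesis
        using J_le_surv[OF \<sigma>, of "B y r" n y m] by (simp add: q_def)
    qed
  qed
  moreover have "0 < q"
    using q by simp
  ultimately show ?thesis
    using q by blast
qed

text \<open>Chaining through \<open>N\<close> balls of radius about \<open>R / N\<close> gives
  \<open>q^N * exp (8 * n / E0)\<close>, with \<open>E0\<close> of order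
  \<open>E(x,R) / N^\<beta>\<close>. The gain is linear in \<open>N\<close>, the cost grows like
  \<open>N^\<beta>\<close>; the cost stays below half of the gain up to \<open>N\<close> of order
  \<open>(E(x,R) / n)^(1/(\<beta>-1))\<close>.\<close>

lemma exit_estimate:
  "\<exists>C>0. \<exists>c>0. \<exists>\<beta>>1. \<forall>x R n. 1 \<le> R \<longrightarrow> 1 \<le> n \<longrightarrow>
     1 - surv (B x R) n x \<le> C * exp (- c * (Er x R / real n) powr (1 / (\<beta> - 1)))"
proof -
  obtain Ce \<beta> where Ce: "1 \<le> Ce" "1 < \<beta>"
    "\<And>x y r R. 0 < r \<Longrightarrow> r \<le> R \<Longrightarrow> real (d x y) < R \<Longrightarrow> Er y R \<le> Ce * (R / r) powr \<beta> * Er x r"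
    using Er_scale by blast
  obtain c0 where c0: "1 \<le> c0" "\<And>x. Er x 1 \<le> c0"
    using Er_1_le by blast
  obtain q where q: "0 < q" "q < 1"
    "\<And>y r E0 n. 0 < r \<Longrightarrow> 0 < E0 \<Longrightarrow> E0 \<le> Er y r \<Longrightarrow> J (B y r) (exp (- 8 / E0)) n y \<le> q"
    using J_uniform by blast
  define K where "K = 8 * Ce * 4 powr \<beta>"
  have K: "0 < K"
    using Ce by (simp add: K_def)
  \<comment> \<open>The first entry gives \<open>q^N \<le> exp (- c1 * N)\<close>; the second
    ensures \<open>\<nu> \<le> R\<close>, so that the small balls have radius at least 1.\<close>
  define c1 where "c1 = min (- ln q) (2 * K / (Ce * c0))"
  have c1: "0 < c1" "c1 \<le> - ln q" "c1 \<le> 2 * K / (Ce * c0)"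
    using q K Ce c0 by (auto simp: c1_def)
  let ?g = "1 / (\<beta> - 1)"
  have g: "0 < ?g"
    using Ce by simp
  define c where "c = c1 / 2 * (c1 / (2 * K)) powr ?g"
  have c: "0 < c"
    using c1 K by (simp add: c_def)
  have "1 - surv (B x R) n x \<le> exp (c1 / 2) * exp (- c * (Er x R / real n) powr ?g)"
    if R: "1 \<le> R" and n: "1 \<le> n" for x R n
  \<comment> \<open>In fewer than \<open>R\<close> steps the walk cannot leave; the opposite
    inequality is used for \<open>\<nu> \<le> R\<close>.\<close>
  proof (cases "real n < R")
    case True
    have "surv (B x R) n x = 1"
      using True by (intro surv_1) (simp add: B_iff)
    then show ?thesis
      by simp
  next
    case False
    \<comment> \<open>At \<open>N = \<nu>\<close> the cost \<open>K * N^\<beta> * n / E(x,R)\<close>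
      equals \<open>c1 * N / 2\<close>. The factor \<open>exp (c1 / 2)\<close> pays for rounding and
      for \<open>\<nu> < 1\<close>.\<close>
    define \<nu> where "\<nu> = (c1 * Er x R / (2 * K * real n)) powr ?g"
    have c\<nu>: "c * (Er x R / real n) powr ?g = c1 / 2 * \<nu>"
      using c1 K Er_nonneg[of x R] n by (simp add: c_def \<nu>_def powr_mult powr_divide)
    have E1: "1 \<le> Er x R"
      using R by (intro Er_ge1) simp
    have \<nu>R: "\<nu> \<le> R"
    proof -
      have "Er x R \<le> Ce * (R / 1) powr \<beta> * Er x 1"
        using R by (intro Ce(3)) auto
      also have "\<dots> \<le> Ce * R powr \<beta> * c0"
        using c0 Ce(1) by (simp add: mult_left_mono)
      also have "R powr \<beta> = R powr (\<beta> - 1) * R"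
        using R by (simp add: powr_diff)
      finally have "Er x R / real n \<le> Ce * c0 * R powr (\<beta> - 1) * (R / real n)"
        using n by (simp add: field_simps)
      also have "\<dots> \<le> Ce * c0 * R powr (\<beta> - 1) * 1"
        using False n Ce(1) c0 by (intro mult_left_mono) auto
      finally have "c1 * (Er x R / real n) \<le> 2 * K / (Ce * c0) * (Ce * c0 * R powr (\<beta> - 1))"
        using c1 K Ce(1) c0 Er_nonneg[of x R] by (intro mult_mono) auto
      then have "c1 * Er x R / (2 * K * real n) \<le> R powr (\<beta> - 1)"
        using K Ce(1) c0 n by (simp add: field_simps)
      then have "\<nu> \<le> (R powr (\<beta> - 1)) powr ?g"
        unfolding \<nu>_def using c1 K g E1 by (intro powr_mono2) auto
      also have "\<dots> = R"
        using R Ce by (simp add: powr_powr)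
      finally show ?thesis .
    qed
    show ?thesis
    proof (cases "\<nu> < 1")
      case True
      have "1 - surv (B x R) n x \<le> 1"
        by (simp add: surv_nonneg)
      also have "\<dots> \<le> exp (c1 / 2 - c1 / 2 * \<nu>)"
        using True c1 by (simp add: mult_left_le)
      also have "\<dots> = exp (c1 / 2) * exp (- c * (Er x R / real n) powr ?g)"
        using c\<nu> by (simp flip: exp_add)
      finally show ?thesis .
    next
      case \<nu>1: False
      define N where "N = nat \<lfloor>\<nu>\<rfloor>"
      have N: "1 \<le> N" "real N \<le> \<nu>" "\<nu> \<le> real N + 1"
        using \<nu>1 unfolding N_def by linarith+
      have RN: "1 \<le> R / real N"
        using N \<nu>R by simp
      define r where "r = nat \<lfloor>R / real N\<rfloor>"
      have r: "1 \<le> r" "real r \<le> R / real N" "R / real N \<le> 2 * real r"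
      proof -
        have "real_of_int \<lfloor>R / real N\<rfloor> = real r" "1 \<le> \<lfloor>R / real N\<rfloor>"
          using RN by (auto simp: r_def le_floor_iff)
        then show "1 \<le> r" "real r \<le> R / real N" "R / real N \<le> 2 * real r"
          using RN by linarith+
      qed
      have Nr: "real (N * r) \<le> R"
        using r(2) N(1) by (simp add: field_simps)
      define E0 where "E0 = Er x R / (Ce * (4 * real N) powr \<beta>)"
      have E0: "0 < E0"
        using E1 Ce N by (simp add: E0_def)
      have E0_le: "E0 \<le> Er y (real r)" if y: "y \<in> B x (real (N * r))" for y
      proof -
        have "r \<le> R"
        proof -
          have "1 * real r \<le> real N * real r"
            using N by (intro mult_right_mono) auto
          then show ?thesis
            using Nr by simp
        qed
        have "Er x R \<le> Er x (2 * R)"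
          using R by (intro Er_mono) simp
        also have "\<dots> \<le> Ce * (2 * R / real r) powr \<beta> * Er y (real r)"
          using y Nr R r \<open>r \<le> R\<close> by (intro Ce(3)) (auto simp: B_iff d_sym)
        also have "\<dots> \<le> Ce * (4 * real N) powr \<beta> * Er y (real r)"
        proof (intro mult_right_mono mult_left_mono powr_mono2 Er_nonneg)
          show "2 * R / real r \<le> 4 * real N"
            using r N by (simp add: field_simps)
        qed (use Ce R in auto)
        finally show ?thesis
          using Ce N by (simp add: E0_def field_simps)
      qed
      let ?\<sigma> = "exp (- 8 / E0)"
      have "1 - surv (B x R) n x \<le> 1 - surv (B x (real (N * r))) n x"
        using Q_mono_set[OF B_mono[OF Nr], of "\<lambda>_. 1"] by simp
      also have "\<dots> \<le> q ^ N * (1 / ?\<sigma>) ^ n"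
      proof (rule exit_chain)
        show "J (B y (real r)) ?\<sigma> n y \<le> q" if "y \<in> B x (real (N * r))" for y n
          using E0_le[OF that] E0 r by (intro q(3)) auto
      qed (use q E0 r in auto)
      also have "(1 / ?\<sigma>) ^ n = exp (real n * (8 / E0))"
        by (simp add: exp_minus inverse_eq_divide flip: exp_of_nat_mult)
      finally have exit: "1 - surv (B x R) n x \<le> q ^ N * exp (real n * (8 / E0))" .
      have "real n * (8 / E0) \<le> real N * (c1 / 2)"
      proof -
        have "real N powr (\<beta> - 1) \<le> \<nu> powr (\<beta> - 1)"
          using N Ce by (intro powr_mono2) auto
        also have "\<dots> = c1 * Er x R / (2 * K * real n)"
          using Ce c1 K E1 n by (simp add: \<nu>_def powr_powr)
        finally have "real N powr (\<beta> - 1) * (K * real n / Er x R) \<le> c1 / 2"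
          using E1 K n by (simp add: field_simps)
        then have "real N * (real N powr (\<beta> - 1) * (K * real n / Er x R)) \<le> real N * (c1 / 2)"
          by (intro mult_left_mono) auto
        moreover have "real N * real N powr (\<beta> - 1) = real N powr \<beta>"
          using N by (simp add: powr_diff)
        ultimately have "real N powr \<beta> * (K * real n / Er x R) \<le> real N * (c1 / 2)"
          by (simp only: mult.assoc[symmetric])
        moreover have "real n * (8 / E0) = real N powr \<beta> * (K * real n / Er x R)"
          by (simp add: E0_def K_def powr_mult)
        ultimately show ?thesis
          by simp
      qed
      moreover have "q ^ N \<le> exp (- c1 * real N)"
      proof -
        have "q ^ N = exp (real N * ln q)"
          using q by (simp add: exp_of_nat_mult)
        also have "\<dots> \<le> exp (- c1 * real N)"
          using mult_left_mono[OF c1(2), of "real N"] by (simp add: mult.commute)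
        finally show ?thesis .
      qed
      ultimately have "q ^ N * exp (real n * (8 / E0)) \<le> exp (- c1 * real N) * exp (real N * (c1 / 2))"
        by (intro mult_mono) auto
      with exit have "1 - surv (B x R) n x \<le> exp (- c1 * real N) * exp (real N * (c1 / 2))"
        by (rule order_trans)
      also have "\<dots> = exp (- (c1 / 2) * real N)"
        by (simp flip: exp_add)
      also have "\<dots> \<le> exp (c1 / 2 - c1 / 2 * \<nu>)"
        using mult_left_mono[OF N(3), of "c1 / 2"] c1 by (simp add: algebra_simps)
      also have "\<dots> = exp (c1 / 2) * exp (- c * (Er x R / real n) powr ?g)"
        using c\<nu> by (simp flip: exp_add)
      finally show ?thesis .
    qed
  qed
  then show ?thesis
    using c Ce(2) by (intro exI[of _ "exp (c1 / 2)"] exI[of _ c] exI[of _ \<beta>] conjI) auto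
qed

end

section \<open>Powers against stretched exponentials\<close>

lemma powr_exp_bounded:
  fixes c g a :: real
  assumes "0 < c" "0 < g" "0 < a"
  shows "\<exists>M>0. \<forall>t\<ge>0. (1 + t) powr a * exp (- c * t powr g) \<le> M"
proof -
  define b where "b = a / g"
  have b: "0 < b"
    using assms by (simp add: b_def)
  \<comment> \<open>The exponent is the maximum of \<open>b * ln s - c * s\<close>, attained at
    \<open>s = b / c\<close>; the summand 1 covers \<open>t \<le> 1\<close>.\<close>
  define M where "M = 2 powr a * (1 + exp (- b + b * ln (b / c)))"
  have "(1 + t) powr a * exp (- c * t powr g) \<le> M" if t: "0 \<le> t" for t
  proof (cases "t \<le> 1")
    case True
    have "(1 + t) powr a * exp (- c * t powr g) \<le> 2 powr a * 1"
      using True t assms by (intro mult_mono powr_mono2) auto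
    also have "\<dots> \<le> M"
      unfolding M_def by (intro mult_left_mono) auto
    finally show ?thesis .
  next
    case False
    define s where "s = t powr g"
    have s: "0 < s"
      using False by (simp add: s_def)
    have "ln (s * c / b) \<le> s * c / b - 1"
      using s assms b by (intro ln_le_minus_one) auto
    then have "b * ln (s * c / b) \<le> b * (s * c / b - 1)"
      using b by (intro mult_left_mono) auto
    also have "\<dots> = c * s - b"
      using b by (simp add: field_simps)
    also have "ln (s * c / b) = ln s - ln (b / c)"
      using s b assms by (simp add: ln_mult ln_div)
    finally have ln: "b * ln s - c * s \<le> - b + b * ln (b / c)"
      by (simp add: algebra_simps)
    have "(1 + t) powr a \<le> (2 * t) powr a"
      using False assms by (intro powr_mono2) auto
    also have "\<dots> = 2 powr a * s powr b"
      using False assms by (simp add: powr_mult s_def powr_powr b_def)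
    finally have "(1 + t) powr a * exp (- c * s) \<le> 2 powr a * s powr b * exp (- c * s)"
      by (intro mult_right_mono) auto
    also have "\<dots> = 2 powr a * exp (b * ln s - c * s)"
      using s by (simp add: powr_def mult.assoc flip: exp_add)
    also have "\<dots> \<le> 2 powr a * exp (- b + b * ln (b / c))"
      using ln by (intro mult_left_mono) auto
    also have "\<dots> \<le> M"
      unfolding M_def by (intro mult_left_mono) auto
    finally show ?thesis
      by (simp add: s_def)
  qed
  moreover have "0 < M"
    unfolding M_def by (intro mult_pos_pos add_pos_pos) auto
  ultimately show ?thesis
    by blast
qed

context weighted_graph_p0 begin

subsection \<open>Heat kernel\<close>

lemma p_nonneg: "0 \<le> p n x y"
  by (simp add: p_eq Q_dens_nonneg)

lemma p_ip: "ip (Q UNIV m (dens x)) (Q UNIV n (dens y)) = p (m + n) x y"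
  by (simp add: p_eq ip_Q_dens)

lemma p_fun: "Q UNIV n (dens y) = (\<lambda>x. p n x y)"
  by (simp add: p_eq)

lemma p_Suc: "p (Suc n) x y = T UNIV (\<lambda>x. p n x y) x"
  by (simp add: p_eq Q_Suc)

lemma p_eq_0: "n < d x y \<Longrightarrow> p n x y = 0"
proof (induction n arbitrary: x)
  case 0
  then have "x \<noteq> y"
    by auto
  then show ?case
    by (simp add: p_eq Q_0 dens_def)
next
  case (Suc n)
  have "p n z y = 0" if "z \<in> nb x" for z
    using d_triangle[of x y z] d_nb[OF that] Suc.prems by (intro Suc.IH) linarith
  then show ?case
    by (simp add: p_Suc T_def)
qed

text \<open>Unlike \<open>p\<^sub>k(x,x)\<close>, which vanishes for odd \<open>k\<close> on bipartite graphs, this is monotone in \<open>k\<close>.\<close>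

definition pe :: "nat \<Rightarrow> 'a \<Rightarrow> real" where
  "pe k x = p (2 * (k div 2)) x x"

lemma pe_nonneg: "0 \<le> pe k x"
  by (simp add: pe_def p_nonneg)

lemma p_even_antimono: "i \<le> j \<Longrightarrow> p (2 * j) x x \<le> p (2 * i) x x"
proof (induction j rule: dec_induct)
  case (step j)
  have "p (2 * Suc j) x x = ip (T UNIV (Q UNIV j (dens x))) (T UNIV (Q UNIV j (dens x)))"
    using p_ip[of "Suc j" x "Suc j" x] by (simp add: Q_Suc mult_2)
  also have "\<dots> \<le> ip (Q UNIV j (dens x)) (Q UNIV j (dens x))"
    by (intro ip_T_le fs_Q fs_dens) simp
  also have "\<dots> = p (2 * j) x x"
    by (simp add: p_ip mult_2)
  finally show ?case
    using step.IH by simp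
qed simp

lemma pe_antimono: "k \<le> l \<Longrightarrow> pe l x \<le> pe k x"
  unfolding pe_def by (intro p_even_antimono div_le_mono)

lemma pe_le_inverse: "pe k x \<le> 1 / \<mu> x"
  using p_even_antimono[of 0 "k div 2" x] by (simp add: pe_def p_eq Q_0 dens_def)

text \<open>Cauchy-Schwarz after splitting the time in halves; for odd \<open>k\<close> the extra
  step is absorbed because \<open>P\<close> is a contraction.\<close>

lemma p_square_le: "(p k x y)\<^sup>2 \<le> pe k x * pe k y"
proof -
  define j where "j = k div 2"
  let ?f = "Q UNIV j (dens x)" and ?g = "Q UNIV j (dens y)"
  have pe: "pe k x = ip ?f ?f" "pe k y = ip ?g ?g"
    by (simp_all add: pe_def p_ip j_def mult_2)
  show ?thesis
  proof (cases "even k")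
    case True
    then have "p k x y = ip ?f ?g"
      by (simp add: p_ip j_def flip: mult_2)
    then show ?thesis
      unfolding pe by (simp add: ip_Cauchy_Schwarz fs_Q fs_dens)
  next
    case False
    then have "Suc j + j = k"
      unfolding j_def by presburger
    then have "p k x y = ip (T UNIV ?f) ?g"
      using p_ip[of "Suc j" x j y] by (simp add: Q_Suc)
    then have "(p k x y)\<^sup>2 \<le> ip (T UNIV ?f) (T UNIV ?f) * ip ?g ?g"
      by (simp add: ip_Cauchy_Schwarz fs_Q fs_dens fs_T)
    also have "\<dots> \<le> ip ?f ?f * ip ?g ?g"
      by (intro mult_right_mono ip_T_le fs_Q fs_dens ip_self_nonneg) simp
    finally show ?thesis
      unfolding pe .
  qed
qed

lemma p_le_of_pe:
  assumes "pe j x \<le> S" "pe j y \<le> S" "j \<le> k"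
  shows "p k x y \<le> S"
proof (rule power2_le_imp_le)
  have "(p k x y)\<^sup>2 \<le> pe k x * pe k y"
    by (rule p_square_le)
  also have "\<dots> \<le> S * S"
    using assms pe_antimono[OF assms(3)] pe_nonneg[of k] pe_nonneg[of j x] by (intro mult_mono) (auto intro: order_trans)
  finally show "(p k x y)\<^sup>2 \<le> S\<^sup>2"
    by (simp add: power2_eq_square)
  show "0 \<le> S"
    using assms(1) pe_nonneg[of j x] by simp
qed

lemma p_le_pe: "p k x x \<le> pe k x"
  by (rule p_le_of_pe[of k]) simp_all

text \<open>The first factor counts the walks from \<open>x\<close> that have left \<open>A\<close> by time \<open>a\<close>.\<close>

lemma ip_exit_le:
  assumes x: "x \<in> A"
    and S: "\<And>k v z. b \<le> k \<Longrightarrow> z \<in> A \<Longrightarrow> v \<in> nb z \<Longrightarrow> v \<notin> A \<Longrightarrow> p k v y \<le> S"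
  shows "ip (\<lambda>z. p a z x - Q A a (dens x) z) (\<lambda>z. p b z y) \<le> (1 - surv A a x) * S"
proof -
  let ?h = "\<lambda>z. p b z y"
  have fs: "fs ?h" "fs (\<lambda>z. p a z x)"
    unfolding p_fun[symmetric] by (intro fs_Q fs_dens)+
  have res: "fs (res A ?h)"
    using fs(1) by (rule fsE) (erule fsI, simp add: res_def)
  have "ip (Q A a (dens x)) ?h = ip (Q A a (dens x)) (res A ?h)"
    by (rule ip_cong) (auto simp: res_def Q_out)
  also have "\<dots> = ip (dens x) (Q A a (res A ?h))"
    using x res by (intro ip_Q_sym fs_dens) (auto simp: dens_def res_def)
  also have "\<dots> = Q A a ?h x"
    unfolding ip_commute[of "dens x"] ip_dens by (rule fun_cong[OF Q_cong]) (simp add: res_def)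
  finally have 1: "ip (Q A a (dens x)) ?h = Q A a ?h x" .
  have 2: "ip (\<lambda>z. p a z x) ?h = p (b + a) x y"
    using p_ip[of a x b y] by (simp add: p_fun add.commute)
  have "p (b + a) x y \<le> Q A a ?h x + (1 - surv A a x) * S"
    using heat_exit_le[of "\<lambda>k z. p (b + k) z y" a A S x] S x by (simp add: p_Suc)
  then show ?thesis
    using 1 2 fs by (simp add: ip_diff fs_Q fs_dens)
qed

text \<open>With \<open>f\<close> the full and \<open>g\<close> the killed kernel,
  \<open>f^2 \<le> g^2 + 2 * (f - g) * f\<close> because \<open>(f - g)^2 \<ge> 0\<close>. The
  factor \<open>f - g\<close> counts the walks that have left \<open>A\<close>.\<close>

lemma p_even_exit_le:
  assumes x: "x \<in> A"
    and S: "\<And>k v z. j \<le> k \<Longrightarrow> z \<in> A \<Longrightarrow> v \<in> nb z \<Longrightarrow> v \<notin> A \<Longrightarrow> p k v x \<le> S"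
  shows "p (2 * j) x x \<le> Q A (2 * j) (dens x) x + 2 * ((1 - surv A j x) * S)"
proof -
  define f where "f z = p j z x" for z
  define g where "g = Q A j (dens x)"
  have fs: "fs f" "fs g"
    unfolding f_def[abs_def] g_def p_fun[symmetric] by (intro fs_Q fs_dens)+
  have "p (2 * j) x x = ip f f"
    using p_ip[of j x j x] by (simp add: p_fun f_def[abs_def] mult_2)
  also have "\<dots> \<le> ip (\<lambda>z. g z * g z + 2 * ((f z - g z) * f z)) (\<lambda>_. 1)"
  proof (rule ip_mono)
    show "fs (\<lambda>z. g z * g z + 2 * ((f z - g z) * f z))"
      by (rule fsE2[OF fs]) (erule fsI, simp)
    show "f z * f z \<le> (g z * g z + 2 * ((f z - g z) * f z)) * 1" for z
      using zero_le_square[of "f z - g z"] by (simp add: algebra_simps)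
  qed (rule fs)
  also have "\<dots> = ip g g + 2 * ip (\<lambda>z. f z - g z) f"
  proof -
    obtain S where "finite S" "\<And>x. x \<notin> S \<Longrightarrow> f x = 0" "\<And>x. x \<notin> S \<Longrightarrow> g x = 0"
      using fsE2[OF fs] by blast
    then show ?thesis
      by (simp add: ip_eq[of S] sum.distrib sum_distrib_left distrib_right mult.assoc)
  qed
  also have "ip g g = Q A (2 * j) (dens x) x"
    using x by (simp add: g_def ip_Q_dens mult_2)
  also have "ip (\<lambda>z. f z - g z) f \<le> (1 - surv A j x) * S"
    unfolding f_def g_def by (rule ip_exit_le[OF x S])
  finally show ?thesis
    by simp
qed

text \<open>The midpoint of a path from \<open>x\<close> to \<open>y\<close> cannot be close to both end points.\<close>

lemma p_off_diagonal_le: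
  assumes R: "0 < R" "2 * R \<le> real (d x y)"
    and S1: "\<And>k v z. b \<le> k \<Longrightarrow> z \<in> B x R \<Longrightarrow> v \<in> nb z \<Longrightarrow> p k v y \<le> S"
    and S2: "\<And>k v z. a \<le> k \<Longrightarrow> z \<in> B y R \<Longrightarrow> v \<in> nb z \<Longrightarrow> p k v x \<le> S"
  shows "p (a + b) x y \<le> (1 - surv (B x R) a x) * S + (1 - surv (B y R) b y) * S"
proof -
  define f where "f z = p a z x" for z
  define h where "h z = p b z y" for z
  define f' where "f' = Q (B x R) a (dens x)"
  define h' where "h' = Q (B y R) b (dens y)"
  have fs: "fs f" "fs h" "fs f'" "fs h'"
    unfolding f_def[abs_def] h_def[abs_def] f'_def h'_def p_fun[symmetric] by (intro fs_Q fs_dens)+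
  have le: "0 \<le> f' z" "f' z \<le> f z" "0 \<le> h' z" "h' z \<le> h z" for z
    unfolding f_def h_def f'_def h'_def p_eq
    by (intro Q_dens_nonneg Q_mono_set; simp add: dens_def \<mu>_nonneg)+
  have "p (a + b) x y = ip f h"
    using p_ip[of a x b y] by (simp add: p_fun f_def[abs_def] h_def[abs_def])
  also have "\<dots> \<le> ip (\<lambda>z. (f z - f' z) * h z + (h z - h' z) * f z) (\<lambda>_. 1)"
  proof (rule ip_mono)
    show "fs (\<lambda>z. (f z - f' z) * h z + (h z - h' z) * f z)"
      by (rule fsE2[OF fs(1,2)]) (erule fsI, simp)
    fix z
    have "z \<notin> B x R \<or> z \<notin> B y R"
      using R d_triangle[of x y z] d_sym[of z y] by (auto simp: B_iff)
    then have "f' z = 0 \<or> h' z = 0"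
      by (auto simp: f'_def h'_def Q_out)
    moreover have "0 \<le> (f z - f' z) * h z" "0 \<le> (h z - h' z) * f z"
      using le[of z] by (auto intro!: mult_nonneg_nonneg)
    ultimately show "f z * h z \<le> ((f z - f' z) * h z + (h z - h' z) * f z) * 1"
      by (auto simp: mult.commute)
  qed (rule fs)
  also have "\<dots> = ip (\<lambda>z. f z - f' z) h + ip (\<lambda>z. h z - h' z) f"
  proof -
    obtain S where "finite S" "\<And>x. x \<notin> S \<Longrightarrow> f x = 0" "\<And>x. x \<notin> S \<Longrightarrow> h x = 0"
      using fsE2[OF fs(1,2)] by blast
    then show ?thesis
      by (simp add: ip_eq[of S] sum.distrib distrib_right mult.assoc)
  qed
  also have "ip (\<lambda>z. f z - f' z) h \<le> (1 - surv (B x R) a x) * S"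
    unfolding f_def f'_def h_def using R S1 by (intro ip_exit_le center_B) auto
  also have "ip (\<lambda>z. h z - h' z) f \<le> (1 - surv (B y R) b y) * S"
    unfolding f_def h'_def h_def using R S2 by (intro ip_exit_le center_B) auto
  finally show ?thesis
    by simp
qed

lemma UE_imp_DUE:
  assumes cond_UE
  shows cond_DUE
proof -
  obtain c C \<beta> where C: "cond_VD" "cond_TC" "C > 0"
    "\<And>x y n. n \<ge> 1 \<Longrightarrow> p n x y \<le> C / V x (real (e x n)) *
          exp (- c * (enn2real (E x (real (d x y))) / real n) powr (1 / (\<beta> - 1)))"
    using assms unfolding cond_UE_def by blast
  have "p n x x \<le> C / V x (real (e x n))" if "n \<ge> 1" for x n
    using C(4)[OF that, of x x] by (simp add: E_eq Er_nonpos)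
  with C show ?thesis
    unfolding cond_DUE_def by blast
qed

end

section \<open>On-diagonal and off-diagonal bounds under doubling\<close>

context doubling_graph begin

definition DUEr :: "real \<Rightarrow> bool" where
  "DUEr C \<longleftrightarrow> (\<forall>x k. 1 \<le> k \<longrightarrow> pe k x \<le> C / V x (real (e x k)))"

lemma V_e_pos: "1 \<le> k \<Longrightarrow> 0 < V x (real (e x k))"
  using e_pos[of k x] by (intro V_pos) simp

lemma DUEr_imp_DUE:
  assumes "DUEr C" "0 < C"
  shows cond_DUE
  using assms VD TC order_trans[OF p_le_pe] unfolding cond_DUE_def DUEr_def by blast

text \<open>\<open>pe k\<close> looks at time \<open>k\<close> or \<open>k - 1\<close>, and
  \<open>V_compare\<close> corrects the volume. For \<open>k = 1\<close> the time is 0, outside the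
  range of (DUE), and the trivial bound \<open>1 / \<mu> x\<close> takes over.\<close>

lemma DUE_imp_DUEr:
  assumes cond_DUE
  shows "\<exists>C\<ge>1. DUEr C"
proof -
  obtain C where C: "C > 0" "\<And>x n. n \<ge> 1 \<Longrightarrow> p n x x \<le> C / V x (real (e x n))"
    using assms unfolding cond_DUE_def by blast
  obtain Cc \<alpha> where Cc: "1 \<le> Cc" "0 < \<alpha>" "\<And>x v k j R. 1 \<le> k \<Longrightarrow> k \<le> 4 * j \<Longrightarrow> 1 \<le> R \<Longrightarrow> real (d x v) \<le> R \<Longrightarrow>
     V x (real (e x k)) \<le> Cc * (1 + Er x R / real k) powr \<alpha> * V v (real (e v j))"
    using V_compare by blast
  obtain c0 where c0: "1 \<le> c0" "\<And>x. Er x 1 \<le> c0"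
    using Er_1_le by blast
  define C' where "C' = max 1 (C * (Cc * (1 + c0) powr \<alpha>))"
  have "pe k x \<le> C' / V x (real (e x k))" if k: "1 \<le> k" for x k
  proof (cases "k = 1")
    case True
    have "1 / \<mu> x \<le> C' / \<mu> x"
      by (intro divide_right_mono) (auto simp: C'_def \<mu>_nonneg)
    then show ?thesis
      using True pe_le_inverse[of k x] e_1[of x] by (simp add: V_1)
  next
    case False
    define n where "n = 2 * (k div 2)"
    have n: "1 \<le> n" "k \<le> 4 * n"
      using k False unfolding n_def by presburger+
    have "V x (real (e x k)) \<le> Cc * (1 + Er x 1 / real k) powr \<alpha> * V x (real (e x n))"
      using k n by (intro Cc(3)) auto
    also have "\<dots> \<le> Cc * (1 + c0) powr \<alpha> * V x (real (e x n))"
    proof (intro mult_right_mono mult_left_mono powr_mono2)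
      have "Er x 1 / real k \<le> Er x 1 / 1"
        using k Er_nonneg[of x 1] by (intro divide_left_mono) auto
      then show "1 + Er x 1 / real k \<le> 1 + c0"
        using c0(2)[of x] by simp
    qed (use Cc V_e_pos[OF n(1), of x] Er_nonneg[of x 1] in \<open>auto intro!: add_nonneg_nonneg\<close>)
    finally have le: "V x (real (e x k)) \<le> Cc * (1 + c0) powr \<alpha> * V x (real (e x n))" .
    have "pe k x \<le> C / V x (real (e x n))"
      using C(2)[OF n(1), of x] by (simp add: pe_def n_def)
    also have "\<dots> \<le> C * (Cc * (1 + c0) powr \<alpha>) / V x (real (e x k))"
      using mult_left_mono[OF le, of C] C(1) V_e_pos[OF n(1), of x] V_e_pos[OF k, of x]
      by (simp add: field_simps)
    also have "\<dots> \<le> C' / V x (real (e x k))"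
      using V_e_pos[OF k, of x] by (intro divide_right_mono) (auto simp: C'_def)
    finally show ?thesis .
  qed
  then show ?thesis
    unfolding DUEr_def by (intro exI[of _ C']) (auto simp: C'_def)
qed

text \<open>Lets radii below 1 be raised to 1, where \<open>Er_antiscale\<close> applies.\<close>

lemma Er_max1: "0 < R \<Longrightarrow> Er x (max R 1) = Er x R"
  by (cases "R \<le> 1") (simp_all add: Er_def B_le1 max_def)

text \<open>If \<open>vol A\<close> is comparable to \<open>V x (3 * R)\<close>, the mean exit time
  from the whole ball suffices. Otherwise a time \<open>n\<close> just above \<Lambda> makes
  \<open>V z (e z (2 * n))\<close> larger than \<open>4 * C0 * vol A\<close> for all
  \<open>z\<close> in \<open>A\<close>, so return densities fall below
  \<open>1 / (4 * vol A)\<close> and half of the walks have left by time \<open>n\<close>.\<close>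

lemma DUEr_imp_Eexit:
  assumes DUE: "DUEr C0" and C0: "1 \<le> C0"
  shows "\<exists>C>0. \<exists>\<delta>>0. Eexit C \<delta>"
proof -
  obtain Cv \<alpha> where Cv: "1 \<le> Cv" "0 < \<alpha>"
    "\<And>x r R. 0 < r \<Longrightarrow> r \<le> R \<Longrightarrow> V x R \<le> Cv * (R / r) powr \<alpha> * V x r"
    using V_scale by blast
  obtain Ce \<beta> where Ce: "1 \<le> Ce" "1 < \<beta>"
    "\<And>x y r R. 0 < r \<Longrightarrow> r \<le> R \<Longrightarrow> real (d x y) < R \<Longrightarrow> Er y R \<le> Ce * (R / r) powr \<beta> * Er x r"
    using Er_scale by blast
  obtain Ca \<gamma> where Ca: "1 \<le> Ca" "0 < \<gamma>"
    "\<And>x r R. 1 \<le> r \<Longrightarrow> r \<le> R \<Longrightarrow> (R / r) powr \<gamma> * Er x r \<le> Ca * Er x R"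
    using Er_antiscale by blast
  \<comment> \<open>Volumes grow at most with exponent \<alpha> and mean exit times at least with
    exponent \<gamma>; \<delta> converts one ratio into the other.\<close>
  define \<delta> where "\<delta> = \<gamma> / \<alpha>"
  have \<delta>: "0 < \<delta>"
    using Cv Ca by (simp add: \<delta>_def)
  \<comment> \<open>The threshold between the cases: beyond it, a ball around \<open>z\<close> of
    volume at most \<open>4 * C0 * vol A\<close> has radius at most \<open>4 * R1\<close>.\<close>
  define c2 where "c2 = 4 * C0 * (Cv * 3 powr \<alpha>)"
  have c2: "0 < c2"
    using C0 Cv by (simp add: c2_def)
  define C1 where "C1 = Ca * (Cv * c2) powr \<delta> * (Ce * 4 powr \<beta>)"
  have C1: "0 < C1"
    using Ca Cv Ce c2 by (simp add: C1_def)
  define C2 where "C2 = Ce * 6 powr \<beta> * c2 powr \<delta>"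
  have C2: "0 < C2"
    using Ce c2 by (simp add: C2_def)
  have "Eexit (max (4 * C1) C2) \<delta>"
    unfolding Eexit_def
  proof (intro allI impI)
    fix x R A y assume R: "0 < R" and A: "A \<subseteq> B x (3 * R)" and y: "y \<in> A"
    let ?V = "V x (3 * R)"
    have fin: "finite A"
      using A by (auto intro: finite_subset)
    have volp: "0 < vol A" and Vp: "0 < ?V"
      using fin y R by (auto intro: vol_pos V_pos)
    define R1 where "R1 = max R 1"
    have R1: "1 \<le> R1" "R \<le> R1" "Er x R1 = Er x R"
      using R by (auto simp: R1_def Er_max1)
    have dz: "real (d x z) < 3 * R1" if "z \<in> A" for z
      using that A R1 by (auto simp: B_iff)
    have V3: "?V \<le> Cv * 3 powr \<alpha> * V z (4 * R1)" if z: "z \<in> A" for z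
    proof -
      have "?V \<le> Cv * (3 * R / R) powr \<alpha> * V x R"
        using R by (intro Cv(3)) auto
      also have "V x R \<le> V z (4 * R1)"
        using dz[OF z] R1 by (intro V_subset) (simp add: d_sym)
      finally show ?thesis
        using R Cv by (simp add: mult_left_mono)
    qed
    show "mx A y \<le> bnd (max (4 * C1) C2) \<delta> x R A"
    proof (cases "?V \<le> c2 * vol A")
      case True
      have "mx A y \<le> mx (B x (3 * R)) y"
        by (intro mx_mono finite_B A)
      also have "\<dots> \<le> Er y (6 * R1)"
        unfolding Er_def using dz[OF y] R1 by (intro mx_mono finite_B B_subset) (simp add: d_sym)
      also have "\<dots> \<le> Ce * (6 * R1 / R1) powr \<beta> * Er x R1"
        using dz[OF y] R1 by (intro Ce(3)) auto
      also have "\<dots> = Ce * 6 powr \<beta> * Er x R * 1"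
        using R1 by simp
      also have "\<dots> \<le> Ce * 6 powr \<beta> * Er x R * (c2 * (vol A / ?V)) powr \<delta>"
        using True Vp \<delta> Ce Er_nonneg[of x R]
        by (intro mult_left_mono ge_one_powr_ge_zero) (auto simp: field_simps)
      also have "\<dots> = C2 * Er x R * (vol A / ?V) powr \<delta>"
        using c2 volp Vp by (simp add: C2_def powr_mult powr_divide)
      also have "\<dots> \<le> bnd (max (4 * C1) C2) \<delta> x R A"
        unfolding bnd_def by (intro mult_right_mono Er_nonneg) auto
      finally show ?thesis .
    next
      case False
      define \<Lambda> where "\<Lambda> = bnd C1 \<delta> x R A"
      have small: "Er z r \<le> \<Lambda>" if z: "z \<in> A" and r: "1 \<le> r" "V z r \<le> 4 * C0 * vol A" for z r
      proof -
        have r4: "r \<le> 4 * R1"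
        proof (rule ccontr)
          assume "\<not> r \<le> 4 * R1"
          then have "V z (4 * R1) \<le> V z r"
            by (intro V_mono) simp
          then have "V z (4 * R1) \<le> 4 * C0 * vol A"
            using r by simp
          then have "Cv * 3 powr \<alpha> * V z (4 * R1) \<le> Cv * 3 powr \<alpha> * (4 * C0 * vol A)"
            using Cv by (intro mult_left_mono) auto
          then have "?V \<le> c2 * vol A"
            using V3[OF z] by (simp add: c2_def mult_ac)
          then show False
            using False by simp
        qed
        let ?t = "4 * R1 / r"
        have t: "0 < ?t"
          using r R1 by simp
        have "?V \<le> Cv * 3 powr \<alpha> * V z (4 * R1)"
          by (rule V3[OF z])
        also have "V z (4 * R1) \<le> Cv * ?t powr \<alpha> * V z r"
          using r r4 by (intro Cv(3)) auto
        also have "\<dots> \<le> Cv * ?t powr \<alpha> * (4 * C0 * vol A)"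
          using r Cv by (intro mult_left_mono) auto
        finally have "?V \<le> ?t powr \<alpha> * (Cv * c2 * vol A)"
          using Cv by (simp add: c2_def mult_ac)
        then have "1 \<le> ?t powr \<alpha> * (Cv * c2 * (vol A / ?V))"
          using Vp by (simp add: field_simps)
        then have "1 \<le> (?t powr \<alpha> * (Cv * c2 * (vol A / ?V))) powr \<delta>"
          using \<delta> by (intro ge_one_powr_ge_zero) auto
        also have "\<dots> = ?t powr \<gamma> * ((Cv * c2) powr \<delta> * (vol A / ?V) powr \<delta>)"
          using Cv c2 volp Vp by (simp add: powr_mult powr_divide powr_powr \<delta>_def)
        finally have "1 * Er z r \<le> ?t powr \<gamma> * ((Cv * c2) powr \<delta> * (vol A / ?V) powr \<delta>) * Er z r"
          by (intro mult_right_mono Er_nonneg)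
        also have "\<dots> = (Cv * c2) powr \<delta> * (vol A / ?V) powr \<delta> * (?t powr \<gamma> * Er z r)"
          by (simp add: mult_ac)
        also have "\<dots> \<le> (Cv * c2) powr \<delta> * (vol A / ?V) powr \<delta> * (Ca * Er z (4 * R1))"
          using r r4 by (intro mult_left_mono Ca(3)) auto
        also have "\<dots> \<le> (Cv * c2) powr \<delta> * (vol A / ?V) powr \<delta> * (Ca * (Ce * (4 * R1 / R1) powr \<beta> * Er x R1))"
          using dz[OF z] R1 Ca by (intro mult_left_mono Ce(3)) auto
        also have "\<dots> = \<Lambda>"
          using R1 by (simp add: \<Lambda>_def bnd_def C1_def mult_ac)
        finally show ?thesis
          by simp
      qed
      have "V y 1 \<le> vol A"
        using sum_mono2[OF fin, of "{y}" \<mu>] y by (simp add: V_1 vol_eq[OF fin] \<mu>_nonneg)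
      also have "1 * vol A \<le> 4 * C0 * vol A"
        using C0 volp by (intro mult_right_mono) auto
      finally have \<Lambda>1: "1 \<le> \<Lambda>"
        using small[OF y, of 1] Er_ge1[of 1 y] by simp
      define n where "n = nat \<lfloor>\<Lambda>\<rfloor> + 1"
      have n: "\<Lambda> < real n" "real n \<le> \<Lambda> + 1" "1 \<le> n"
        using \<Lambda>1 unfolding n_def by linarith+
      have "surv A n z \<le> 1 / 2" if z: "z \<in> A" for z
      proof -
        let ?r = "real (e z (2 * n))"
        have "1 \<le> ?r"
          using e_pos[of "2 * n" z] n by simp
        have "\<Lambda> < Er z ?r"
          using e_ge[of "2 * n" z] n by simp
        then have "4 * C0 * vol A < V z ?r"
          using small[OF z \<open>1 \<le> ?r\<close>] by linarith
        have "Q A (2 * n) (dens z) z \<le> p (2 * n) z z"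
          unfolding p_eq by (intro Q_mono_set) (auto simp: dens_def \<mu>_nonneg)
        also have "\<dots> \<le> C0 / V z ?r"
          using DUE n unfolding DUEr_def by (auto intro: order_trans[OF p_le_pe])
        also have "\<dots> \<le> C0 / (4 * C0 * vol A)"
          using \<open>4 * C0 * vol A < V z ?r\<close> C0 volp \<open>1 \<le> ?r\<close> V_pos[of ?r z]
          by (intro divide_left_mono mult_pos_pos) auto
        finally have "vol A * Q A (2 * n) (dens z) z \<le> vol A * (C0 / (4 * C0 * vol A))"
          using volp by (intro mult_left_mono) auto
        also have "\<dots> = (1 / 2)\<^sup>2"
          using volp C0 by (simp add: power2_eq_square)
        finally have "(surv A n z)\<^sup>2 \<le> (1 / 2)\<^sup>2"
          using surv_square_le[OF fin z, of n] by simp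
        then show ?thesis
          by (rule power2_le_imp_le) simp
      qed
      then have "mx A y \<le> 2 * real n"
        by (rule mx_le_half[OF fin])
      also have "\<dots> \<le> 4 * \<Lambda>"
        using n \<Lambda>1 by simp
      also have "\<dots> = 4 * C1 * Er x R * (vol A / ?V) powr \<delta>"
        by (simp add: \<Lambda>_def bnd_def)
      also have "\<dots> \<le> bnd (max (4 * C1) C2) \<delta> x R A"
        unfolding bnd_def by (intro mult_right_mono Er_nonneg) auto
      finally show ?thesis .
    qed
  qed
  then show ?thesis
    using \<delta> C2 by (intro exI[of _ "max (4 * C1) C2"] conjI exI[of _ \<delta>]) auto
qed

lemma bdry_dist: "z \<in> B x R \<Longrightarrow> v \<in> nb z \<Longrightarrow> real (d x v) < R + 1"
  using d_nb_le[of v z x] by (simp add: B_iff)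

text \<open>Let \<open>S\<close> be the supremum of \<open>p\<^sub>2\<^sub>j(x,x) V(x,e(x,k))\<close> over \<open>x\<close> and \<open>k \<le> N\<close>, which is finite for
  trivial reasons.  Comparison with the walk killed outside a ball of radius \<open>e(x,Lk)\<close>, from which
  the walk rarely escapes by time \<open>k\<close>, gives \<open>S \<le> C + S/2\<close> with \<open>C\<close> independent of \<open>N\<close>.\<close>

lemma FKr_imp_DUEr:
  assumes FK: "FKr C \<delta>" and C: "0 < C" "0 < \<delta>"
  shows "\<exists>C>0. DUEr C"
proof -
  obtain Cv \<alpha>v where Cv: "1 \<le> Cv" "0 < \<alpha>v"
    "\<And>x r R. 0 < r \<Longrightarrow> r \<le> R \<Longrightarrow> V x R \<le> Cv * (R / r) powr \<alpha>v * V x r"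
    using V_scale by blast
  obtain Cc \<alpha> where Cc: "1 \<le> Cc" "0 < \<alpha>" "\<And>x v k j R. 1 \<le> k \<Longrightarrow> k \<le> 4 * j \<Longrightarrow> 1 \<le> R \<Longrightarrow> real (d x v) \<le> R \<Longrightarrow>
     V x (real (e x k)) \<le> Cc * (1 + Er x R / real k) powr \<alpha> * V v (real (e v j))"
    using V_compare by blast
  obtain C1 where C1: "1 \<le> C1" "\<And>x n. 1 \<le> n \<Longrightarrow> Er x (real (e x n)) \<le> C1 * real n"
    using Er_e_le by blast
  obtain Cx cx \<beta> where Cx: "0 < Cx" "0 < cx" "1 < \<beta>" "\<And>x R n. 1 \<le> R \<Longrightarrow> 1 \<le> n \<Longrightarrow>
     1 - surv (B x R) n x \<le> Cx * exp (- cx * (Er x R / real n) powr (1 / (\<beta> - 1)))"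
    using exit_estimate by blast
  define g where "g = 1 / (\<beta> - 1)"
  have g: "0 < g"
    using Cx by (simp add: g_def)
  have "0 < \<alpha> + 1"
    using Cc by simp
  from powr_exp_bounded[OF Cx(2) g this] obtain M where M: "0 < M" "\<And>t. t \<ge> 0 \<Longrightarrow> (1 + t) powr (\<alpha> + 1) * exp (- cx * t powr g) \<le> M"
    by blast
  \<comment> \<open>\<open>W\<close> grows in \<open>L\<close> like a power with exponent \<alpha>.
    Since \<open>M\<close> controls exponent \<open>\<alpha> + 1\<close>, the product in
    \<open>eps\<close> decays like \<open>1 / (1 + L)\<close>, and \<open>L\<close> brings it below
    1/2.\<close>
  define L where "L = nat \<lceil>4 * (Cx * Cc * C1 powr \<alpha> * M)\<rceil> + 1"
  have L: "1 \<le> L" "4 * (Cx * Cc * C1 powr \<alpha> * M) \<le> 1 + real L"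
    unfolding L_def by linarith+
  define W where "W = Cc * (1 + C1 * real L) powr \<alpha>"
  have W: "0 < W"
  proof -
    have "0 \<le> C1 * real L"
      using C1(1) by simp
    then have "0 < 1 + C1 * real L"
      by linarith
    then show ?thesis
      using Cc(1) by (simp add: W_def)
  qed
  have eps: "2 * (Cx * exp (- cx * real L powr g)) * W \<le> 1 / 2"
  proof -
    have "(1 + C1 * real L) powr \<alpha> \<le> (C1 * (1 + real L)) powr \<alpha>"
      using C1 Cc by (intro powr_mono2) (auto simp: algebra_simps add_nonneg_nonneg)
    also have "\<dots> = C1 powr \<alpha> * (1 + real L) powr \<alpha>"
      using C1 by (simp add: powr_mult)
    finally have "exp (- cx * real L powr g) * (1 + C1 * real L) powr \<alpha> * (1 + real L) \<le>
        exp (- cx * real L powr g) * (C1 powr \<alpha> * (1 + real L) powr \<alpha>) * (1 + real L)"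
      by (intro mult_right_mono mult_left_mono) auto
    also have "\<dots> = C1 powr \<alpha> * ((1 + real L) powr (\<alpha> + 1) * exp (- cx * real L powr g))"
      by (simp add: powr_add mult_ac)
    also have "\<dots> \<le> C1 powr \<alpha> * M"
      by (intro mult_left_mono M) auto
    finally have "2 * (Cx * Cc) * (exp (- cx * real L powr g) * (1 + C1 * real L) powr \<alpha> * (1 + real L)) \<le> 2 * (Cx * Cc) * (C1 powr \<alpha> * M)"
      using Cx Cc by (intro mult_left_mono) auto
    also have "\<dots> \<le> 1 / 2 * (1 + real L)"
      using L by (simp add: mult_ac)
    finally have "(2 * (Cx * exp (- cx * real L powr g)) * W) * (1 + real L) \<le> 1 / 2 * (1 + real L)"
      by (simp add: W_def mult_ac)
    then show ?thesis
      by (rule mult_right_le_imp_le) simp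
  qed
  define CL where "CL = 16 * (16 * C * C1 * real L / \<delta>) powr (1 / \<delta>)"
  have CL: "0 \<le> CL"
    by (simp add: CL_def)
  have "pe k x * V x (real (e x k)) \<le> 2 * (1 + CL)" if "1 \<le> k" for x k
  proof -
    \<comment> \<open>The given time becomes the horizon; below, \<open>k\<close> is bound afresh
      and ranges over \<open>1..N\<close>.\<close>
    define N where "N = k"
    define I where "I = (\<lambda>(x, k). pe k x * V x (real (e x k))) ` (UNIV \<times> {1..N})"
    define S where "S = Sup I"
    have bdd: "bdd_above I"
      unfolding bdd_above_def
    proof (intro exI[of _ "Cv * real N powr \<alpha>v"] ballI)
      fix i assume "i \<in> I"
      then obtain x k where k: "1 \<le> k" "k \<le> N" and i: "i = pe k x * V x (real (e x k))"
        by (auto simp: I_def)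
      have "V x (real (e x k)) \<le> V x (real N)"
        using e_le_self[of x k] k by (intro V_mono) simp
      also have "\<dots> \<le> Cv * (real N / 1) powr \<alpha>v * V x 1"
        using k by (intro Cv(3)) auto
      finally have "pe k x * V x (real (e x k)) \<le> 1 / \<mu> x * (Cv * (real N / 1) powr \<alpha>v * V x 1)"
        using V_e_pos[OF k(1), of x] pe_le_inverse[of k x] \<mu>_pos[of x]
        by (intro mult_mono) auto
      then show "i \<le> Cv * real N powr \<alpha>v"
        using i by (simp add: V_1)
    qed
    have S_upper: "pe k x \<le> S / V x (real (e x k))" if "1 \<le> k" "k \<le> N" for k x
    proof -
      have "pe k x * V x (real (e x k)) \<le> S"
        unfolding S_def using that by (intro cSup_upper bdd) (auto simp: I_def)
      then show ?thesis
        using V_e_pos[OF that(1), of x] by (simp add: field_simps)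
    qed
    have S0: "0 \<le> S"
      using S_upper[of 1 x] pe_nonneg[of 1 x] V_e_pos[of 1 x] \<open>1 \<le> k\<close>
      by (auto simp: N_def zero_le_divide_iff dest: order_trans)
    have main: "pe k x * V x (real (e x k)) \<le> 1 + CL + S / 2" if k: "1 \<le> k" "k \<le> N" for k x
    proof (cases "k = 1")
      case True
      have "pe 1 x * V x (real (e x 1)) \<le> 1 / \<mu> x * \<mu> x"
        unfolding e_1 using pe_le_inverse[of 1 x] by (intro mult_mono) (auto simp: V_1 \<mu>_nonneg)
      then show ?thesis
        using True CL S0 by simp
    next
      case False
      define j where "j = k div 2"
      have j: "1 \<le> j" "k \<le> 4 * j" "j \<le> k"
        using k False unfolding j_def by presburger+
      define R where "R = e x (L * k)"
      have Lk: "1 \<le> L * k"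
        using L k by simp
      have R1: "1 \<le> R"
        using e_pos[of "L * k" x] Lk by (simp add: R_def)
      let ?A = "B x (real R)" and ?V = "V x (real (e x k))"
      have Vp: "0 < ?V"
        using k by (intro V_e_pos)
      have ER: "real (L * k) \<le> Er x (real R)" "Er x (real R) \<le> C1 * real (L * k)"
        unfolding R_def by (rule e_ge, rule C1(2)[OF Lk])
      have ERk: "Er x (real R) / real k \<le> C1 * real L"
        using ER(2) k by (simp add: field_simps)
      have pe_j: "pe j v \<le> S * W / ?V" if v: "real (d x v) \<le> real R" for v
      proof -
        have "?V \<le> Cc * (1 + Er x (real R) / real k) powr \<alpha> * V v (real (e v j))"
          using k j R1 v by (intro Cc(3)) auto
        also have "\<dots> \<le> W * V v (real (e v j))"
          unfolding W_def using ERk Cc V_e_pos[OF j(1), of v] Er_nonneg[of x "real R"]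
          by (intro mult_right_mono mult_left_mono powr_mono2) (auto intro!: add_nonneg_nonneg)
        finally have VW: "?V \<le> W * V v (real (e v j))" .
        have "pe j v \<le> S / V v (real (e v j))"
          using j k by (intro S_upper) auto
        also have "\<dots> \<le> S * W / ?V"
          using mult_left_mono[OF VW S0] V_e_pos[OF j(1), of v] Vp by (simp add: field_simps)
        finally show ?thesis .
      qed
      have "p (2 * j) x x \<le> Q ?A (2 * j) (dens x) x + 2 * ((1 - surv ?A j x) * (S * W / ?V))"
      proof (rule p_even_exit_le)
        show "x \<in> ?A"
          using R1 by (intro center_B) simp
        fix i v z assume "j \<le> i" "z \<in> ?A" "v \<in> nb z"
        then have "real (d x v) < real R + 1"
          by (intro bdry_dist)
        then have "d x v \<le> R"
          by linarith
        then show "p i v x \<le> S * W / ?V"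
          using \<open>j \<le> i\<close> by (intro p_le_of_pe[of j] pe_j) auto
      qed
      moreover have "Q ?A (2 * j) (dens x) x \<le> CL / ?V"
      proof -
        \<comment> \<open>The radius \<open>R / 3\<close> makes the reference ball of (FK) the
          killing ball itself.\<close>
        have "Q ?A (2 * j) (dens x) x \<le>
            16 / V x (3 * (real R / 3)) * (4 * C * Er x (real R / 3) / (\<delta> * real j)) powr (1 / \<delta>)"
          using R1 j by (intro FKr_heat_kernel[OF FK C]) (auto simp: center_B)
        also have "\<dots> \<le> 16 / ?V * (16 * C * C1 * real L / \<delta>) powr (1 / \<delta>)"
        proof (intro mult_mono powr_mono2)
          have "e x k \<le> e x (L * k)"
            using L by (intro e_mono) simp
          then have "?V \<le> V x (real R)"
            by (intro V_mono) (simp add: R_def)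
          then show "16 / V x (3 * (real R / 3)) \<le> 16 / ?V"
            using Vp by (simp add: frac_le)
          have "Er x (real R / 3) \<le> Er x (real R)"
            by (intro Er_mono) simp
          also have "\<dots> \<le> C1 * real (L * k)"
            by (rule ER)
          also have "\<dots> \<le> C1 * (real L * (4 * real j))"
            using j C1 by (simp add: mult_left_mono)
          finally have "4 * C * Er x (real R / 3) \<le> 4 * C * (C1 * (real L * (4 * real j)))"
            using C by (intro mult_left_mono) auto
          then show "4 * C * Er x (real R / 3) / (\<delta> * real j) \<le> 16 * C * C1 * real L / \<delta>"
            using C j by (simp add: field_simps)
        qed (use C Vp j Er_nonneg[of x "real R / 3"] in auto)
        finally show ?thesis
          by (simp add: CL_def)
      qed
      moreover have "2 * ((1 - surv ?A j x) * (S * W / ?V)) \<le> S / 2 / ?V"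
      proof -
        have "real L * real j \<le> Er x (real R)"
          using ER(1) mult_left_mono[of "real j" "real k" "real L"] j by simp
        then have "real L \<le> Er x (real R) / real j"
          using j by (simp add: field_simps)
        then have "real L powr g \<le> (Er x (real R) / real j) powr g"
          using g by (intro powr_mono2) auto
        then have "exp (- cx * (Er x (real R) / real j) powr g) \<le> exp (- cx * real L powr g)"
          using Cx by simp
        then have "Cx * exp (- cx * (Er x (real R) / real j) powr g) \<le> Cx * exp (- cx * real L powr g)"
          using Cx by (intro mult_left_mono) auto
        with Cx(4)[of "real R" j x] have "1 - surv ?A j x \<le> Cx * exp (- cx * real L powr g)"
          using R1 j by (simp add: g_def)
        then have "2 * (1 - surv ?A j x) * W \<le> 2 * (Cx * exp (- cx * real L powr g)) * W"
          using W by (intro mult_right_mono mult_left_mono) auto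
        with eps have "2 * (1 - surv ?A j x) * W \<le> 1 / 2"
          by linarith
        then have "(2 * (1 - surv ?A j x) * W) * (S / ?V) \<le> 1 / 2 * (S / ?V)"
          using S0 Vp by (intro mult_right_mono) auto
        then show ?thesis
          by (simp add: mult_ac)
      qed
      ultimately have "pe k x \<le> (CL + S / 2) / ?V"
        by (simp add: pe_def j_def add_divide_distrib)
      then show ?thesis
        using Vp by (simp add: field_simps)
    qed
    have "Sup I \<le> 1 + CL + S / 2"
    proof (rule cSup_least)
      show "I \<noteq> {}"
        using \<open>1 \<le> k\<close> by (auto simp: I_def N_def)
      fix i assume "i \<in> I"
      then show "i \<le> 1 + CL + S / 2"
        using main by (auto simp: I_def)
    qed
    then have "S \<le> 2 * (1 + CL)"
      by (simp add: S_def[symmetric])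
    then show ?thesis
      using S_upper[of k x] that V_e_pos[OF that, of x] by (simp add: N_def field_simps)
  qed
  then have "DUEr (2 * (1 + CL))"
    unfolding DUEr_def using V_e_pos by (auto simp: pos_le_divide_eq)
  then show ?thesis
    using CL by (intro exI[of _ "2 * (1 + CL)"]) auto
qed

text \<open>In the main case \<open>2 \<le> d x y \<le> n\<close>, leaving a ball of radius
  \<open>d x y / 2\<close> costs \<open>exp (- 2 * c * t powr g)\<close>, while moving the
  on-diagonal bound to points within \<open>2 * d x y\<close> loses a power of \<open>1 + t\<close>;
  one of the two copies of \<open>exp (- c * t powr g)\<close> absorbs that loss. For neighbours or
  \<open>x = y\<close> the exponential is bounded below, and for \<open>n < d x y\<close> the kernel
  vanishes.\<close>

lemma DUEr_imp_UE:
  assumes DUE: "DUEr C0" and C0: "1 \<le> C0"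
  shows cond_UE
proof -
  obtain Ce \<beta>e where Ce: "1 \<le> Ce" "1 < \<beta>e"
    "\<And>x y r R. 0 < r \<Longrightarrow> r \<le> R \<Longrightarrow> real (d x y) < R \<Longrightarrow> Er y R \<le> Ce * (R / r) powr \<beta>e * Er x r"
    using Er_scale by blast
  obtain Cc \<alpha> where Cc: "1 \<le> Cc" "0 < \<alpha>" "\<And>x v k j R. 1 \<le> k \<Longrightarrow> k \<le> 4 * j \<Longrightarrow> 1 \<le> R \<Longrightarrow> real (d x v) \<le> R \<Longrightarrow>
     V x (real (e x k)) \<le> Cc * (1 + Er x R / real k) powr \<alpha> * V v (real (e v j))"
    using V_compare by blast
  obtain Cx cx \<beta> where Cx: "0 < Cx" "0 < cx" "1 < \<beta>" "\<And>x R n. 1 \<le> R \<Longrightarrow> 1 \<le> n \<Longrightarrow>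
     1 - surv (B x R) n x \<le> Cx * exp (- cx * (Er x R / real n) powr (1 / (\<beta> - 1)))"
    using exit_estimate by blast
  obtain c0 where c0: "1 \<le> c0" "\<And>x. Er x 1 \<le> c0"
    using Er_1_le by blast
  define g where "g = 1 / (\<beta> - 1)"
  have g: "0 < g"
    using Cx by (simp add: g_def)
  define C5 where "C5 = Ce * 4 powr \<beta>e"
  have C5: "1 \<le> C5"
  proof -
    have "1 * 1 \<le> Ce * 4 powr \<beta>e"
      using Ce by (intro mult_mono) (auto intro: ge_one_powr_ge_zero)
    then show ?thesis
      by (simp add: C5_def)
  qed
  \<comment> \<open>\<open>C5\<close> compares \<open>E(x,D)\<close> with mean exit times at radius
    \<open>D / 2\<close> around both end points; the half is kept in reserve to absorb the power of
    \<open>1 + t\<close>.\<close>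
  define c where "c = cx * (1 / C5) powr g / 2"
  have c: "0 < c"
    using Cx C5 by (simp add: c_def)
  obtain M where M: "0 < M" "\<And>t. t \<ge> 0 \<Longrightarrow> (1 + t) powr \<alpha> * exp (- c * t powr g) \<le> M"
    using powr_exp_bounded[OF c g Cc(2)] by blast
  define Ca where "Ca = C0 * (Cc * (1 + c0) powr \<alpha>) * exp (c * c0 powr g)"
  define Cb where "Cb = 2 * Cx * C0 * Cc * C5 powr \<alpha> * M"
  have Cab: "0 < Ca" "0 < Cb"
    using C0 Cc c0 Cx C5 M by (auto simp: Ca_def Cb_def)
  have pe_le: "pe k v \<le> C0 * (Cc * (1 + Er x R / real n) powr \<alpha>) / V x (real (e x n))"
    if "1 \<le> k" "1 \<le> n" "n \<le> 4 * k" "1 \<le> R" "real (d x v) \<le> R" for k v x n R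
  proof -
    have le: "V x (real (e x n)) \<le> Cc * (1 + Er x R / real n) powr \<alpha> * V v (real (e v k))"
      using that by (intro Cc(3)) auto
    have "pe k v \<le> C0 / V v (real (e v k))"
      using DUE that by (auto simp: DUEr_def)
    also have "\<dots> \<le> C0 * (Cc * (1 + Er x R / real n) powr \<alpha>) / V x (real (e x n))"
      using mult_left_mono[OF le, of C0] C0 V_e_pos[OF that(1), of v] V_e_pos[OF that(2), of x]
      by (simp add: field_simps)
    finally show ?thesis .
  qed
  have bound: "p n x y \<le> max Ca Cb / V x (real (e x n)) *
      exp (- c * (Er x (real (d x y)) / real n) powr g)" if n: "1 \<le> n" for n x y
  proof -
    define D where "D = d x y"
    define t where "t = Er x (real D) / real n"
    have t: "0 \<le> t"
      by (simp add: t_def Er_nonneg)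
    let ?V = "V x (real (e x n))"
    have Vp: "0 < ?V"
      using n by (rule V_e_pos)
    consider "D \<le> 1" | "n < D" | "2 \<le> D" "D \<le> n"
      by linarith
    then have "p n x y \<le> max Ca Cb / ?V * exp (- c * t powr g)"
    proof cases
      case 1
      have tc: "t \<le> c0"
      proof -
        have "Er x (real D) \<le> Er x 1"
          using 1 by (intro Er_mono) simp
        also have "\<dots> \<le> c0"
          by (rule c0)
        also have "\<dots> \<le> c0 * real n"
          using c0(1) n by simp
        finally show ?thesis
          using n by (simp add: t_def field_simps)
      qed
      have "p n x y \<le> C0 * (Cc * (1 + Er x 1 / real n) powr \<alpha>) / ?V"
        using n 1 by (intro p_le_of_pe[of n] pe_le) (auto simp: D_def)
      also have "\<dots> \<le> C0 * (Cc * (1 + c0) powr \<alpha>) / ?V"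
      proof (intro divide_right_mono mult_left_mono powr_mono2)
        have "Er x 1 / real n \<le> Er x 1 / 1"
          using n Er_nonneg[of x 1] by (intro divide_left_mono) auto
        then show "1 + Er x 1 / real n \<le> 1 + c0"
          using c0(2)[of x] by simp
      qed (use Cc C0 Vp Er_nonneg[of x 1] in \<open>auto intro!: add_nonneg_nonneg\<close>)
      also have "\<dots> = Ca / ?V * exp (- (c * c0 powr g))"
        by (simp add: Ca_def exp_minus field_simps)
      also have "\<dots> \<le> max Ca Cb / ?V * exp (- c * t powr g)"
      proof (intro mult_mono divide_right_mono)
        have "t powr g \<le> c0 powr g"
          using t tc g by (intro powr_mono2) auto
        then show "exp (- (c * c0 powr g)) \<le> exp (- c * t powr g)"
          using c by simp
      qed (use Vp Cab in auto)
      finally show ?thesis .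
    next
      case 2
      then show ?thesis
        using Cab Vp by (simp add: p_eq_0 D_def)
    next
      case 3
      define a where "a = n div 2"
      define b where "b = n - a"
      have ab: "1 \<le> a" "a \<le> b" "n = a + b" "n \<le> 4 * a"
        using 3 unfolding a_def b_def by presburger+
      define R where "R = real D / 2"
      have R: "1 \<le> R" "2 * R = real D"
        using 3 by (auto simp: R_def)
      define S where "S = C0 * (Cc * (1 + Er x (2 * real D) / real n) powr \<alpha>) / ?V"
      have S0: "0 \<le> S"
        using C0 Cc Vp by (simp add: S_def)
      have pv: "pe a v \<le> S" if "real (d x v) \<le> 2 * real D" for v
        unfolding S_def using ab n 3 that by (intro pe_le) auto
      have y: "real (d x y) \<le> 2 * real D" and x: "real (d x x) \<le> 2 * real D"
        by (simp_all add: D_def)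
      have "p n x y \<le> (1 - surv (B x R) a x) * S + (1 - surv (B y R) b y) * S"
        unfolding ab(3)
      proof (rule p_off_diagonal_le)
        fix k v z assume k: "b \<le> k" and "z \<in> B x R" "v \<in> nb z"
        then have "real (d x v) < R + 1"
          by (intro bdry_dist)
        then show "p k v y \<le> S"
          using R 3 k ab y by (intro p_le_of_pe[of a] pv) auto
      next
        fix k v z assume k: "a \<le> k" and "z \<in> B y R" "v \<in> nb z"
        then have "real (d y v) < R + 1"
          by (intro bdry_dist)
        moreover have "real (d x v) \<le> real D + real (d y v)"
          using d_triangle[of x v y] by (simp add: D_def)
        ultimately have "real (d x v) \<le> 2 * real D"
          using R 3 by linarith
        then show "p k v x \<le> S"
          using k x by (intro p_le_of_pe[of a] pv) auto
      qed (use R in \<open>auto simp: D_def\<close>)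
      moreover have exit: "1 - surv (B v R) m v \<le> Cx * exp (- (2 * c) * t powr g)"
        if m: "1 \<le> m" "m \<le> n" and v: "Er x (real D) \<le> C5 * Er v R" for m v
      proof -
        have "t / C5 \<le> Er v R / real n"
          using v n C5 by (simp add: t_def field_simps)
        also have "\<dots> \<le> Er v R / real m"
          using m Er_nonneg[of v R] by (intro divide_left_mono) auto
        finally have "(t / C5) powr g \<le> (Er v R / real m) powr g"
          using t C5 g by (intro powr_mono2) auto
        moreover have "2 * c * t powr g = cx * (t / C5) powr g"
          using t C5 by (simp add: c_def powr_divide)
        ultimately have "2 * c * t powr g \<le> cx * (Er v R / real m) powr g"
          using Cx by simp
        then have "Cx * exp (- cx * (Er v R / real m) powr g) \<le> Cx * exp (- (2 * c) * t powr g)"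
          using Cx by simp
        with Cx(4)[OF R(1) m(1), of v] show ?thesis
          by (simp add: g_def)
      qed
      moreover have "Er x (real D) \<le> C5 * Er x R"
      proof -
        have "Er x (real D) \<le> Er x (2 * real D)"
          by (intro Er_mono) simp
        also have "\<dots> \<le> Ce * (2 * real D / R) powr \<beta>e * Er x R"
          using R 3 by (intro Ce(3)) auto
        finally show ?thesis
          using 3 by (simp add: R_def C5_def)
      qed
      moreover have "Er x (real D) \<le> C5 * Er y R"
      proof -
        have "Er x (real D) \<le> Er x (2 * real D)"
          by (intro Er_mono) simp
        also have "\<dots> \<le> Ce * (2 * real D / R) powr \<beta>e * Er y R"
          using R 3 by (intro Ce(3)) (auto simp: D_def d_sym)
        finally show ?thesis
          using 3 by (simp add: R_def C5_def)
      qed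
      ultimately have "p n x y \<le> Cx * exp (- (2 * c) * t powr g) * S + Cx * exp (- (2 * c) * t powr g) * S"
        using ab S0 by (smt (verit) mult_right_mono le_add1 le_add2 order_trans)
      also have "\<dots> = 2 * Cx * exp (- (2 * c) * t powr g) * S"
        by simp
      also have "S \<le> C0 * (Cc * (C5 powr \<alpha> * (1 + t) powr \<alpha>)) / ?V"
        unfolding S_def
      proof (intro divide_right_mono mult_left_mono)
        have "Er x (2 * real D) \<le> Ce * (2 * real D / real D) powr \<beta>e * Er x (real D)"
          using 3 by (intro Ce(3)) auto
        also have "\<dots> \<le> C5 * Er x (real D)"
          unfolding C5_def using 3 Ce by (intro mult_right_mono mult_left_mono powr_mono2 Er_nonneg) auto
        finally have "Er x (2 * real D) / real n \<le> C5 * t"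
          using n by (simp add: t_def field_simps)
        then have "1 + Er x (2 * real D) / real n \<le> C5 * (1 + t)"
          using C5 by (simp add: algebra_simps)
        then have "(1 + Er x (2 * real D) / real n) powr \<alpha> \<le> (C5 * (1 + t)) powr \<alpha>"
          using Cc by (intro powr_mono2) (auto simp: Er_nonneg)
        then show "(1 + Er x (2 * real D) / real n) powr \<alpha> \<le> C5 powr \<alpha> * (1 + t) powr \<alpha>"
          using C5 t by (simp add: powr_mult)
      qed (use Cc C0 Vp in auto)
      finally have "p n x y \<le> 2 * Cx * exp (- (2 * c) * t powr g) * (C0 * (Cc * (C5 powr \<alpha> * (1 + t) powr \<alpha>)) / ?V)"
        using Cx by (simp add: mult_left_mono)
      also have "exp (- (2 * c) * t powr g) = exp (- c * t powr g) * exp (- c * t powr g)"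
        by (simp flip: exp_add)
      also have "2 * Cx * (exp (- c * t powr g) * exp (- c * t powr g)) * (C0 * (Cc * (C5 powr \<alpha> * (1 + t) powr \<alpha>)) / ?V) =
          2 * Cx * C0 * Cc * C5 powr \<alpha> * ((1 + t) powr \<alpha> * exp (- c * t powr g)) / ?V * exp (- c * t powr g)"
        by (simp add: mult_ac)
      also have "\<dots> \<le> Cb / ?V * exp (- c * t powr g)"
        unfolding Cb_def using M(2)[OF t] Cx C0 Cc C5 Vp
        by (intro mult_right_mono divide_right_mono mult_left_mono) auto
      also have "\<dots> \<le> max Ca Cb / ?V * exp (- c * t powr g)"
        using Vp by (intro mult_right_mono divide_right_mono) auto
      finally show ?thesis .
    qed
    then show ?thesis
      by (simp add: t_def D_def)
  qed
  show ?thesis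
    unfolding cond_UE_def
  proof (intro conjI VD TC)
    show "\<exists>c>0. \<exists>C>0. \<exists>\<beta>>1. \<forall>x y n. n \<ge> 1 \<longrightarrow> p n x y \<le> C / V x (real (e x n)) *
        exp (- c * (enn2real (E x (real (d x y))) / real n) powr (1 / (\<beta> - 1)))"
      using bound c Cab Cx(3) unfolding g_def
      by (intro exI[of _ c] conjI exI[of _ "max Ca Cb"] exI[of _ \<beta>]) (auto simp: E_eq Er_nonneg)
  qed
qed

end

section \<open>The implications between the conditions\<close>

context weighted_graph_p0 begin

lemma doubling_graphI: "cond_VD \<Longrightarrow> cond_TC \<Longrightarrow> doubling_graph w"
  by unfold_locales

lemma E_imp_FK: "cond_E \<Longrightarrow> cond_FK"
  unfolding cond_E_iff cond_FK_iff using Eexit_imp_FKr by blast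

lemma FK_imp_E:
  assumes cond_FK
  shows cond_E
proof -
  obtain C \<delta> where C: "0 < C" "0 < \<delta>" "FKr C \<delta>"
    using assms cond_FK_iff by blast
  have "0 < (8 * 64 powr \<delta> / \<delta> + 2) * C"
    using C by (intro mult_pos_pos add_pos_pos) auto
  then show ?thesis
    unfolding cond_E_iff using FKr_imp_Eexit[OF C(3,1,2)] C(2) by blast
qed

lemma rho_imp_FK:
  assumes cond_rho
  shows cond_FK
proof -
  obtain C \<delta> where C: "0 < C" "0 < \<delta>" "capr C \<delta>"
    using cond_rho_imp_capr[OF assms] by blast
  then have "FKr (16 * C) \<delta>"
    by (intro capr_imp_FKr)
  then show ?thesis
    unfolding cond_FK_iff using C by (intro exI[of _ "16 * C"] conjI exI[of _ \<delta>]) auto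
qed

text \<open>The detour through (E) supplies (VD) and (TC), on which the passage from killed to full
  kernels rests.\<close>

lemma FK_imp_DUE:
  assumes cond_FK
  shows cond_DUE
proof -
  obtain C \<delta> where C: "0 < C" "0 < \<delta>" "Eexit C \<delta>"
    using FK_imp_E[OF assms] cond_E_iff by blast
  interpret doubling_graph w
    using Eexit_imp_VD[OF C(3,1,2)] Eexit_imp_TC[OF C(3)] by (rule doubling_graphI)
  show ?thesis
    using FKr_imp_DUEr[OF Eexit_imp_FKr[OF C(3)] C(1,2)] DUEr_imp_DUE by blast
qed

lemma DUE_imp_E_UE:
  assumes cond_DUE
  shows "cond_E \<and> cond_UE"
proof -
  interpret doubling_graph w
    using assms by (intro doubling_graphI) (simp_all add: cond_DUE_def)
  obtain C where "1 \<le> C" "DUEr C"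
    using DUE_imp_DUEr[OF assms] by blast
  then show ?thesis
    using DUEr_imp_Eexit DUEr_imp_UE cond_E_iff by blast
qed

end

theorem theorem2p1:
  fixes w :: "'a \<Rightarrow> 'a \<Rightarrow> real"
  assumes "weighted_graph w"
    and "weighted_graph.cond_p0 w"
  shows "(weighted_graph.cond_E w \<longleftrightarrow> weighted_graph.cond_FK w)
       \<and> (weighted_graph.cond_FK w \<longleftrightarrow> weighted_graph.cond_rho w)
       \<and> (weighted_graph.cond_rho w \<longleftrightarrow> weighted_graph.cond_DUE w)
       \<and> (weighted_graph.cond_DUE w \<longleftrightarrow> weighted_graph.cond_UE w)"
proof -
  interpret weighted_graph_p0 w
    using assms by (intro weighted_graph_p0.intro weighted_graph_p0_axioms.intro)
  show ?thesis
    using E_imp_FK FK_imp_E FK_imp_rho rho_imp_FK FK_imp_DUE DUE_imp_E_UE UE_imp_DUE by blast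
qed

end
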